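(* Let $S$ be a closed nonorientable surface with $\chi(S)<0$, endowed with an auxiliary hyperbolic metric. Let $\lambda\in\mathcal{ML}^-(S)$ be a measured lamination with a one-sided closed leaf $\gamma$. For any integer $k\ge 1$ there exists a neighborhood $U_k$ of $\lambda$ in the space of geodesic currents $\mathcal C(S)$ such that for any geodesic current $c\in U_k$ there exists a geodesic $\delta\in\mathrm{supp}(c)$ whose projection to $S$ is either $\gamma$ or a geodesic with at least $k$ self-intersections.
   Context: Let $\tilde S$ be the universal cover of $S$ with boundary at infinity $\tilde S_\infty$. The space of geodesics of $\tilde S$ is $\mathcal G(\tilde S)=(\tilde S_\infty\times\tilde S_\infty-\text{diagonal})/(\mathbf Z/2\mathbf Z)$ (unordered pairs of distinct endpoints). A geodesic current is a $\pi_1(S)$-invariant positive Radon measure on $\mathcal G(\tilde S)$; $\mathcal C(S)$ is the space of geodesic currents with the weak$^*$ topology, and $\mathrm{supp}(c)\subset\mathcal G(\tilde S)$ is the support of $c$. A primitive closed geodesic $\gamma$ is identified with the current given by the sum of Dirac masses at all its lifts, and this extends to the standard topological embedding of the space of measured laminations $\mathcal{ML}(S)$ into $\mathcal C(S)$. $\mathcal{ML}^-(S)\subset\mathcal{ML}(S)$ is the subset of measured laminations having a closed one-sided leaf. The projection of $\delta$ to $S$ is not required to be closed. *)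

theory Defs
  imports "HOL-Complex_Analysis.Complex_Analysis"
begin

section \<open>The hyperbolic plane\<close>

text \<open>Poincare disc model: the plane is \<open>ball 0 1\<close> in the complex numbers, with curvature -1, and
  its boundary at infinity is the unit circle \<open>sphere 0 1\<close>.\<close>

definition hdist :: "complex \<Rightarrow> complex \<Rightarrow> real" where
  "hdist z w = arcosh (1 + 2 * (cmod (z - w))\<^sup>2 / ((1 - (cmod z)\<^sup>2) * (1 - (cmod w)\<^sup>2)))"

text \<open>The formulas for the isometries of the disc make sense on the closed disc, so the same functions
  also give the action on the boundary at infinity. Their values outside the closed disc play
  no role.\<close>

definition preserving_isometries :: "(complex \<Rightarrow> complex) set" where
  "preserving_isometries = {Moebius_function t w | t w. cmod w < 1}"

definition reversing_isometries :: "(complex \<Rightarrow> complex) set" where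
  "reversing_isometries = {Moebius_function t w \<circ> cnj | t w. cmod w < 1}"

text \<open>A geodesic is the unordered pair of its endpoints, so that an isometry \<open>g\<close> maps the geodesic
  \<open>x\<close> to the image \<open>g ` x\<close>.\<close>

type_synonym geodesic = "complex set"

definition geodesics :: "geodesic set" where
  "geodesics = {{a, b} | a b. a \<in> sphere 0 1 \<and> b \<in> sphere 0 1 \<and> a \<noteq> b}"

text \<open>The points of the disc on the geodesic \<open>x\<close>: the image of the diameter from \<open>-1\<close> to \<open>1\<close> under
  any orientation-preserving isometry taking the endpoints of the diameter to those of \<open>x\<close>.\<close>

definition hyp_line :: "geodesic \<Rightarrow> complex set" where
  "hyp_line x = {m (of_real t) | m t. m \<in> preserving_isometries \<and> m ` {-1, 1} = x \<and> -1 < t \<and> t < 1}"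

definition endpoint_pairs :: "(complex \<times> complex) set" where
  "endpoint_pairs = {(a, b). a \<in> sphere 0 1 \<and> b \<in> sphere 0 1 \<and> a \<noteq> b}"

text \<open>The quotient topology of the space of ordered pairs by the swap of the two factors.\<close>

definition geodesic_topology :: "geodesic topology" where
  "geodesic_topology = topology (\<lambda>U. U \<subseteq> geodesics \<and>
     openin (top_of_set endpoint_pairs) {(a, b) \<in> endpoint_pairs. {a, b} \<in> U})"

lemma openin_geodesic_topology:
  "openin geodesic_topology U \<longleftrightarrow> U \<subseteq> geodesics \<and>
     openin (top_of_set endpoint_pairs) {(a, b) \<in> endpoint_pairs. {a, b} \<in> U}"
proof -
  have "istopology (\<lambda>U. U \<subseteq> geodesics \<and>
     openin (top_of_set endpoint_pairs) {(a, b) \<in> endpoint_pairs. {a, b} \<in> U})"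
    unfolding istopology_def
  proof (intro conjI allI impI)
    fix S T :: "geodesic set"
    assume S: "S \<subseteq> geodesics \<and> openin (top_of_set endpoint_pairs) {(a, b) \<in> endpoint_pairs. {a, b} \<in> S}"
      and T: "T \<subseteq> geodesics \<and> openin (top_of_set endpoint_pairs) {(a, b) \<in> endpoint_pairs. {a, b} \<in> T}"
    have "{(a, b) \<in> endpoint_pairs. {a, b} \<in> S \<inter> T}
        = {(a, b) \<in> endpoint_pairs. {a, b} \<in> S} \<inter> {(a, b) \<in> endpoint_pairs. {a, b} \<in> T}"
      by auto
    with S T show "openin (top_of_set endpoint_pairs) {(a, b) \<in> endpoint_pairs. {a, b} \<in> S \<inter> T}"
      by (simp add: openin_Int)
    show "S \<inter> T \<subseteq> geodesics" using S by auto
  next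
    fix \<K> :: "geodesic set set"
    assume K: "\<forall>K\<in>\<K>. K \<subseteq> geodesics \<and>
      openin (top_of_set endpoint_pairs) {(a, b) \<in> endpoint_pairs. {a, b} \<in> K}"
    have "{(a, b) \<in> endpoint_pairs. {a, b} \<in> \<Union>\<K>}
        = (\<Union>K\<in>\<K>. {(a, b) \<in> endpoint_pairs. {a, b} \<in> K})"
      by auto
    with K show "openin (top_of_set endpoint_pairs) {(a, b) \<in> endpoint_pairs. {a, b} \<in> \<Union>\<K>}"
      by auto
    show "\<Union>\<K> \<subseteq> geodesics" using K by auto
  qed
  then show ?thesis
    by (simp add: geodesic_topology_def topology_inverse')
qed

lemma topspace_geodesic_topology [simp]: "topspace geodesic_topology = geodesics"
proof
  show "topspace geodesic_topology \<subseteq> geodesics"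
    using openin_geodesic_topology by blast
  have "{(a, b) \<in> endpoint_pairs. {a, b} \<in> geodesics} = endpoint_pairs"
    by (auto simp: endpoint_pairs_def geodesics_def)
  then have "openin geodesic_topology geodesics"
    by (simp add: openin_geodesic_topology)
  then show "geodesics \<subseteq> topspace geodesic_topology"
    by (rule openin_subset)
qed

section \<open>Closed hyperbolic surfaces\<close>

text \<open>A closed hyperbolic surface is a compact space \<open>S\<close> (a subset of a metric space) whose metric is locally
  that of the hyperbolic plane. Its universal cover, with the pulled back metric, is the hyperbolic
  plane, so the projection \<open>p\<close> from the disc is a covering map and a local isometry. Conversely,
  such a \<open>p\<close> makes \<open>S\<close> a connected closed surface with a hyperbolic metric, and then
  the Euler characteristic of \<open>S\<close> is negative by the Gauss-Bonnet theorem.\<close>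

definition closed_hyperbolic_surface :: "'s::metric_space set \<Rightarrow> (complex \<Rightarrow> 's) \<Rightarrow> bool" where
  "closed_hyperbolic_surface S p \<longleftrightarrow>
     compact S \<and> covering_space (ball 0 1) p S \<and>
     (\<forall>z \<in> ball 0 1. \<exists>e > 0. \<forall>u \<in> ball 0 1. \<forall>v \<in> ball 0 1.
        hdist z u < e \<and> hdist z v < e \<longrightarrow> dist (p u) (p v) = hdist u v)"

text \<open>The fundamental group of \<open>S\<close>, acting on the universal cover; deck transformations of a locally
  isometric covering are isometries.\<close>

definition deck_group :: "(complex \<Rightarrow> 's) \<Rightarrow> (complex \<Rightarrow> complex) set" where
  "deck_group p = {g \<in> preserving_isometries \<union> reversing_isometries. \<forall>z \<in> ball 0 1. p (g z) = p z}"

definition nonorientable_surface :: "(complex \<Rightarrow> 's) \<Rightarrow> bool" where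
  "nonorientable_surface p \<longleftrightarrow> deck_group p \<inter> reversing_isometries \<noteq> {}"

definition projection :: "(complex \<Rightarrow> 's) \<Rightarrow> geodesic \<Rightarrow> 's set" where
  "projection p x = p ` hyp_line x"

text \<open>The lifts of the projection of \<open>x\<close> are the translates of \<open>x\<close> under the deck group. A
  self-intersection is a point of \<open>S\<close> over which two distinct lifts meet (necessarily transversely).
  A point through which several branches pass is counted once.\<close>

definition self_intersections :: "(complex \<Rightarrow> 's) \<Rightarrow> geodesic \<Rightarrow> 's set" where
  "self_intersections p x =
     {p q | q h. h \<in> deck_group p \<and> h ` x \<noteq> x \<and> q \<in> hyp_line x \<inter> hyp_line (h ` x)}"

text \<open>A geodesic of \<open>S\<close> is closed iff a lift is invariant under a nontrivial deck transformation. Deck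
  transformations act freely on the disc, so an orientation-reversing one with an invariant line is a
  glide reflection along it, and the projection is then a closed geodesic along which
  the orientation is reversed.\<close>

definition one_sided_closed_geodesic :: "(complex \<Rightarrow> 's) \<Rightarrow> 's set \<Rightarrow> bool" where
  "one_sided_closed_geodesic p \<gamma> \<longleftrightarrow>
     (\<exists>x \<in> geodesics. \<gamma> = projection p x \<and> (\<exists>g \<in> deck_group p \<inter> reversing_isometries. g ` x = x))"

section \<open>Geodesic currents\<close>

text \<open>The space of geodesics is locally compact and second countable, so a Borel measure that is finite
  on compact sets is automatically regular, i.e. Radon.\<close>

definition geodesic_currents :: "(complex \<Rightarrow> 's) \<Rightarrow> geodesic measure set" where
  "geodesic_currents p = {c.
     space c = geodesics \<and>
     sets c = sigma_sets geodesics {U. openin geodesic_topology U} \<and>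
     (\<forall>K. compactin geodesic_topology K \<longrightarrow> emeasure c K < \<infinity>) \<and>
     (\<forall>g \<in> deck_group p. \<forall>A \<in> sets c. emeasure c ((`) g ` A) = emeasure c A)}"

definition test_functions :: "(geodesic \<Rightarrow> real) set" where
  "test_functions = {f. continuous_map geodesic_topology euclideanreal f \<and>
     (\<exists>K. compactin geodesic_topology K \<and> (\<forall>x \<in> geodesics - K. f x = 0))}"

text \<open>The weak-star topology: the coarsest one for which integration of every test function
  is continuous.\<close>

definition current_topology :: "(complex \<Rightarrow> 's) \<Rightarrow> geodesic measure topology" where
  "current_topology p = topology_generated_by
     {{c \<in> geodesic_currents p. integral\<^sup>L c f \<in> V} | f V. f \<in> test_functions \<and> open V}"

lemma topspace_current_topology [simp]: "topspace (current_topology p) = geodesic_currents p"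
proof -
  have "(\<lambda>_. 0) \<in> test_functions"
    by (auto simp: test_functions_def intro!: exI[of _ "{}"])
  then have "\<exists>f V. geodesic_currents p = {c \<in> geodesic_currents p. integral\<^sup>L c f \<in> V}
      \<and> f \<in> test_functions \<and> open V"
    by (intro exI[of _ "\<lambda>_. 0"] exI[of _ UNIV]) auto
  then show ?thesis
    unfolding current_topology_def topology_generated_by_topspace by blast
qed

definition current_support :: "geodesic measure \<Rightarrow> geodesic set" where
  "current_support c =
     {x \<in> geodesics. \<forall>U. openin geodesic_topology U \<and> x \<in> U \<longrightarrow> emeasure c U > 0}"

section \<open>Measured laminations\<close>

text \<open>A geodesic lamination, a closed subset of \<open>S\<close> that is a disjoint union of simple complete
  geodesics, is represented by the set \<open>L\<close> of all lifts of its leaves.\<close>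

definition geodesic_lamination :: "(complex \<Rightarrow> 's) \<Rightarrow> geodesic set \<Rightarrow> bool" where
  "geodesic_lamination p L \<longleftrightarrow>
     closedin geodesic_topology L \<and>
     (\<forall>g \<in> deck_group p. \<forall>x \<in> L. g ` x \<in> L) \<and>
     (\<forall>x \<in> L. \<forall>y \<in> L. x \<noteq> y \<longrightarrow> hyp_line x \<inter> hyp_line y = {})"

text \<open>Measured laminations are identified with their images under the standard embedding in the space
  of currents: a transverse measure of full support on a lamination amounts to a current whose
  support is the set of lifts of the leaves.\<close>

definition measured_laminations :: "(complex \<Rightarrow> 's) \<Rightarrow> geodesic measure set" where
  "measured_laminations p = {c \<in> geodesic_currents p. geodesic_lamination p (current_support c)}"

definition leaves :: "(complex \<Rightarrow> 's) \<Rightarrow> geodesic measure \<Rightarrow> 's set set" where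
  "leaves p c = projection p ` current_support c"

definition one_sided_laminations :: "(complex \<Rightarrow> 's) \<Rightarrow> geodesic measure set" where
  "one_sided_laminations p =
     {c \<in> measured_laminations p. \<exists>\<gamma> \<in> leaves p c. one_sided_closed_geodesic p \<gamma>}"

end

theory Submission
  imports Defs
begin

text \<open>Choose a lift of \<open>\<gamma>\<close> in the support of \<open>lam\<close>; it is the axis of a glide reflection in the deck
  group, which is \<open>z \<mapsto> - l * cnj z\<close> with \<open>l > 1\<close> in the upper half-plane. If a geodesic has its ends at real
  \<open>a \<noteq> 0\<close> near \<open>0\<close> and \<open>b\<close> near \<open>\<infinity>\<close>, it crosses its images under many powers of the glide reflection: under
  the even powers if \<open>a * b > 0\<close> and under the odd ones if \<open>a * b < 0\<close>. The crossings have distinct distances to the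
  axis, and can be moved by powers of the glide reflection into a fixed compact set, on which the
  projection to the surface is boundedly finite to one. A current close to \<open>lam\<close> charges every given
  neighbourhood of the axis, but not the geodesics sharing exactly one end with the axis, so its
  support contains the axis or a geodesic as above.\<close>

section \<open>Isometries of the disc\<close>

text \<open>One-sidedness is what settles the case \<open>a * b < 0\<close>: a geodesic crossing the
  axis is disjoint from its images under dilations by positive factors other than 1, and only
  negative factors, the odd powers of the glide reflection, make it meet an image. The compactness
  argument supplies uniformity: the bound on the fibres depends on the glide reflection alone, so
  the number of powers, and then the size of the neighbourhood, can be fixed before any geodesic is
  given. Distance to the axis is measured by \<open>(Re z)^2 / (cmod z)^2\<close>. Dilations
  preserve this ratio, so it still separates the crossings after they have been moved. The other
  obstacle is a mismatch of lifts: the lift lying in the support and the lift known to be invariant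
  under a glide reflection need only have the same image in \<open>S\<close>. That they are
  translates of each other rests on transitivity of the deck group on fibres, derived here from the
  local isometry property, and on a cardinality argument: a line is uncountable, a fibre is
  countable.\<close>

text \<open>The action of SU(1,1), with the determinant left unnormalised. Composition is then
  matrix multiplication, which the parameters of \<open>Moebius_function\<close> hide.\<close>

definition disc_moebius :: "complex \<Rightarrow> complex \<Rightarrow> complex \<Rightarrow> complex" where
  "disc_moebius \<alpha> \<beta> z = (\<alpha> * z + \<beta>) / (cnj \<beta> * z + cnj \<alpha>)"

text \<open>The flag records reversal of orientation, so that one proof covers both kinds and the
  flags of a composition combine by exclusive or.\<close>

definition isometries :: "bool \<Rightarrow> (complex \<Rightarrow> complex) set" where
  "isometries r = (if r then reversing_isometries else preserving_isometries)"

lemma preserving_isometries_eq: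
  "preserving_isometries = {disc_moebius \<alpha> \<beta> | \<alpha> \<beta>. cmod \<beta> < cmod \<alpha>}"
proof (intro equalityI subsetI)
  fix T assume "T \<in> preserving_isometries"
  then obtain t w where T: "T = Moebius_function t w" and w: "cmod w < 1"
    by (auto simp: preserving_isometries_def)
  \<comment> \<open>Half the angle: \<open>disc_moebius e 0\<close> rotates by
    \<open>e / cnj e\<close>, which is \<open>e * e\<close> for unimodular \<open>e\<close>.\<close>
  define e where "e = exp (\<i> * of_real (t / 2))"
  have e2: "exp (\<i> * of_real t) = e * e"
    by (simp add: e_def flip: exp_add)
  have ee: "e * cnj e = 1"
    by (simp add: e_def exp_cnj flip: exp_add)
  then have e0: "e \<noteq> 0" "cnj e = 1 / e" by (metis nonzero_eq_divide_eq mult.commute mult_zero_left zero_neq_one)+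
  have "T z = disc_moebius e (- w * e) z" for z
  proof -
    have "disc_moebius e (- w * e) z = (e * (z - w)) / (cnj e * (1 - cnj w * z))"
      by (simp add: disc_moebius_def algebra_simps)
    also have "\<dots> = e * e * (z - w) / (1 - cnj w * z)"
      unfolding e0(2) by simp
    finally show ?thesis by (simp add: T Moebius_function_def e2)
  qed
  then have "T = disc_moebius e (- w * e)" by auto
  moreover have "cmod (- w * e) < cmod e"
    using w e0 by (simp add: norm_mult)
  ultimately show "T \<in> {disc_moebius \<alpha> \<beta> | \<alpha> \<beta>. cmod \<beta> < cmod \<alpha>}" by blast
next
  fix T assume "T \<in> {disc_moebius \<alpha> \<beta> | \<alpha> \<beta>. cmod \<beta> < cmod \<alpha>}"
  then obtain \<alpha> \<beta> where T: "T = disc_moebius \<alpha> \<beta>" and ab: "cmod \<beta> < cmod \<alpha>" by blast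
  then have a0: "\<alpha> \<noteq> 0" by auto
  have "cmod (\<alpha> / cnj \<alpha>) = 1"
    using a0 by (simp add: norm_divide)
  then obtain t where t: "\<alpha> / cnj \<alpha> = exp (\<i> * of_real t)"
    by (metis complex_norm_eq_1_exp)
  let ?w = "- \<beta> / \<alpha>"
  have "T z = Moebius_function t ?w z" for z
  proof -
    have "Moebius_function t ?w z = (\<alpha> / cnj \<alpha>) * (z + \<beta> / \<alpha>) / (1 + cnj \<beta> / cnj \<alpha> * z)"
      by (simp add: Moebius_function_def flip: t)
    also have "\<dots> = (\<alpha> * (z + \<beta> / \<alpha>)) / (cnj \<alpha> * (1 + cnj \<beta> / cnj \<alpha> * z))"
      by simp
    also have "\<dots> = T z"
      using a0 by (simp add: T disc_moebius_def algebra_simps)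
    finally show ?thesis by simp
  qed
  then have "T = Moebius_function t ?w" by auto
  moreover have "cmod ?w < 1" using ab a0 by (simp add: norm_divide)
  ultimately show "T \<in> preserving_isometries" unfolding preserving_isometries_def by blast
qed

lemma isometriesE:
  assumes "T \<in> isometries r"
  obtains \<alpha> \<beta> where "cmod \<beta> < cmod \<alpha>" "\<And>z. T z = disc_moebius \<alpha> \<beta> (if r then cnj z else z)"
proof (cases r)
  case True
  with assms obtain U where "U \<in> preserving_isometries" "T = U \<circ> cnj"
    by (auto simp: isometries_def reversing_isometries_def preserving_isometries_def)
  then show ?thesis
    using that True by (auto simp: preserving_isometries_eq)
next
  case False
  then show ?thesis
    using that assms by (auto simp: preserving_isometries_eq isometries_def)
qed

lemma isometriesI:
  assumes "cmod \<beta> < cmod \<alpha>" "\<And>z. T z = disc_moebius \<alpha> \<beta> (if r then cnj z else z)"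
  shows "T \<in> isometries r"
proof -
  obtain t w where "disc_moebius \<alpha> \<beta> = Moebius_function t w" "cmod w < 1"
    using assms(1) preserving_isometries_eq unfolding preserving_isometries_def by blast
  moreover have "T = (if r then disc_moebius \<alpha> \<beta> \<circ> cnj else disc_moebius \<alpha> \<beta>)"
    using assms(2) by auto
  ultimately show ?thesis
    by (auto simp: isometries_def reversing_isometries_def preserving_isometries_def)
qed

lemma moebius_denominator_nonzero:
  assumes "cmod \<beta> < cmod \<alpha>" "cmod z \<le> 1"
  shows "cnj \<beta> * z + cnj \<alpha> \<noteq> 0"
proof
  assume "cnj \<beta> * z + cnj \<alpha> = 0"
  then have "cmod \<alpha> = cmod \<beta> * cmod z"
    by (metis add.commute complex_mod_cnj eq_neg_iff_add_eq_0 norm_minus_cancel norm_mult)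
  also have "\<dots> \<le> cmod \<beta> * 1" using assms by (intro mult_left_mono) auto
  finally show False using assms by simp
qed

lemma moebius_determinant_nonzero:
  assumes "cmod \<beta> < cmod \<alpha>"
  shows "\<alpha> * cnj \<alpha> - \<beta> * cnj \<beta> \<noteq> 0"
proof -
  have "(cmod \<beta>)\<^sup>2 < (cmod \<alpha>)\<^sup>2" using assms by (simp add: power_strict_mono)
  moreover have "\<alpha> * cnj \<alpha> - \<beta> * cnj \<beta> = of_real ((cmod \<alpha>)\<^sup>2 - (cmod \<beta>)\<^sup>2)"
    by (simp flip: complex_norm_square)
  ultimately show ?thesis by (metis less_irrefl of_real_eq_0_iff right_minus_eq)
qed

text \<open>With the companion law for \<open>1 - w * cnj z\<close>, this is the source of the
  invariance of \<open>hdist\<close> and of \<open>line_form\<close>: the determinant and the two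
  denominators split off as factors.\<close>

lemma disc_moebius_diff:
  assumes "cmod \<beta> < cmod \<alpha>" "cmod z \<le> 1" "cmod w \<le> 1"
  shows "disc_moebius \<alpha> \<beta> z - disc_moebius \<alpha> \<beta> w =
    (\<alpha> * cnj \<alpha> - \<beta> * cnj \<beta>) * (z - w) / ((cnj \<beta> * z + cnj \<alpha>) * (cnj \<beta> * w + cnj \<alpha>))"
  using moebius_denominator_nonzero[OF assms(1,2)] moebius_denominator_nonzero[OF assms(1,3)]
  by (simp add: disc_moebius_def diff_frac_eq) (simp add: algebra_simps)

lemma disc_moebius_codiff:
  assumes "cmod \<beta> < cmod \<alpha>" "cmod z \<le> 1" "cmod w \<le> 1"
  shows "1 - disc_moebius \<alpha> \<beta> w * cnj (disc_moebius \<alpha> \<beta> z) =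
    (\<alpha> * cnj \<alpha> - \<beta> * cnj \<beta>) * (1 - w * cnj z) / ((cnj \<beta> * w + cnj \<alpha>) * cnj (cnj \<beta> * z + cnj \<alpha>))"
proof -
  have d: "cnj \<beta> * w + cnj \<alpha> \<noteq> 0" "cnj (cnj \<beta> * z + cnj \<alpha>) \<noteq> 0"
    using moebius_denominator_nonzero[OF assms(1,2)] moebius_denominator_nonzero[OF assms(1,3)]
    by (simp_all only: complex_cnj_zero_iff not_False_eq_True)
  have "1 - disc_moebius \<alpha> \<beta> w * cnj (disc_moebius \<alpha> \<beta> z) =
     1 - ((\<alpha> * w + \<beta>) * cnj (\<alpha> * z + \<beta>)) / ((cnj \<beta> * w + cnj \<alpha>) * cnj (cnj \<beta> * z + cnj \<alpha>))"
    by (simp add: disc_moebius_def)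
  also have "\<dots> = ((cnj \<beta> * w + cnj \<alpha>) * cnj (cnj \<beta> * z + cnj \<alpha>) - (\<alpha> * w + \<beta>) * cnj (\<alpha> * z + \<beta>))
      / ((cnj \<beta> * w + cnj \<alpha>) * cnj (cnj \<beta> * z + cnj \<alpha>))"
    using d by (simp only: diff_divide_distrib) simp
  finally show ?thesis by (simp add: algebra_simps)
qed

lemma disc_moebius_norm:
  assumes "cmod \<beta> < cmod \<alpha>" "cmod z \<le> 1"
  shows "1 - (cmod (disc_moebius \<alpha> \<beta> z))\<^sup>2 =
    ((cmod \<alpha>)\<^sup>2 - (cmod \<beta>)\<^sup>2) * (1 - (cmod z)\<^sup>2) / (cmod (cnj \<beta> * z + cnj \<alpha>))\<^sup>2"
proof -
  have "complex_of_real (1 - (cmod (disc_moebius \<alpha> \<beta> z))\<^sup>2) =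
    of_real (((cmod \<alpha>)\<^sup>2 - (cmod \<beta>)\<^sup>2) * (1 - (cmod z)\<^sup>2) / (cmod (cnj \<beta> * z + cnj \<alpha>))\<^sup>2)"
    using disc_moebius_codiff[OF assms(1) assms(2) assms(2)]
    by (simp add: complex_norm_square del: of_real_power)
  then show ?thesis unfolding of_real_eq_iff .
qed

lemma disc_moebius_compose:
  assumes "cmod \<beta>' < cmod \<alpha>'" "cmod z \<le> 1"
  shows "disc_moebius \<alpha> \<beta> (disc_moebius \<alpha>' \<beta>' z) =
    disc_moebius (\<alpha> * \<alpha>' + \<beta> * cnj \<beta>') (\<alpha> * \<beta>' + \<beta> * cnj \<alpha>') z"
proof -
  define d where "d = cnj \<beta>' * z + cnj \<alpha>'"
  have d: "d \<noteq> 0" using moebius_denominator_nonzero[OF assms] by (simp add: d_def)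
  have "disc_moebius \<alpha> \<beta> (disc_moebius \<alpha>' \<beta>' z) =
      (d * (\<alpha> * ((\<alpha>' * z + \<beta>') / d) + \<beta>)) / (d * (cnj \<beta> * ((\<alpha>' * z + \<beta>') / d) + cnj \<alpha>))"
    using d by (simp add: disc_moebius_def flip: d_def)
  also have "\<dots> = (\<alpha> * (\<alpha>' * z + \<beta>') + d * \<beta>) / (cnj \<beta> * (\<alpha>' * z + \<beta>') + d * cnj \<alpha>)"
    using d by (simp add: distrib_left[of d])
  finally show ?thesis by (simp add: disc_moebius_def d_def algebra_simps)
qed

lemma cnj_disc_moebius: "cnj (disc_moebius \<alpha> \<beta> z) = disc_moebius (cnj \<alpha>) (cnj \<beta>) (cnj z)"
  by (simp add: disc_moebius_def)

text \<open>The determinant \<open>(cmod \<alpha>)^2 - (cmod \<beta>)^2\<close> is multiplicative,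
  hence stays positive.\<close>

lemma moebius_compose_coefficients:
  assumes "cmod \<beta> < cmod \<alpha>" "cmod \<beta>' < cmod \<alpha>'"
  shows "cmod (\<alpha> * \<beta>' + \<beta> * cnj \<alpha>') < cmod (\<alpha> * \<alpha>' + \<beta> * cnj \<beta>')"
proof -
  have "complex_of_real ((cmod (\<alpha> * \<alpha>' + \<beta> * cnj \<beta>'))\<^sup>2 - (cmod (\<alpha> * \<beta>' + \<beta> * cnj \<alpha>'))\<^sup>2) =
     of_real (((cmod \<alpha>)\<^sup>2 - (cmod \<beta>)\<^sup>2) * ((cmod \<alpha>')\<^sup>2 - (cmod \<beta>')\<^sup>2))"
    by (simp add: complex_norm_square algebra_simps del: of_real_power)
  then have "(cmod (\<alpha> * \<alpha>' + \<beta> * cnj \<beta>'))\<^sup>2 - (cmod (\<alpha> * \<beta>' + \<beta> * cnj \<alpha>'))\<^sup>2 =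
     ((cmod \<alpha>)\<^sup>2 - (cmod \<beta>)\<^sup>2) * ((cmod \<alpha>')\<^sup>2 - (cmod \<beta>')\<^sup>2)"
    unfolding of_real_eq_iff .
  moreover have "\<dots> > 0" using assms by (simp add: power_strict_mono)
  ultimately show ?thesis by (simp add: power2_less_imp_less)
qed

text \<open>\<open>1 - (cmod (T z))^2\<close> is a positive multiple of
  \<open>1 - (cmod z)^2\<close>.\<close>

lemma isometry_cball:
  assumes "T \<in> isometries r" "z \<in> cball 0 1"
  shows "T z \<in> cball 0 1" "T z \<in> ball 0 1 \<longleftrightarrow> z \<in> ball 0 1" "T z \<in> sphere 0 1 \<longleftrightarrow> z \<in> sphere 0 1"
proof -
  obtain \<alpha> \<beta> where ab: "cmod \<beta> < cmod \<alpha>" and T: "T z = disc_moebius \<alpha> \<beta> (if r then cnj z else z)"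
    using isometriesE[OF assms(1)] by metis
  define z' where "z' = (if r then cnj z else z)"
  have z': "cmod z' = cmod z" by (simp add: z'_def)
  have z1: "cmod z' \<le> 1" using z' assms(2) by simp
  define D where "D = ((cmod \<alpha>)\<^sup>2 - (cmod \<beta>)\<^sup>2) / (cmod (cnj \<beta> * z' + cnj \<alpha>))\<^sup>2"
  have "1 - (cmod (T z))\<^sup>2 = D * (1 - (cmod z)\<^sup>2)"
    using disc_moebius_norm[OF ab z1] by (simp add: D_def T z' flip: z'_def)
  moreover have "D > 0"
    unfolding D_def using moebius_denominator_nonzero[OF ab z1] ab
    by (intro divide_pos_pos) (simp_all add: power_strict_mono)
  ultimately have *: "1 - (cmod (T z))\<^sup>2 > 0 \<longleftrightarrow> 1 - (cmod z)\<^sup>2 > 0"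
     "1 - (cmod (T z))\<^sup>2 = 0 \<longleftrightarrow> 1 - (cmod z)\<^sup>2 = 0"
    by (simp_all add: zero_less_mult_iff)
  have **: "1 - (cmod u)\<^sup>2 > 0 \<longleftrightarrow> cmod u < 1" "1 - (cmod u)\<^sup>2 = 0 \<longleftrightarrow> cmod u = 1" for u
    by (simp_all add: power_less_one_iff power2_eq_1_iff)
      (smt (verit) norm_ge_zero)
  show "T z \<in> cball 0 1" "T z \<in> ball 0 1 \<longleftrightarrow> z \<in> ball 0 1" "T z \<in> sphere 0 1 \<longleftrightarrow> z \<in> sphere 0 1"
    using *[unfolded **] assms(2) by auto
qed

text \<open>Isometries compose and invert only on the closed disc: at a pole, division by zero gives a value
  off the formula.\<close>

lemma isometry_compose:
  assumes "T \<in> isometries r" "T' \<in> isometries r'"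
  obtains U where "U \<in> isometries (r \<noteq> r')" "\<And>z. z \<in> cball 0 1 \<Longrightarrow> U z = T (T' z)"
proof -
  obtain \<alpha> \<beta> where ab: "cmod \<beta> < cmod \<alpha>" and T: "\<And>z. T z = disc_moebius \<alpha> \<beta> (if r then cnj z else z)"
    using isometriesE[OF assms(1)] by metis
  obtain \<alpha>' \<beta>' where ab': "cmod \<beta>' < cmod \<alpha>'" and T': "\<And>z. T' z = disc_moebius \<alpha>' \<beta>' (if r' then cnj z else z)"
    using isometriesE[OF assms(2)] by metis
  define \<alpha>'' where "\<alpha>'' = (if r then cnj \<alpha>' else \<alpha>')"
  define \<beta>'' where "\<beta>'' = (if r then cnj \<beta>' else \<beta>')"
  have ab'': "cmod \<beta>'' < cmod \<alpha>''" using ab' by (simp add: \<alpha>''_def \<beta>''_def)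
  let ?U = "\<lambda>z. disc_moebius (\<alpha> * \<alpha>'' + \<beta> * cnj \<beta>'') (\<alpha> * \<beta>'' + \<beta> * cnj \<alpha>'') (if r \<noteq> r' then cnj z else z)"
  have "?U z = T (T' z)" if "z \<in> cball 0 1" for z
  proof -
    have "(if r then cnj (T' z) else T' z) = disc_moebius \<alpha>'' \<beta>'' (if r \<noteq> r' then cnj z else z)"
      by (simp add: T' \<alpha>''_def \<beta>''_def cnj_disc_moebius)
    then show ?thesis
      using disc_moebius_compose[OF ab'', of "if r \<noteq> r' then cnj z else z"] that by (simp add: T)
  qed
  moreover have "?U \<in> isometries (r \<noteq> r')"
    by (rule isometriesI[OF moebius_compose_coefficients[OF ab ab'']]) simp
  ultimately show ?thesis using that by blast
qed

lemma isometry_inverse: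
  assumes "T \<in> isometries r"
  obtains U where "U \<in> isometries r" "\<And>z. z \<in> cball 0 1 \<Longrightarrow> U (T z) = z" "\<And>z. z \<in> cball 0 1 \<Longrightarrow> T (U z) = z"
proof -
  obtain \<alpha> \<beta> where ab: "cmod \<beta> < cmod \<alpha>" and T: "\<And>z. T z = disc_moebius \<alpha> \<beta> (if r then cnj z else z)"
    using isometriesE[OF assms(1)] by metis
  have a0: "\<alpha> \<noteq> 0" using ab by auto
  have inv: "disc_moebius (cnj \<alpha>) (- \<beta>) (disc_moebius \<alpha> \<beta> z) = z"
    "disc_moebius \<alpha> \<beta> (disc_moebius (cnj \<alpha>) (- \<beta>) z) = z" if "cmod z \<le> 1" for z
    using that ab moebius_determinant_nonzero[OF ab]
    by (subst disc_moebius_compose; simp add: disc_moebius_def mult.commute)+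
  let ?U = "\<lambda>z. disc_moebius (if r then \<alpha> else cnj \<alpha>) (if r then - cnj \<beta> else - \<beta>) (if r then cnj z else z)"
  have "?U \<in> isometries r"
    by (rule isometriesI) (use ab in auto)
  moreover have U: "?U z = (if r then cnj (disc_moebius (cnj \<alpha>) (- \<beta>) z) else disc_moebius (cnj \<alpha>) (- \<beta>) z)" for z
    by (simp add: cnj_disc_moebius)
  have "?U (T z) = z" "T (?U z) = z" if "z \<in> cball 0 1" for z
    unfolding U using that inv[of z] inv[of "cnj z"] by (simp_all add: T)
  ultimately show ?thesis using that by blast
qed

lemma isometry_inj_on:
  assumes "T \<in> isometries r"
  shows "inj_on T (cball 0 1)"
  using isometry_inverse[OF assms] by (metis inj_onI)

lemma isometry_continuous:
  assumes "T \<in> isometries r"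
  shows "continuous_on (cball 0 1) T"
proof -
  obtain \<alpha> \<beta> where ab: "cmod \<beta> < cmod \<alpha>" and T: "\<And>z. T z = disc_moebius \<alpha> \<beta> (if r then cnj z else z)"
    using isometriesE[OF assms(1)] by metis
  have "continuous_on (cball 0 1) (disc_moebius \<alpha> \<beta>)"
    unfolding disc_moebius_def[abs_def]
    by (intro continuous_intros) (use moebius_denominator_nonzero[OF ab] in auto)
  then have "continuous_on (cball 0 1) (\<lambda>z. disc_moebius \<alpha> \<beta> (if r then cnj z else z))"
    by (rule continuous_on_compose2) (cases r; force intro!: continuous_intros)+
  then show ?thesis
    by (simp add: T continuous_on_eq)
qed

lemma hdist_isometry:
  assumes "T \<in> isometries r" "z \<in> ball 0 1" "w \<in> ball 0 1"
  shows "hdist (T z) (T w) = hdist z w"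
proof -
  obtain \<alpha> \<beta> where ab: "cmod \<beta> < cmod \<alpha>" and T: "\<And>z. T z = disc_moebius \<alpha> \<beta> (if r then cnj z else z)"
    using isometriesE[OF assms(1)] by metis
  define z' w' where "z' = (if r then cnj z else z)" and "w' = (if r then cnj w else w)"
  have n: "cmod z' = cmod z" "cmod w' = cmod w" "cmod (z' - w') = cmod (z - w)"
    by (simp_all add: z'_def w'_def flip: complex_cnj_diff)
  have l: "cmod z' \<le> 1" "cmod w' \<le> 1" using assms n by auto
  define D where "D = (cmod \<alpha>)\<^sup>2 - (cmod \<beta>)\<^sup>2"
  define d e where "d = cmod (cnj \<beta> * z' + cnj \<alpha>)" and "e = cmod (cnj \<beta> * w' + cnj \<alpha>)"
  have nz: "D \<noteq> 0" "d \<noteq> 0" "e \<noteq> 0"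
    using ab moebius_denominator_nonzero[OF ab] l by (simp_all add: d_def e_def D_def)
  have "\<alpha> * cnj \<alpha> - \<beta> * cnj \<beta> = of_real D"
    by (simp add: D_def flip: complex_norm_square)
  then have "cmod (T z - T w) = \<bar>D\<bar> * cmod (z - w) / (d * e)"
    using disc_moebius_diff[OF ab l] n by (simp add: T norm_mult norm_divide d_def e_def flip: z'_def w'_def)
  then have "(cmod (T z - T w))\<^sup>2 = D\<^sup>2 * (cmod (z - w))\<^sup>2 / (d\<^sup>2 * e\<^sup>2)"
    by (simp add: power_mult_distrib power_divide)
  moreover have "1 - (cmod (T z))\<^sup>2 = D * (1 - (cmod z)\<^sup>2) / d\<^sup>2" "1 - (cmod (T w))\<^sup>2 = D * (1 - (cmod w)\<^sup>2) / e\<^sup>2"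
    using disc_moebius_norm[OF ab l(1)] disc_moebius_norm[OF ab l(2)] n
    by (simp_all add: T D_def d_def e_def flip: z'_def w'_def)
  ultimately have "(cmod (T z - T w))\<^sup>2 / ((1 - (cmod (T z))\<^sup>2) * (1 - (cmod (T w))\<^sup>2)) =
     (cmod (z - w))\<^sup>2 / ((1 - (cmod z)\<^sup>2) * (1 - (cmod w)\<^sup>2))"
    using nz by (simp add: power2_eq_square)
  then show ?thesis unfolding hdist_def by (metis times_divide_eq_right)
qed

text \<open>Conjugation moves a point of \<open>U\<close> to 0. An isometry fixing 0 is a rotation,
  possibly after \<open>cnj\<close>; a fixed real point makes the rotation trivial, and a fixed
  imaginary point then rules out \<open>cnj\<close>.\<close>

lemma isometry_eq_id:
  assumes T: "T \<in> isometries r" and U: "open U" "U \<subseteq> ball 0 1" "U \<noteq> {}" and eq: "\<And>z. z \<in> U \<Longrightarrow> T z = z"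
  shows "\<not> r" "z \<in> cball 0 1 \<Longrightarrow> T z = z"
proof -
  obtain q where q: "q \<in> U" using U by auto
  let ?m = "disc_moebius 1 q"
  have m: "?m \<in> isometries False"
    using q U by (intro isometriesI[of q 1]) auto
  obtain m' where m': "m' \<in> isometries False" "\<And>z. z \<in> cball 0 1 \<Longrightarrow> m' (?m z) = z" "\<And>z. z \<in> cball 0 1 \<Longrightarrow> ?m (m' z) = z"
    using isometry_inverse[OF m] by metis
  obtain T1 where T1: "T1 \<in> isometries r" "\<And>z. z \<in> cball 0 1 \<Longrightarrow> T1 z = T (?m z)"
    using isometry_compose[OF T m] by auto
  obtain T2 where T2: "T2 \<in> isometries r" "\<And>z. z \<in> cball 0 1 \<Longrightarrow> T2 z = m' (T1 z)"
    using isometry_compose[OF m'(1) T1(1)] by auto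
  have T2': "T2 z = m' (T (?m z))" if "z \<in> cball 0 1" for z
    using T1 T2 that by simp
  have "open (ball 0 1 \<inter> ?m -` U)"
    by (rule continuous_open_preimage[OF continuous_on_subset[OF isometry_continuous[OF m]]]) (use U in auto)
  moreover have "0 \<in> ball 0 1 \<inter> ?m -` U" using q by (simp add: disc_moebius_def)
  ultimately obtain e where e: "e > 0" "ball 0 e \<subseteq> ball 0 1 \<inter> ?m -` U"
    by (meson open_contains_ball)
  have T2id: "T2 z = z" if "z \<in> ball 0 e" for z
  proof -
    have "z \<in> cball 0 1" "?m z \<in> U" using that e(2) ball_subset_cball by blast+
    then show ?thesis using eq m'(2) T2' by simp
  qed
  obtain \<alpha> \<beta> where ab: "cmod \<beta> < cmod \<alpha>" and T2f: "\<And>z. T2 z = disc_moebius \<alpha> \<beta> (if r then cnj z else z)"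
    using isometriesE[OF T2(1)] by metis
  have a0: "\<alpha> \<noteq> 0" using ab by auto
  have "T2 0 = 0" using T2id e by simp
  then have b0: "\<beta> = 0" using ab by (cases r) (auto simp: T2f disc_moebius_def)
  let ?t = "complex_of_real (e / 2)"
  have "T2 ?t = ?t" "T2 (\<i> * ?t) = \<i> * ?t"
    using e(1) by (intro T2id; simp add: norm_mult)+
  then have "\<alpha> = cnj \<alpha>" "\<not> r"
    using e(1) a0 by (auto simp: T2f disc_moebius_def b0 field_simps split: if_splits)
  then show "\<not> r" by simp
  assume z: "z \<in> cball 0 1"
  have "T2 (m' z) = m' z"
    using \<open>\<alpha> = cnj \<alpha>\<close> \<open>\<not> r\<close> a0 by (simp add: T2f disc_moebius_def b0)
  moreover have "m' z \<in> cball 0 1" using isometry_cball(1)[OF m'(1) z] .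
  ultimately have "m' (T z) = m' z" using T2' m'(3)[OF z] by simp
  then show "T z = z"
    using m'(3) z isometry_cball(1)[OF T z] by metis
qed

lemma isometry_eqI:
  assumes T: "T \<in> isometries r" "T' \<in> isometries r'"
    and U: "open U" "U \<subseteq> ball 0 1" "U \<noteq> {}" and eq: "\<And>z. z \<in> U \<Longrightarrow> T z = T' z" and z: "z \<in> cball 0 1"
  shows "T z = T' z"
proof -
  obtain V where V: "V \<in> isometries r" "\<And>z. z \<in> cball 0 1 \<Longrightarrow> V (T z) = z" "\<And>z. z \<in> cball 0 1 \<Longrightarrow> T (V z) = z"
    using isometry_inverse[OF T(1)] by metis
  obtain W where W: "W \<in> isometries (r \<noteq> r')" "\<And>z. z \<in> cball 0 1 \<Longrightarrow> W z = V (T' z)"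
    using isometry_compose[OF V(1) T(2)] by metis
  have "W u = u" if "u \<in> U" for u
    using that U ball_subset_cball[of 0 1] W(2)[of u] V(2)[of u] eq[of u] by auto
  then have "W z = z" using isometry_eq_id(2)[OF W(1) U _ z] by blast
  then have "V (T' z) = z" using W z by simp
  then show ?thesis using V(3)[OF isometry_cball(1)[OF T(2) z]] by simp
qed

section \<open>Geodesic lines\<close>

text \<open>This vanishes iff the pair of \<open>z\<close> and its mirror image \<open>1 / cnj z\<close> in the unit circle separates
  \<open>a\<close> and \<open>b\<close> harmonically.\<close>

definition line_form :: "complex \<Rightarrow> complex \<Rightarrow> complex \<Rightarrow> complex" where
  "line_form a b z = (z - a) * (1 - b * cnj z) + (z - b) * (1 - a * cnj z)"

lemma line_form_commute: "line_form a b z = line_form b a z"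
  by (simp add: line_form_def)

text \<open>Both summands of the form acquire the same nonzero factor, since the product of the
  denominators is symmetric in \<open>a\<close> and \<open>b\<close>.\<close>

lemma line_form_isometry:
  assumes "T \<in> isometries r" and in_disc: "a \<in> cball 0 1" "b \<in> cball 0 1" "z \<in> cball 0 1"
  shows "line_form (T a) (T b) (T z) = 0 \<longleftrightarrow> line_form a b z = 0"
proof -
  obtain \<alpha> \<beta> where ab: "cmod \<beta> < cmod \<alpha>" and T: "\<And>z. T z = disc_moebius \<alpha> \<beta> (if r then cnj z else z)"
    using isometriesE[OF assms(1)] by metis
  have *: "line_form (disc_moebius \<alpha> \<beta> a) (disc_moebius \<alpha> \<beta> b) (disc_moebius \<alpha> \<beta> z) = 0 \<longleftrightarrow> line_form a b z = 0"
    if "cmod a \<le> 1" "cmod b \<le> 1" "cmod z \<le> 1" for a b z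
  proof -
    define D where "D = \<alpha> * cnj \<alpha> - \<beta> * cnj \<beta>"
    define d where "d u = cnj \<beta> * u + cnj \<alpha>" for u
    have nz: "D \<noteq> 0" "d a \<noteq> 0" "d b \<noteq> 0" "d z \<noteq> 0" "cnj (d z) \<noteq> 0"
      unfolding D_def d_def complex_cnj_zero_iff
      using moebius_denominator_nonzero[OF ab] that moebius_determinant_nonzero[OF ab] by blast+
    have "line_form (disc_moebius \<alpha> \<beta> a) (disc_moebius \<alpha> \<beta> b) (disc_moebius \<alpha> \<beta> z)
        = (D * (z - a) / (d z * d a)) * (D * (1 - b * cnj z) / (d b * cnj (d z)))
        + (D * (z - b) / (d z * d b)) * (D * (1 - a * cnj z) / (d a * cnj (d z)))"
      unfolding line_form_def D_def d_def
      by (simp only: disc_moebius_diff[OF ab] disc_moebius_codiff[OF ab] that)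
    also have "\<dots> = D * D / (d z * d a * d b * cnj (d z)) * line_form a b z"
      unfolding line_form_def distrib_left by (simp add: mult_ac)
    finally show ?thesis using nz by simp
  qed
  have "line_form (cnj a) (cnj b) (cnj z) = cnj (line_form a b z)"
    by (simp add: line_form_def)
  then have "line_form (cnj a) (cnj b) (cnj z) = 0 \<longleftrightarrow> line_form a b z = 0"
    by simp
  then show ?thesis
    using *[of a b z] *[of "cnj a" "cnj b" "cnj z"] in_disc by (cases r) (simp_all add: T)
qed

text \<open>\<open>disc_moebius \<alpha> \<beta>\<close> maps \<open>1\<close> to
  \<open>(\<alpha> + \<beta>) / cnj (\<alpha> + \<beta>)\<close> and \<open>-1\<close> to
  \<open>- (\<alpha> - \<beta>) / cnj (\<alpha> - \<beta>)\<close>. So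
  \<open>\<alpha> + \<beta>\<close> and \<open>\<alpha> - \<beta>\<close> are taken as square roots
  of \<open>b\<close> and \<open>- a\<close>. The determinant is then \<open>Re (u * cnj v)\<close>,
  and the free sign of \<open>v\<close> makes it positive.\<close>

lemma exists_isometry_endpoints:
  assumes "a \<in> sphere 0 1" "b \<in> sphere 0 1" "a \<noteq> b"
  obtains m where "m \<in> isometries False" "m (- 1) = a" "m 1 = b"
proof -
  define u where "u = csqrt b"
  define v0 where "v0 = csqrt (- a)"
  have n: "cmod a = 1" "cmod b = 1" using assms by auto
  have u: "u * u = b" "cmod u = 1"
    using n by (simp_all add: u_def norm_csqrt flip: power2_eq_square)
  have v0: "v0 * v0 = - a" "cmod v0 = 1"
    using n by (simp_all add: v0_def norm_csqrt flip: power2_eq_square)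
  have uu: "u * cnj u = 1" "v0 * cnj v0 = 1"
    using u(2) v0(2) by (metis complex_norm_square of_real_1 power_one)+
  \<comment> \<open>If \<open>u * cnj v0\<close> were imaginary, its square would be
    \<open>-1\<close>, that is \<open>b = a\<close>.\<close>
  have "Re (u * cnj v0) \<noteq> 0"
  proof
    assume 0: "Re (u * cnj v0) = 0"
    let ?w = "u * cnj v0"
    have "cnj ?w = - ?w" using 0 by (simp add: complex_eq_iff)
    then have "(u * v0) * (cnj u * v0) = (u * v0) * (- (u * cnj v0))" by simp
    then have "(u * cnj u) * (v0 * v0) = - ((u * u) * (v0 * cnj v0))" by (simp add: mult_ac)
    then have "b = a" unfolding uu u v0 by simp
    then show False using assms by simp
  qed
  then obtain v where v: "v * v = - a" "v * cnj v = 1" "Re (u * cnj v) > 0"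
  proof (cases "Re (u * cnj v0) > 0")
    case True
    then show ?thesis using that v0 uu by blast
  next
    case False
    then have "Re (u * cnj (- v0)) > 0" using \<open>Re (u * cnj v0) \<noteq> 0\<close> by simp
    then show ?thesis using that[of "- v0"] v0 uu by simp
  qed
  define \<alpha> \<beta> where "\<alpha> = (u + v) / 2" and "\<beta> = (u - v) / 2"
  have sd: "\<alpha> + \<beta> = u" "\<alpha> - \<beta> = v" by (simp_all add: \<alpha>_def \<beta>_def field_simps)
  have "(cmod \<alpha>)\<^sup>2 - (cmod \<beta>)\<^sup>2 = Re (u * cnj v)"
    unfolding cmod_power2 by (simp add: \<alpha>_def \<beta>_def power2_eq_square field_simps)
  then have "(cmod \<beta>)\<^sup>2 < (cmod \<alpha>)\<^sup>2" using v by simp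
  then have ab: "cmod \<beta> < cmod \<alpha>" by (simp add: power2_less_imp_less)
  have m: "disc_moebius \<alpha> \<beta> \<in> isometries False"
    using isometriesI[OF ab] by auto
  have cn: "cnj u \<noteq> 0" "cnj v \<noteq> 0" using uu v by auto
  have "disc_moebius \<alpha> \<beta> 1 = (\<alpha> + \<beta>) / cnj (\<alpha> + \<beta>)"
    by (simp add: disc_moebius_def add.commute)
  also have "\<dots> = u / cnj u" by (simp only: sd)
  also have "\<dots> = b" using uu u(1) cn by (metis mult.assoc mult_1_right nonzero_eq_divide_eq)
  finally have 1: "disc_moebius \<alpha> \<beta> 1 = b" .
  have "disc_moebius \<alpha> \<beta> (- 1) = - (v / cnj v)"
  proof -
    have "\<alpha> * - 1 + \<beta> = - v" "cnj \<beta> * - 1 + cnj \<alpha> = cnj v"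
      by (simp_all flip: sd)
    then show ?thesis by (simp add: disc_moebius_def)
  qed
  also have "v / cnj v = - a" using v cn by (metis mult.assoc mult_1_right nonzero_eq_divide_eq)
  finally have "disc_moebius \<alpha> \<beta> (- 1) = a" by simp
  with 1 m that show ?thesis by blast
qed

lemma line_form_diameter: "line_form (- 1) 1 z = 0 \<longleftrightarrow> z \<in> \<real>"
  by (simp add: line_form_def complex_is_Real_iff complex_eq_iff algebra_simps)

text \<open>The defining isometry carries the question to the diameter, where the form vanishes
  exactly on the reals.\<close>

lemma hyp_line_eq:
  assumes "a \<in> sphere 0 1" "b \<in> sphere 0 1" "a \<noteq> b"
  shows "hyp_line {a, b} = {z \<in> ball 0 1. line_form a b z = 0}"
proof (intro equalityI subsetI)
  fix z assume "z \<in> hyp_line {a, b}"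
  then obtain m t where m: "m \<in> isometries False" "m ` {-1, 1} = {a, b}" and t: "-1 < t" "t < 1"
    and z: "z = m (of_real t)"
    by (auto simp: hyp_line_def isometries_def)
  have "line_form (m (-1)) (m 1) z = 0"
    unfolding z using t line_form_diameter
    by (subst line_form_isometry[OF m(1)]) auto
  moreover have "m (-1) = a \<and> m 1 = b \<or> m (-1) = b \<and> m 1 = a"
    using m(2) by (auto simp: doubleton_eq_iff)
  moreover have "z \<in> ball 0 1"
    unfolding z using isometry_cball(2)[OF m(1), of "of_real t"] t by auto
  ultimately show "z \<in> {z \<in> ball 0 1. line_form a b z = 0}"
    by (auto simp: line_form_commute)
next
  fix z assume z: "z \<in> {z \<in> ball 0 1. line_form a b z = 0}"
  obtain m where m: "m \<in> isometries False" "m (- 1) = a" "m 1 = b"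
    using exists_isometry_endpoints[OF assms] .
  obtain m' where m': "m' \<in> isometries False" "\<And>z. z \<in> cball 0 1 \<Longrightarrow> m (m' z) = z"
    using isometry_inverse[OF m(1)] by metis
  have zb: "z \<in> cball 0 1" using z by auto
  then have w: "m' z \<in> ball 0 1" "m' z \<in> cball 0 1"
    using isometry_cball[OF m'(1) zb] z by auto
  have "line_form (m (-1)) (m 1) (m (m' z)) = 0"
    using m'(2)[OF zb] m z by simp
  then have "m' z \<in> \<real>"
    using line_form_isometry[OF m(1), of "-1" 1 "m' z"] w line_form_diameter by simp
  then obtain t where t: "m' z = of_real t" by (auto elim: Reals_cases)
  moreover have "-1 < t" "t < 1" using w(1) t by auto
  moreover have "z = m (of_real t)" using m'(2)[OF zb] t by simp
  moreover have "m \<in> preserving_isometries" using m by (simp add: isometries_def)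
  ultimately show "z \<in> hyp_line {a, b}"
    unfolding hyp_line_def using m by force
qed

lemma geodesicsE:
  assumes "x \<in> geodesics"
  obtains a b where "x = {a, b}" "a \<in> sphere 0 1" "b \<in> sphere 0 1" "a \<noteq> b"
  using assms by (auto simp: geodesics_def)

lemma geodesicsI: "a \<in> sphere 0 1 \<Longrightarrow> b \<in> sphere 0 1 \<Longrightarrow> a \<noteq> b \<Longrightarrow> {a, b} \<in> geodesics"
  by (auto simp: geodesics_def)

lemma geodesic_subset_sphere: "x \<in> geodesics \<Longrightarrow> x \<subseteq> sphere 0 1"
  by (auto simp: geodesics_def)

lemma hyp_line_subset: "x \<in> geodesics \<Longrightarrow> hyp_line x \<subseteq> ball 0 1"
  by (auto simp: geodesics_def hyp_line_eq)

lemma isometry_geodesics: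
  assumes "T \<in> isometries r" "x \<in> geodesics"
  shows "T ` x \<in> geodesics"
proof -
  obtain a b where x: "x = {a, b}" "a \<in> sphere 0 1" "b \<in> sphere 0 1" "a \<noteq> b"
    using geodesicsE[OF assms(2)] .
  then have "T a \<noteq> T b"
    using inj_onD[OF isometry_inj_on[OF assms(1)], of a b] by auto
  then show ?thesis
    using x isometry_cball[OF assms(1)] by (auto intro!: geodesicsI)
qed

lemma hyp_line_isometry:
  assumes "T \<in> isometries r" "x \<in> geodesics" "z \<in> ball 0 1"
  shows "T z \<in> hyp_line (T ` x) \<longleftrightarrow> z \<in> hyp_line x"
proof -
  obtain a b where x: "x = {a, b}" "a \<in> sphere 0 1" "b \<in> sphere 0 1" "a \<noteq> b"
    using geodesicsE[OF assms(2)] .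
  have "T a \<noteq> T b"
    using inj_onD[OF isometry_inj_on[OF assms(1)], of a b] x by auto
  then have "hyp_line (T ` x) = {z \<in> ball 0 1. line_form (T a) (T b) z = 0}"
    using x isometry_cball(3)[OF assms(1)] by (simp add: hyp_line_eq)
  then show ?thesis
    using x assms(3) isometry_cball(2)[OF assms(1), of z] line_form_isometry[OF assms(1), of a b z]
    by (simp add: hyp_line_eq)
qed

text \<open>Once \<open>x\<close> is the diameter, a real point \<open>t\<close> lies on the line
  with ends \<open>c\<close>, \<open>d\<close> iff
  \<open>2 * t * (1 + c * d) = (c + d) * (1 + t * t)\<close>. Two distinct solutions in the open
  interval force both coefficients to vanish, so the ends are \<open>1\<close> and
  \<open>-1\<close>.\<close>

lemma hyp_line_two_points:
  assumes x: "x \<in> geodesics" and y: "y \<in> geodesics"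
    and z: "z \<in> hyp_line x" "z \<in> hyp_line y" and w: "w \<in> hyp_line x" "w \<in> hyp_line y" and "z \<noteq> w"
  shows "x = y"
proof -
  obtain a b where ab: "x = {a, b}" "a \<in> sphere 0 1" "b \<in> sphere 0 1" "a \<noteq> b"
    using geodesicsE[OF x] .
  obtain m where m: "m \<in> isometries False" "m (- 1) = a" "m 1 = b"
    using exists_isometry_endpoints[OF ab(2-)] .
  obtain m' where m': "m' \<in> isometries False" "\<And>z. z \<in> cball 0 1 \<Longrightarrow> m (m' z) = z" "\<And>z. z \<in> cball 0 1 \<Longrightarrow> m' (m z) = z"
    using isometry_inverse[OF m(1)] by metis
  have x': "m' ` x = {-1, 1}"
    using m m'(3)[of 1] m'(3)[of "-1"] by (auto simp: ab(1))
  obtain c d where cd: "m' ` y = {c, d}" "c \<in> sphere 0 1" "d \<in> sphere 0 1" "c \<noteq> d"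
    using geodesicsE[OF isometry_geodesics[OF m'(1) y]] .
  have *: "\<exists>t. m' v = of_real t \<and> -1 < t \<and> t < 1 \<and> 2 * of_real t * (1 + c * d) = (c + d) * (1 + of_real t * of_real t)"
    if v: "v \<in> hyp_line x" "v \<in> hyp_line y" for v
  proof -
    have vb: "v \<in> ball 0 1" using v hyp_line_subset[OF x] by blast
    have "m' v \<in> hyp_line {-1, 1}" "m' v \<in> hyp_line {c, d}"
      using hyp_line_isometry[OF m'(1) x vb] hyp_line_isometry[OF m'(1) y vb] v x' cd by auto
    then have r: "m' v \<in> ball 0 1" "line_form (-1) 1 (m' v) = 0" "line_form c d (m' v) = 0"
      using cd by (auto simp: hyp_line_eq)
    then obtain t where t: "m' v = of_real t" by (auto simp: line_form_diameter elim: Reals_cases)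
    have "2 * of_real t * (1 + c * d) - (c + d) * (1 + of_real t * of_real t) = line_form c d (of_real t)"
      by (simp add: line_form_def algebra_simps)
    then have "2 * of_real t * (1 + c * d) = (c + d) * (1 + of_real t * of_real t)" using r(3) t by simp
    then show ?thesis using r(1) t by auto
  qed
  obtain s where s: "m' z = of_real s" "-1 < s" "s < 1" "2 * of_real s * (1 + c * d) = (c + d) * (1 + of_real s * of_real s)"
    using *[OF z] by metis
  obtain t where t: "m' w = of_real t" "-1 < t" "t < 1" "2 * of_real t * (1 + c * d) = (c + d) * (1 + of_real t * of_real t)"
    using *[OF w] by metis
  have "z \<in> cball 0 1" "w \<in> cball 0 1" using z w hyp_line_subset[OF x] by auto
  then have "s \<noteq> t" using s(1) t(1) \<open>z \<noteq> w\<close> m'(2) by metis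
  have "\<bar>s\<bar> * \<bar>t\<bar> < 1 * 1" using s t by (intro mult_strict_mono') auto
  then have "s * t \<noteq> 1" by (auto simp flip: abs_mult)
  \<comment> \<open>The term with \<open>c + d\<close> is eliminated by cross-multiplying the
    equations for \<open>s\<close> and \<open>t\<close>.\<close>
  have "2 * complex_of_real ((s - t) * (1 - s * t)) * (1 + c * d)
      = (2 * of_real s * (1 + c * d)) * (1 + of_real t * of_real t)
      - (2 * of_real t * (1 + c * d)) * (1 + of_real s * of_real s)"
    by (simp add: algebra_simps)
  also have "\<dots> = 0" unfolding s(4) t(4) by (simp add: algebra_simps)
  finally have "complex_of_real ((s - t) * (1 - s * t)) = 0 \<or> 1 + c * d = 0" by simp
  then have cd1: "1 + c * d = 0"
    unfolding of_real_eq_0_iff using \<open>s \<noteq> t\<close> \<open>s * t \<noteq> 1\<close> by simp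
  have "1 + s * s > 0" by (simp add: add_pos_nonneg)
  then have "1 + complex_of_real s * s \<noteq> 0"
    by (metis less_irrefl of_real_1 of_real_add of_real_eq_0_iff of_real_mult)
  then have "c + d = 0" using s(4) cd1 by simp
  then have "d = - c" by (simp add: add_eq_0_iff)
  then have "c * c = 1" using cd1 by simp
  then have "c = 1 \<or> c = -1" by (simp add: square_eq_1_iff)
  then have eq: "m' ` x = m' ` y" using x' cd(1) \<open>d = - c\<close> by auto
  have "x \<subseteq> cball 0 1" "y \<subseteq> cball 0 1"
    using geodesic_subset_sphere[OF x] geodesic_subset_sphere[OF y] by auto
  then show "x = y"
    using inj_on_image_eq_iff[OF isometry_inj_on[OF m'(1)]] eq by blast
qed

lemma uncountable_hyp_line:
  assumes "x \<in> geodesics"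
  shows "uncountable (hyp_line x)"
proof -
  obtain a b where x: "x = {a, b}" "a \<in> sphere 0 1" "b \<in> sphere 0 1" "a \<noteq> b"
    using geodesicsE[OF assms] .
  obtain m where m: "m \<in> isometries False" "m (- 1) = a" "m 1 = b"
    using exists_isometry_endpoints[OF x(2-)] .
  let ?D = "complex_of_real ` {-1<..<1}"
  have "inj_on of_real {-1<..<(1::real)}" by (auto simp: inj_on_def)
  then have "uncountable ?D"
    using countable_image_inj_on[of complex_of_real "{-1<..<1}"] uncountable_open_interval[of "-1::real" 1] by auto
  moreover have "?D \<subseteq> cball 0 1" by auto
  ultimately have "uncountable (m ` ?D)"
    using countable_image_inj_on inj_on_subset[OF isometry_inj_on[OF m(1)]] by blast
  moreover have "m ` ?D \<subseteq> hyp_line x"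
    unfolding hyp_line_def using m x(1) by (force simp: isometries_def)
  ultimately show ?thesis using countable_subset by blast
qed

section \<open>Deck transformations\<close>

lemma hdist_eqD:
  assumes "z \<in> ball 0 1" "w \<in> ball 0 1" "z' \<in> ball 0 1" "w' \<in> ball 0 1" "hdist z w = hdist z' w'"
  shows "(cmod (z - w))\<^sup>2 / ((1 - (cmod z)\<^sup>2) * (1 - (cmod w)\<^sup>2)) =
    (cmod (z' - w'))\<^sup>2 / ((1 - (cmod z')\<^sup>2) * (1 - (cmod w')\<^sup>2))"
proof -
  define F where "F z w = (cmod (z - w))\<^sup>2 / ((1 - (cmod z)\<^sup>2) * (1 - (cmod w)\<^sup>2))" for z w
  have F: "F z w \<ge> 0" if "z \<in> ball 0 1" "w \<in> ball 0 1" for z w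
    using that by (auto simp: F_def power_le_one_iff intro!: divide_nonneg_nonneg mult_nonneg_nonneg)
  have h: "cosh (hdist z w) = 1 + 2 * F z w" if "z \<in> ball 0 1" "w \<in> ball 0 1" for z w
    unfolding hdist_def F_def using F[OF that] by (subst cosh_arcosh_real) (auto simp: F_def)
  show ?thesis using h[of z w] h[of z' w'] assms by (simp add: F_def)
qed

lemma continuous_on_hdist:
  assumes "z \<in> ball 0 1"
  shows "continuous_on (ball 0 1) (hdist z)"
proof -
  have "(cmod w)\<^sup>2 < 1" if "w \<in> ball 0 1" for w :: complex
    using that by (simp add: power_less_one_iff)
  then have "1 - (cmod w)\<^sup>2 > 0" if "w \<in> ball 0 1" for w :: complex
    using that by simp
  then have "(1 - (cmod z)\<^sup>2) * (1 - (cmod w)\<^sup>2) > 0" if "w \<in> ball 0 1" for w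
    using that assms by (intro mult_pos_pos)
  then have pos: "(1 - (cmod z)\<^sup>2) * (1 - (cmod w)\<^sup>2) > 0" if "w \<in> ball 0 1" for w
    using that by blast
  have nz: "(1 - (cmod z)\<^sup>2) * (1 - (cmod w)\<^sup>2) \<noteq> 0" if "w \<in> ball 0 1" for w
    using pos[OF that] by linarith
  have ge: "1 + 2 * (cmod (z - w))\<^sup>2 / ((1 - (cmod z)\<^sup>2) * (1 - (cmod w)\<^sup>2)) \<ge> 1" if "w \<in> ball 0 1" for w
    using pos[OF that] by (simp only: le_add_same_cancel1) (intro divide_nonneg_pos; simp)
  have "continuous_on (ball 0 1) (\<lambda>w. 1 + 2 * (cmod (z - w))\<^sup>2 / ((1 - (cmod z)\<^sup>2) * (1 - (cmod w)\<^sup>2)))"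
    using nz by (intro continuous_intros) blast
  then show ?thesis
    unfolding hdist_def[abs_def]
    by (rule continuous_on_compose2[OF continuous_on_arcosh[OF order_refl]]) (use ge in auto)
qed

text \<open>Distances from 0 determine moduli, so \<open>k\<close> preserves moduli. The conformal
  factors in \<open>hdist\<close> then cancel and \<open>k\<close> preserves Euclidean distances
  too, hence inner products, which leaves only a rotation or a reflection.\<close>

lemma local_isometry_at_0:
  assumes \<rho>: "0 < \<rho>" "\<rho> \<le> 1"
    and k: "\<And>u. u \<in> ball 0 \<rho> \<Longrightarrow> k u \<in> ball 0 1" "k 0 = 0"
    and iso: "\<And>u v. u \<in> ball 0 \<rho> \<Longrightarrow> v \<in> ball 0 \<rho> \<Longrightarrow> hdist (k u) (k v) = hdist u v"
  obtains r c where "cmod c = 1" "\<And>u. u \<in> ball 0 \<rho> \<Longrightarrow> k u = c * (if r then cnj u else u)"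
proof -
  have sub: "u \<in> ball 0 1" if "u \<in> ball 0 \<rho>" for u :: complex
    using that \<rho> by auto
  have lt: "(cmod u)\<^sup>2 < 1" if "u \<in> ball 0 1" for u :: complex
    using that by (simp add: power_less_one_iff)
  have nrm: "(cmod (k u))\<^sup>2 = (cmod u)\<^sup>2" if u: "u \<in> ball 0 \<rho>" for u
  proof -
    have "(cmod (k u))\<^sup>2 / (1 - (cmod (k u))\<^sup>2) = (cmod u)\<^sup>2 / (1 - (cmod u)\<^sup>2)"
      using hdist_eqD[of "k u" "k 0" u 0] iso[OF u, of 0] k sub u \<rho> by simp
    moreover have "(cmod (k u))\<^sup>2 < 1" "(cmod u)\<^sup>2 < 1" using lt k sub u by auto
    ultimately show ?thesis by (simp add: field_simps)
  qed
  have diff: "(cmod (k u - k v))\<^sup>2 = (cmod (u - v))\<^sup>2" if u: "u \<in> ball 0 \<rho>" and v: "v \<in> ball 0 \<rho>" for u v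
  proof -
    have "(cmod (k u - k v))\<^sup>2 / ((1 - (cmod u)\<^sup>2) * (1 - (cmod v)\<^sup>2)) = (cmod (u - v))\<^sup>2 / ((1 - (cmod u)\<^sup>2) * (1 - (cmod v)\<^sup>2))"
      using hdist_eqD[of "k u" "k v" u v] iso[OF u v] k sub u v nrm by simp
    moreover have "(cmod v)\<^sup>2 < 1" "(cmod u)\<^sup>2 < 1" using lt k sub u v by auto
    ultimately show ?thesis by simp
  qed
  define t where "t = \<rho> / 2"
  have t: "t > 0" "of_real t \<in> ball (0::complex) \<rho>" "\<i> * of_real t \<in> ball 0 \<rho>"
    using \<rho> by (auto simp: t_def norm_mult)
  define c where "c = k (of_real t) / of_real t"
  have "(cmod (k (of_real t)))\<^sup>2 = t\<^sup>2" using nrm[OF t(2)] by simp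
  then have "cmod (k (of_real t)) = t" using t(1) by (simp add: power2_eq_iff_nonneg)
  then have c: "cmod c = 1" using t(1) by (simp add: c_def norm_divide)
  then have cc: "c * cnj c = 1" by (metis complex_norm_square of_real_1 power_one)
  \<comment> \<open>After this rotation \<open>f\<close> fixes the real point \<open>t\<close>;
    inner products with \<open>t\<close> and with the image of \<open>\<i> * t\<close> determine
    \<open>f\<close> up to the sign \<open>s\<close>.\<close>
  define f where "f u = cnj c * k u" for u
  have kf: "k u = c * f u" for u using cc by (simp add: f_def flip: mult.assoc)
  have ft: "f (of_real t) = of_real t"
    using t cc by (simp add: f_def c_def field_simps)
  have fn: "(cmod (f u))\<^sup>2 = (cmod u)\<^sup>2" if "u \<in> ball 0 \<rho>" for u
    using nrm[OF that] c by (simp add: f_def norm_mult)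
  have fd: "(cmod (f u - f v))\<^sup>2 = (cmod (u - v))\<^sup>2" if "u \<in> ball 0 \<rho>" "v \<in> ball 0 \<rho>" for u v
    using diff[OF that] c by (simp add: f_def norm_mult flip: right_diff_distrib)
  have dot: "Re (f u) * Re (f v) + Im (f u) * Im (f v) = Re u * Re v + Im u * Im v"
    if "u \<in> ball 0 \<rho>" "v \<in> ball 0 \<rho>" for u v
    using fd[OF that] fn[OF that(1)] fn[OF that(2)]
    by (simp add: cmod_power2 power2_diff)
  have re: "Re (f u) = Re u" if "u \<in> ball 0 \<rho>" for u
    using dot[OF that t(2)] t(1) by (simp add: ft)
  define s where "s = Im (f (\<i> * of_real t)) / t"
  have "(Im (f (\<i> * of_real t)))\<^sup>2 = t\<^sup>2"
    using fn[OF t(3)] re[OF t(3)] by (simp add: cmod_power2)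
  then have s: "s = 1 \<or> s = -1"
    using t(1) by (auto simp: s_def power2_eq_iff)
  have im: "Im (f u) = s * Im u" if "u \<in> ball 0 \<rho>" for u
  proof -
    have "Im (f u) * (s * t) = Im u * t"
      using dot[OF that t(3)] re[OF t(3)] t(1) by (simp add: s_def)
    then have "Im (f u) * s = Im u" using t(1) by simp
    then show ?thesis using s by auto
  qed
  have "k u = c * (if s = -1 then cnj u else u)" if "u \<in> ball 0 \<rho>" for u
    unfolding kf using re[OF that] im[OF that] s by (auto simp: complex_eq_iff)
  with c that show ?thesis by metis
qed

text \<open>Isometries taking 0 to \<open>z\<close> and to \<open>k z\<close> reduce this to a map
  fixing 0, which is the restriction of a global isometry.\<close>

lemma local_isometry_extends:
  assumes W: "open W" "W \<subseteq> ball 0 1" "z \<in> W"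
    and k: "\<And>u. u \<in> W \<Longrightarrow> k u \<in> ball 0 1"
    and iso: "\<And>u v. u \<in> W \<Longrightarrow> v \<in> W \<Longrightarrow> hdist (k u) (k v) = hdist u v"
  obtains r T U where "T \<in> isometries r" "open U" "z \<in> U" "U \<subseteq> W" "\<And>u. u \<in> U \<Longrightarrow> T u = k u"
proof -
  have cb: "u \<in> cball 0 1" if "u \<in> ball 0 1" for u :: complex using that by simp
  define m where "m = disc_moebius 1 z"
  have m: "m \<in> isometries False"
    unfolding m_def by (rule isometriesI[of z 1]) (use W in auto)
  obtain m' where m': "m' \<in> isometries False" "\<And>u. u \<in> cball 0 1 \<Longrightarrow> m' (m u) = u" "\<And>u. u \<in> cball 0 1 \<Longrightarrow> m (m' u) = u"
    using isometry_inverse[OF m] by metis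
  define n where "n = disc_moebius 1 (k z)"
  have n: "n \<in> isometries False"
    unfolding n_def using k[OF W(3)] by (intro isometriesI[of "k z" 1]) auto
  obtain n' where n': "n' \<in> isometries False" "\<And>u. u \<in> cball 0 1 \<Longrightarrow> n' (n u) = u" "\<And>u. u \<in> cball 0 1 \<Longrightarrow> n (n' u) = u"
    using isometry_inverse[OF n] by metis
  have m0: "m 0 = z" and n0: "n 0 = k z" by (simp_all add: m_def n_def disc_moebius_def)
  have "open (ball 0 1 \<inter> m -` W)"
    by (rule continuous_open_preimage[OF continuous_on_subset[OF isometry_continuous[OF m]]]) (use W in auto)
  moreover have "0 \<in> ball 0 1 \<inter> m -` W" using W m0 by simp
  ultimately obtain \<rho>' where \<rho>': "\<rho>' > 0" "ball 0 \<rho>' \<subseteq> ball 0 1 \<inter> m -` W"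
    by (meson open_contains_ball)
  define \<rho> where "\<rho> = min \<rho>' 1"
  have \<rho>: "0 < \<rho>" "\<rho> \<le> 1" "ball 0 \<rho> \<subseteq> ball 0 1 \<inter> m -` W"
    using \<rho>' by (auto simp: \<rho>_def)
  define f where "f u = n' (k (m u))" for u
  have mW: "m u \<in> W" "u \<in> ball 0 1" if "u \<in> ball 0 \<rho>" for u using \<rho>(3) that by auto
  have fb: "f u \<in> ball 0 1" if "u \<in> ball 0 \<rho>" for u
    unfolding f_def using isometry_cball(2)[OF n'(1) cb[OF k]] k mW that by blast
  have f0: "f 0 = 0" unfolding f_def m0 n0[symmetric] by (rule n'(2)) simp
  have fi: "hdist (f u) (f v) = hdist u v" if "u \<in> ball 0 \<rho>" "v \<in> ball 0 \<rho>" for u v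
    unfolding f_def
    using hdist_isometry[OF n'(1) k k] iso hdist_isometry[OF m] mW that by simp
  obtain r c where rc: "cmod c = 1" "\<And>u. u \<in> ball 0 \<rho> \<Longrightarrow> f u = c * (if r then cnj u else u)"
    using local_isometry_at_0[of \<rho> f] \<rho> fb f0 fi by metis
  define d where "d = csqrt c"
  have d: "d * d = c" "cmod d = 1" using rc(1) by (simp_all add: d_def norm_csqrt flip: power2_eq_square)
  then have "d * cnj d = 1" by (metis complex_norm_square of_real_1 power_one)
  then have d': "d \<noteq> 0" "1 / cnj d = d" by (auto simp: divide_eq_eq)
  define R where "R u = disc_moebius d 0 (if r then cnj u else u)" for u
  have R: "R \<in> isometries r"
    by (rule isometriesI[of 0 d]) (use d in \<open>auto simp: R_def\<close>)
  have Rf: "R u = f u" if "u \<in> ball 0 \<rho>" for u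
  proof -
    have "R u = d * (if r then cnj u else u) * (1 / cnj d)" by (simp add: R_def disc_moebius_def)
    also have "\<dots> = f u" unfolding d' rc(2)[OF that] d(1)[symmetric] by (simp add: mult_ac)
    finally show ?thesis .
  qed
  obtain T1 where T1: "T1 \<in> isometries r" "\<And>u. u \<in> cball 0 1 \<Longrightarrow> T1 u = R (m' u)"
    using isometry_compose[OF R m'(1)] by auto
  obtain T where T: "T \<in> isometries r" "\<And>u. u \<in> cball 0 1 \<Longrightarrow> T u = n (T1 u)"
    using isometry_compose[OF n T1(1)] by auto
  define U where "U = W \<inter> (ball 0 1 \<inter> m' -` ball 0 \<rho>)"
  have "open (ball 0 1 \<inter> m' -` ball 0 \<rho>)"
    by (rule continuous_open_preimage[OF continuous_on_subset[OF isometry_continuous[OF m'(1)]]]) auto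
  then have "open U" using W by (auto simp: U_def)
  moreover have "m' z = 0" using m'(2)[of 0] m0 by simp
  then have "z \<in> U" using W \<rho> by (auto simp: U_def)
  moreover have "T u = k u" if "u \<in> U" for u
  proof -
    have u: "u \<in> cball 0 1" "m' u \<in> ball 0 \<rho>" "u \<in> W" using that W by (auto simp: U_def)
    have "T u = n (f (m' u))" using T T1 Rf u by simp
    also have "\<dots> = n (n' (k u))" using m'(3) u by (simp add: f_def)
    also have "\<dots> = k u" by (rule n'(3)[OF cb[OF k[OF u(3)]]])
    finally show ?thesis .
  qed
  ultimately show ?thesis using that[OF T(1), of U] by (auto simp: U_def)
qed

section \<open>The covering map and its deck group\<close>

locale hyperbolic_surface =
  fixes S :: "'s::metric_space set" and p :: "complex \<Rightarrow> 's"
  assumes surface: "closed_hyperbolic_surface S p"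
begin

lemma covering: "covering_space (ball 0 1) p S"
  using surface by (simp add: closed_hyperbolic_surface_def)

lemma continuous_p: "continuous_on (ball 0 1) p"
  using covering by (rule covering_space_imp_continuous)

lemma p_locally_inj:
  assumes "z \<in> ball 0 1"
  obtains W where "open W" "z \<in> W" "W \<subseteq> ball 0 1" "inj_on p W"
proof -
  obtain W u q where W: "z \<in> W" "openin (top_of_set (ball 0 1)) W" "homeomorphism W u p q"
    using covering_space_local_homeomorphism[OF covering assms] by metis
  have "open W" "W \<subseteq> ball 0 1" using W(2) openin_open_eq by auto
  moreover have "inj_on p W" using W(3) by (metis homeomorphism_def inj_onI)
  ultimately show ?thesis using that W(1) by blast
qed

lemma deck_groupI:
  assumes "g \<in> isometries r" "\<And>z. z \<in> ball 0 1 \<Longrightarrow> p (g z) = p z"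
  shows "g \<in> deck_group p"
  using assms by (auto simp: deck_group_def isometries_def split: if_splits)

lemma deck_groupE:
  assumes "g \<in> deck_group p"
  obtains r where "g \<in> isometries r" "\<And>z. z \<in> ball 0 1 \<Longrightarrow> p (g z) = p z"
proof (cases "g \<in> reversing_isometries")
  case True
  then show ?thesis using assms that[of True] by (auto simp: deck_group_def isometries_def)
next
  case False
  then show ?thesis using assms that[of False] by (auto simp: deck_group_def isometries_def)
qed

lemma deck_compose:
  assumes "g \<in> deck_group p" "h \<in> deck_group p"
  obtains f where "f \<in> deck_group p" "\<And>z. z \<in> cball 0 1 \<Longrightarrow> f z = g (h z)"
proof -
  obtain r where g: "g \<in> isometries r" "\<And>z. z \<in> ball 0 1 \<Longrightarrow> p (g z) = p z" using deck_groupE[OF assms(1)] by blast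
  obtain s where h: "h \<in> isometries s" "\<And>z. z \<in> ball 0 1 \<Longrightarrow> p (h z) = p z" using deck_groupE[OF assms(2)] by blast
  obtain f where f: "f \<in> isometries (r \<noteq> s)" "\<And>z. z \<in> cball 0 1 \<Longrightarrow> f z = g (h z)"
    using isometry_compose[OF g(1) h(1)] by metis
  have "p (f z) = p z" if "z \<in> ball 0 1" for z
    using that g(2)[of "h z"] h f(2)[of z] isometry_cball(2)[OF h(1), of z] by auto
  then show ?thesis using that f deck_groupI by metis
qed

lemma deck_inverse:
  assumes "g \<in> deck_group p"
  obtains f where "f \<in> deck_group p" "\<And>z. z \<in> cball 0 1 \<Longrightarrow> f (g z) = z" "\<And>z. z \<in> cball 0 1 \<Longrightarrow> g (f z) = z"
proof -
  obtain r where g: "g \<in> isometries r" "\<And>z. z \<in> ball 0 1 \<Longrightarrow> p (g z) = p z" using deck_groupE[OF assms(1)] by blast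
  obtain f where f: "f \<in> isometries r" "\<And>z. z \<in> cball 0 1 \<Longrightarrow> f (g z) = z" "\<And>z. z \<in> cball 0 1 \<Longrightarrow> g (f z) = z"
    using isometry_inverse[OF g(1)] by metis
  have "p (f z) = p z" if "z \<in> ball 0 1" for z
    using that g(2)[of "f z"] f(3)[of z] isometry_cball(2)[OF f(1), of z] by auto
  then show ?thesis using that f deck_groupI by metis
qed

text \<open>Near \<open>z\<close> both images lie in one open set on which \<open>p\<close> is
  injective, and both project to \<open>p u\<close>. So the two isometries agree on an open set,
  hence everywhere.\<close>

lemma deck_agree_at_point:
  assumes g: "g \<in> isometries r" "\<And>z. z \<in> ball 0 1 \<Longrightarrow> p (g z) = p z"
    and h: "h \<in> isometries s"
    and U: "open U" "U \<subseteq> ball 0 1" "z \<in> U" "\<And>z. z \<in> U \<Longrightarrow> p (h z) = p z"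
    and eq: "g z = h z" and w: "w \<in> cball 0 1"
  shows "g w = h w"
proof -
  have z: "z \<in> ball 0 1" "z \<in> cball 0 1" using U by auto
  have gz: "g z \<in> ball 0 1" using isometry_cball(2)[OF g(1) z(2)] z by simp
  obtain W where W: "open W" "g z \<in> W" "W \<subseteq> ball 0 1" "inj_on p W"
    using p_locally_inj[OF gz] .
  have op: "open (ball 0 1 \<inter> f -` W)" if "f \<in> isometries r" for f r
    by (rule continuous_open_preimage[OF continuous_on_subset[OF isometry_continuous[OF that]]]) (use W in auto)
  define V where "V = U \<inter> (ball 0 1 \<inter> g -` W) \<inter> (ball 0 1 \<inter> h -` W)"
  have "open V" unfolding V_def using U op[OF g(1)] op[OF h] by blast
  moreover have "z \<in> V" using U z W eq by (auto simp: V_def)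
  moreover have "g u = h u" if "u \<in> V" for u
    using that g(2)[of u] U(4)[of u] inj_onD[OF W(4), of "g u" "h u"] by (auto simp: V_def)
  ultimately show ?thesis
    using isometry_eqI[OF g(1) h, of V w] U w by (auto simp: V_def)
qed

lemma deck_eqI:
  assumes "g \<in> deck_group p" "h \<in> deck_group p" "z \<in> ball 0 1" "g z = h z" "w \<in> cball 0 1"
  shows "g w = h w"
proof -
  obtain r where g: "g \<in> isometries r" "\<And>z. z \<in> ball 0 1 \<Longrightarrow> p (g z) = p z" using deck_groupE[OF assms(1)] by blast
  obtain s where h: "h \<in> isometries s" "\<And>z. z \<in> ball 0 1 \<Longrightarrow> p (h z) = p z" using deck_groupE[OF assms(2)] by blast
  show ?thesis
    by (rule deck_agree_at_point[OF g h(1), of "ball 0 1" z w]) (use h assms in auto)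
qed

text \<open>A fixed point is a point of agreement with the identity, which is a deck transformation
  and does not reverse orientation.\<close>

lemma reversing_deck_no_fixed_point:
  assumes "g \<in> isometries True" "g \<in> deck_group p" "z \<in> ball 0 1"
  shows "g z \<noteq> z"
proof
  assume "g z = z"
  have id: "(\<lambda>z. z) \<in> deck_group p"
    by (rule deck_groupI[of _ False], rule isometriesI[of 0 1]) (auto simp: disc_moebius_def)
  have "g w = w" if "w \<in> ball 0 1" for w
    using deck_eqI[OF assms(2) id assms(3)] \<open>g z = z\<close> that by auto
  then show False
    using isometry_eq_id(1)[OF assms(1), of "ball 0 1"] by auto
qed

text \<open>If \<open>q\<close> is the inverse of \<open>p\<close> near \<open>z'\<close>, then
  \<open>q \<circ> p\<close> is defined near \<open>z\<close> and preserves \<open>hdist\<close>,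
  because \<open>p\<close> is a local isometry at both points; it extends to a global
  isometry.\<close>

lemma local_deck_transformation:
  assumes z: "z \<in> ball 0 1" and z': "z' \<in> ball 0 1" and eq: "p z = p z'"
  obtains r T U where "T \<in> isometries r" "open U" "z \<in> U" "U \<subseteq> ball 0 1" "T z = z'"
    "\<And>u. u \<in> U \<Longrightarrow> p (T u) = p u"
proof -
  obtain V Q q where V: "z' \<in> V" "openin (top_of_set (ball 0 1)) V" and Q: "p z' \<in> Q" "openin (top_of_set S) Q"
    and hom: "homeomorphism V Q p q"
    using covering_space_local_homeomorphism[OF covering z'] by metis
  have Vb: "V \<subseteq> ball 0 1" using V(2) openin_open_eq by auto
  have q: "q y \<in> V" "p (q y) = y" if "y \<in> Q" for y
    using hom that by (auto simp: homeomorphism_def)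
  have qp: "q (p u) = u" if "u \<in> V" for u
    using hom that by (auto simp: homeomorphism_def)
  obtain e where e: "e > 0" "\<And>u v. u \<in> ball 0 1 \<Longrightarrow> v \<in> ball 0 1 \<Longrightarrow> hdist z u < e \<Longrightarrow> hdist z v < e \<Longrightarrow> dist (p u) (p v) = hdist u v"
    using surface z unfolding closed_hyperbolic_surface_def by meson
  obtain e' where e': "e' > 0" "\<And>u v. u \<in> ball 0 1 \<Longrightarrow> v \<in> ball 0 1 \<Longrightarrow> hdist z' u < e' \<Longrightarrow> hdist z' v < e' \<Longrightarrow> dist (p u) (p v) = hdist u v"
    using surface z' unfolding closed_hyperbolic_surface_def by meson
  define B where "B = ball 0 1 \<inter> p -` Q"
  have "openin (top_of_set (ball 0 1)) B"
    unfolding B_def using continuous_on_open_gen[of p "ball 0 1" S] continuous_p Q(2) covering_space_imp_surjective[OF covering]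
    by (metis image_subset_iff_funcset order_refl)
  then have oB: "open B" using openin_open_eq by auto
  have kc: "continuous_on B (\<lambda>u. q (p u))"
    by (rule continuous_on_compose2[of Q q B p])
      (use hom continuous_on_subset[OF continuous_p, of B] in \<open>auto simp: homeomorphism_def B_def\<close>)
  have h0: "hdist u u = 0" for u by (simp add: hdist_def)
  \<comment> \<open>Small enough for \<open>p\<close> to be isometric both around \<open>z\<close>
    and on the image around \<open>z'\<close>.\<close>
  define W where "W = (B \<inter> hdist z -` {..<e}) \<inter> (B \<inter> (\<lambda>u. hdist z' (q (p u))) -` {..<e'})"
  have "continuous_on B (hdist z)"
    by (rule continuous_on_subset[OF continuous_on_hdist[OF z]]) (auto simp: B_def)
  moreover have "continuous_on B (\<lambda>u. hdist z' (q (p u)))"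
    by (rule continuous_on_compose2[OF continuous_on_hdist[OF z'] kc]) (use q Vb in \<open>auto simp: B_def\<close>)
  ultimately have oW: "open W"
    unfolding W_def using oB by (intro open_Int continuous_open_preimage) auto
  have zW: "z \<in> W" using z eq Q qp[OF V(1)] e e' by (auto simp: W_def B_def h0)
  have Wb: "W \<subseteq> ball 0 1" by (auto simp: W_def B_def)
  have kb: "q (p u) \<in> ball 0 1" if "u \<in> W" for u
  proof -
    have "p u \<in> Q" using that by (auto simp: W_def B_def)
    then show ?thesis using q(1) Vb by blast
  qed
  have "hdist (q (p u)) (q (p v)) = hdist u v" if "u \<in> W" "v \<in> W" for u v
    using e(2)[of u v] e'(2)[OF kb kb, of u v] that q by (simp add: W_def B_def)
  then obtain r T U where T: "T \<in> isometries r" "open U" "z \<in> U" "U \<subseteq> W" "\<And>u. u \<in> U \<Longrightarrow> T u = q (p u)"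
    using local_isometry_extends[OF oW Wb zW, of "\<lambda>u. q (p u)"] kb by metis
  have "T z = z'" using T(5)[OF T(3)] eq qp[OF V(1)] by simp
  moreover have "p (T u) = p u" if "u \<in> U" for u
  proof -
    have "p u \<in> Q" using T(4) that by (auto simp: W_def B_def)
    then show ?thesis using T(5)[OF that] q(2) by simp
  qed
  ultimately show ?thesis using that[OF T(1,2,3)] T(4) Wb by blast
qed

text \<open>A local deck transformation extends by continuation: where it commutes with the projection is
  open, and closed because at a limit point it agrees with the local deck transformation there.\<close>

lemma deck_transitive_on_fibres:
  assumes z: "z \<in> ball 0 1" and z': "z' \<in> ball 0 1" and eq: "p z = p z'"
  obtains T where "T \<in> deck_group p" "T z = z'"
proof -
  obtain r T U where T: "T \<in> isometries r" and U: "open U" "z \<in> U" "U \<subseteq> ball 0 1" "T z = z'"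
      "\<And>u. u \<in> U \<Longrightarrow> p (T u) = p u"
    using local_deck_transformation[OF assms] by metis
  \<comment> \<open>\<open>A\<close> is the interior of the relatively closed set \<open>E\<close>
    below. The task is to show that \<open>A\<close> is relatively closed as well.\<close>
  define A where "A = \<Union> {U. open U \<and> U \<subseteq> ball 0 1 \<and> (\<forall>u \<in> U. p (T u) = p u)}"
  define E where "E = {u \<in> ball 0 1. dist (p (T u)) (p u) = 0}"
  have T1: "T u \<in> ball 0 1" if "u \<in> ball 0 1" for u
    using isometry_cball(2)[OF T, of u] that by auto
  have Tc: "continuous_on (ball 0 1) T"
    by (rule continuous_on_subset[OF isometry_continuous[OF T]]) auto
  have "continuous_on (ball 0 1) (\<lambda>u. p (T u))"
    by (rule continuous_on_compose2[OF continuous_p Tc]) (use T1 in auto)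
  then have E: "closedin (top_of_set (ball 0 1)) E"
    unfolding E_def by (intro continuous_closedin_preimage_constant continuous_on_dist continuous_p)
  have oA: "open A" and Ab: "A \<subseteq> ball 0 1" and AE: "A \<subseteq> E" and zA: "z \<in> A"
    using U by (auto simp: A_def E_def)
  have "a \<in> A" if lim: "a islimpt A" and a: "a \<in> ball 0 1" for a
  proof -
    have "a \<in> E" using E lim AE a by (meson closedin_limpt islimpt_subset)
    then have pa: "p a = p (T a)" by (simp add: E_def)
    obtain r' T' U' where T': "T' \<in> isometries r'" and U': "open U'" "a \<in> U'" "U' \<subseteq> ball 0 1" "T' a = T a"
      "\<And>u. u \<in> U' \<Longrightarrow> p (T' u) = p u"
      using local_deck_transformation[OF a T1[OF a] pa] by metis
    obtain W where W: "open W" "T a \<in> W" "W \<subseteq> ball 0 1" "inj_on p W"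
      using p_locally_inj[OF T1[OF a]] .
    have op: "open (ball 0 1 \<inter> f -` W)" if "f \<in> isometries r" for f r
      by (rule continuous_open_preimage[OF continuous_on_subset[OF isometry_continuous[OF that]]]) (use W in auto)
    define V where "V = U' \<inter> (ball 0 1 \<inter> T -` W) \<inter> (ball 0 1 \<inter> T' -` W)"
    have oV: "open V" unfolding V_def using U' op[OF T] op[OF T'] by blast
    have "a \<in> V" using U' a W by (auto simp: V_def)
    then obtain b where "b \<in> A" "b \<in> V" using lim oV by (meson islimptE)
    then have "open (A \<inter> V)" "A \<inter> V \<noteq> {}" "A \<inter> V \<subseteq> ball 0 1" using oA oV Ab by auto
    moreover have "T u = T' u" if "u \<in> A \<inter> V" for u
      using that AE U'(5)[of u] inj_onD[OF W(4), of "T u" "T' u"] by (auto simp: V_def E_def)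
    \<comment> \<open>Agreement on a nonempty open set spreads to the whole disc, so
      \<open>T\<close> inherits from \<open>T'\<close> the compatibility with \<open>p\<close> on
      \<open>U'\<close>, which contains the limit point \<open>a\<close>.\<close>
    ultimately have "T u = T' u" if "u \<in> cball 0 1" for u
      using isometry_eqI[OF T T'] that by blast
    then have "\<forall>u \<in> U'. p (T u) = p u" using U' ball_subset_cball by (metis subsetD)
    then show "a \<in> A" using U' by (auto simp: A_def)
  qed
  then have "closedin (top_of_set (ball 0 1)) A" using Ab by (auto simp: closedin_limpt)
  moreover have "openin (top_of_set (ball 0 1)) A" using oA Ab by (simp add: openin_open_eq)
  ultimately have "A = ball 0 1"
    using zA connected_ball[of "0::complex" 1] unfolding connected_clopen by blast
  then have "p (T u) = p u" if "u \<in> ball 0 1" for u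
    using that AE by (auto simp: E_def)
  then show ?thesis using that[OF deck_groupI[OF T]] U by blast
qed

text \<open>By the Lindelof property, countably many open sets on which \<open>p\<close> is
  injective cover the disc, and each contains at most one point of the fibre.\<close>

lemma countable_fibre: "countable (ball 0 1 \<inter> p -` {y})"
proof -
  obtain \<F>' where F: "\<F>' \<subseteq> {W. open W \<and> inj_on p W}" "countable \<F>'" "\<Union> \<F>' = \<Union> {W. open W \<and> inj_on p W}"
    using Lindelof[of "{W. open W \<and> inj_on p W}"] by auto
  have "ball 0 1 \<subseteq> \<Union> \<F>'"
    unfolding F(3) using p_locally_inj by blast
  then have "ball 0 1 \<inter> p -` {y} \<subseteq> (\<Union>W \<in> \<F>'. W \<inter> p -` {y})" by blast
  moreover have "countable (W \<inter> p -` {y})" if "W \<in> \<F>'" for W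
  proof (rule ccontr)
    assume *: "uncountable (W \<inter> p -` {y})"
    then obtain u where u: "u \<in> W \<inter> p -` {y}" by (metis countable_empty ex_in_conv)
    have "W \<inter> p -` {y} \<subseteq> {u}" using that F(1) u by (auto simp: inj_on_def)
    then show False using * countable_subset[of _ "{u}"] by simp
  qed
  ultimately show ?thesis by (rule countable_subset[OF _ countable_UN[OF F(2)]])
qed

text \<open>Every point of the line of \<open>x\<close> is the image of a point of the line of
  \<open>y\<close> under some deck transformation. If one transformation served two points, it would
  map \<open>y\<close> to a geodesic sharing two points with \<open>x\<close>, hence to
  \<open>x\<close>. Otherwise uncountably many deck transformations would be needed.\<close>

lemma geodesic_projection_eqD:
  assumes x: "x \<in> geodesics" and y: "y \<in> geodesics" and eq: "projection p x = projection p y"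
  obtains h where "h \<in> deck_group p" "h ` y = x"
proof (rule ccontr)
  assume no: "\<not> thesis"
  have "\<exists>h q'. h \<in> deck_group p \<and> q' \<in> hyp_line y \<and> h q' = q" if q: "q \<in> hyp_line x" for q
  proof -
    obtain q' where q': "q' \<in> hyp_line y" "p q' = p q"
      using eq q unfolding projection_def by (metis imageE imageI)
    then show ?thesis
      using deck_transitive_on_fibres[of q' q] hyp_line_subset[OF x] hyp_line_subset[OF y] q by blast
  qed
  then obtain h q' where h: "\<And>q. q \<in> hyp_line x \<Longrightarrow> h q \<in> deck_group p"
    "\<And>q. q \<in> hyp_line x \<Longrightarrow> q' q \<in> hyp_line y" "\<And>q. q \<in> hyp_line x \<Longrightarrow> h q (q' q) = q"
    by metis
  \<comment> \<open>A deck transformation is determined by its value at 0, which lies in the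
    countable fibre over \<open>p 0\<close>.\<close>
  have "inj_on (\<lambda>q. h q 0) (hyp_line x)"
  proof (rule inj_onI, rule ccontr)
    fix q1 q2 assume q: "q1 \<in> hyp_line x" "q2 \<in> hyp_line x" "h q1 0 = h q2 0" "q1 \<noteq> q2"
    have agree: "h q1 w = h q2 w" if "w \<in> cball 0 1" for w
      using deck_eqI[OF h(1)[OF q(1)] h(1)[OF q(2)], of 0] q(3) that by simp
    obtain r where r: "h q1 \<in> isometries r" using deck_groupE[OF h(1)[OF q(1)]] .
    have b: "q' q1 \<in> ball 0 1" "q' q2 \<in> ball 0 1" using h(2)[OF q(1)] h(2)[OF q(2)] hyp_line_subset[OF y] by blast+
    then have "h q1 (q' q2) = q2" using agree[of "q' q2"] h(3)[OF q(2)] by simp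
    then have "q1 \<in> hyp_line (h q1 ` y)" "q2 \<in> hyp_line (h q1 ` y)"
      using hyp_line_isometry[OF r y b(1)] hyp_line_isometry[OF r y b(2)] h q by auto
    then have "h q1 ` y = x"
      using hyp_line_two_points[OF isometry_geodesics[OF r y] x, of q1 q2] q by blast
    then show False using no that h(1) q by blast
  qed
  moreover have "(\<lambda>q. h q 0) ` hyp_line x \<subseteq> ball 0 1 \<inter> p -` {p 0}"
  proof clarify
    fix q assume q: "q \<in> hyp_line x"
    obtain r where r: "h q \<in> isometries r" "\<And>z. z \<in> ball 0 1 \<Longrightarrow> p (h q z) = p z"
      using deck_groupE[OF h(1)[OF q]] by blast
    then show "h q 0 \<in> ball 0 1 \<inter> p -` {p 0}" using isometry_cball(2)[OF r(1), of 0] by auto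
  qed
  then have "countable ((\<lambda>q. h q 0) ` hyp_line x)" using countable_fibre countable_subset by blast
  ultimately have "countable (hyp_line x)" by (rule countable_image_inj_on[rotated])
  then show False using uncountable_hyp_line[OF x] by blast
qed

end

section \<open>Half-plane coordinates along a glide reflection\<close>

text \<open>Upper half-plane to disc. The end \<open>0\<close> goes to \<open>-1\<close>, and the
  omitted value \<open>1\<close> stands for infinity, so the diameter corresponds to the imaginary
  axis.\<close>

definition cayley :: "complex \<Rightarrow> complex" where
  "cayley z = (z - \<i>) / (z + \<i>)"

text \<open>In the upper half-plane these are the isometries fixing \<open>0\<close> and \<open>\<infinity>\<close>; the
  glide reflections are those with negative factor.\<close>

definition dilation :: "real \<Rightarrow> complex \<Rightarrow> complex" where
  "dilation s z = of_real s * (if s > 0 then z else cnj z)"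

lemma dilation_dilation: "s \<noteq> 0 \<Longrightarrow> t \<noteq> 0 \<Longrightarrow> dilation s (dilation t z) = dilation (s * t) z"
  by (auto simp: dilation_def zero_less_mult_iff)

lemma dilation_of_real: "dilation s (of_real t) = of_real (s * t)"
  by (simp add: dilation_def)

lemma Im_dilation: "Im (dilation s z) = \<bar>s\<bar> * Im z"
  by (auto simp: dilation_def)

lemma cayley_denominator: "Im z \<ge> 0 \<Longrightarrow> z + \<i> \<noteq> 0"
  by (auto simp: complex_eq_iff)

lemma cayley_0: "cayley 0 = - 1"
  by (simp add: cayley_def)

lemma cayley_cball:
  assumes "Im z \<ge> 0"
  shows "cayley z \<in> cball 0 1" "Im z > 0 \<Longrightarrow> cayley z \<in> ball 0 1" "Im z = 0 \<Longrightarrow> cayley z \<in> sphere 0 1"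
proof -
  have eq: "(cmod (z + \<i>))\<^sup>2 = (cmod (z - \<i>))\<^sup>2 + 4 * Im z"
    unfolding cmod_power2 by (simp add: power2_eq_square algebra_simps)
  have pos: "cmod (z + \<i>) > 0" using cayley_denominator[OF assms] by simp
  have n: "cmod (cayley z) = cmod (z - \<i>) / cmod (z + \<i>)"
    by (simp add: cayley_def norm_divide)
  have "cmod (z - \<i>) \<le> cmod (z + \<i>)"
    by (rule power2_le_imp_le) (use eq assms in linarith, simp)
  then show "cayley z \<in> cball 0 1" using pos by (simp add: n)
  show "cayley z \<in> ball 0 1" if "Im z > 0"
  proof -
    have "cmod (z - \<i>) < cmod (z + \<i>)"
      by (rule power2_less_imp_less) (use eq that in linarith, simp)
    then show ?thesis using pos by (simp add: n)
  qed
  show "cayley z \<in> sphere 0 1" if "Im z = 0"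
  proof -
    have "cmod (z - \<i>) = cmod (z + \<i>)"
      by (rule power2_eq_imp_eq) (use eq that in linarith, simp_all)
    then show ?thesis using pos by (simp add: n)
  qed
qed

lemma cayley_neq_1: "cayley z \<noteq> 1"
proof
  assume eq: "cayley z = 1"
  then have "z + \<i> \<noteq> 0" by (auto simp: cayley_def)
  with eq have "z - \<i> = z + \<i>" by (simp add: cayley_def)
  then show False by (simp add: complex_eq_iff)
qed

lemma cayley_eqD:
  assumes "Im z \<ge> 0" "Im w \<ge> 0" "cayley z = cayley w"
  shows "z = w"
proof -
  have "(z - \<i>) * (w + \<i>) = (w - \<i>) * (z + \<i>)"
    using assms cayley_denominator[of z] cayley_denominator[of w] by (simp add: cayley_def frac_eq_eq)
  then have "2 * \<i> * (z - w) = 0" by (simp add: algebra_simps)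
  then show ?thesis by simp
qed

lemma continuous_cayley: "continuous_on {z. Im z \<ge> 0} cayley"
  unfolding cayley_def[abs_def] using cayley_denominator by (intro continuous_intros) auto

text \<open>Multiplied out rather than as a quotient, the modulus in the half-plane can be compared
  with a bound by functions that stay continuous at the end \<open>1\<close>. The test function is
  built from this.\<close>

lemma cayley_ratio:
  assumes "Im z \<ge> 0"
  shows "cmod (1 + cayley z) = cmod z * cmod (1 - cayley z)"
proof -
  have "1 + cayley z = 2 * z / (z + \<i>)" "1 - cayley z = 2 * \<i> / (z + \<i>)"
    using cayley_denominator[OF assms] by (simp_all add: cayley_def field_simps)
  then show ?thesis by (simp add: norm_divide norm_mult)
qed

lemma sphere_cayley:
  assumes "w \<in> sphere 0 1" "w \<noteq> 1"
  obtains t :: real where "w = cayley (of_real t)"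
proof -
  define z where "z = \<i> * (1 + w) / (1 - w)"
  have nz: "1 - w \<noteq> 0" using assms by simp
  have zi: "z + \<i> = 2 * \<i> / (1 - w)" "z - \<i> = 2 * \<i> * w / (1 - w)"
    using nz by (simp_all add: z_def field_simps)
  have w: "cayley z = w" using nz by (simp add: cayley_def zi)
  have "w * cnj w = 1" using assms by (simp flip: complex_norm_square)
  then have "cnj w = 1 / w" "w \<noteq> 0" by (metis nonzero_eq_divide_eq mult.commute mult_zero_left zero_neq_one)+
  then have "cnj z = z"
    using nz by (simp add: z_def field_simps)
  then obtain t where "z = of_real t" by (metis Reals_cnj_iff Reals_cases)
  with w that show ?thesis by metis
qed

text \<open>With \<open>z = x + \<i> * y\<close> the right-hand side is
  \<open>(x - a) * (x - b) + y^2 = 0\<close>, the half-circle over the segment from \<open>a\<close>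
  to \<open>b\<close>.\<close>

lemma line_form_cayley:
  assumes "Im z > 0"
  shows "line_form (cayley (of_real a)) (cayley (of_real b)) (cayley z) = 0 \<longleftrightarrow>
    (cmod z)\<^sup>2 - (a + b) * Re z + a * b = 0"
proof -
  define A B where "A = complex_of_real a" and "B = complex_of_real b"
  have nz: "A + \<i> \<noteq> 0" "B + \<i> \<noteq> 0" "z + \<i> \<noteq> 0"
    using cayley_denominator[of A] cayley_denominator[of B] cayley_denominator[of z] assms by (auto simp: A_def B_def)
  have "cnj (z + \<i>) \<noteq> 0" using nz by (simp only: complex_cnj_zero_iff not_False_eq_True)
  then have nz': "cnj z - \<i> \<noteq> 0" by simp
  have d: "cayley z - cayley C = 2 * \<i> * (z - C) / ((z + \<i>) * (C + \<i>))" if "C + \<i> \<noteq> 0" for C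
    using nz that by (simp add: cayley_def diff_frac_eq) (simp add: algebra_simps)
  have e: "1 - cayley C * cnj (cayley z) = 2 * \<i> * (cnj z - C) / ((C + \<i>) * (cnj z - \<i>))" if "C + \<i> \<noteq> 0" for C
  proof -
    have "1 - cayley C * cnj (cayley z) = ((C + \<i>) * (cnj z - \<i>) - (C - \<i>) * (cnj z + \<i>)) / ((C + \<i>) * (cnj z - \<i>))"
    proof -
      have "cayley C * cnj (cayley z) = ((C - \<i>) * (cnj z + \<i>)) / ((C + \<i>) * (cnj z - \<i>))"
        by (simp add: cayley_def)
      then show ?thesis using nz' that by (simp only: diff_divide_distrib) simp
    qed
    then show ?thesis by (simp add: algebra_simps)
  qed
  have "line_form (cayley A) (cayley B) (cayley z) =
      - 4 / ((z + \<i>) * (A + \<i>) * (B + \<i>) * (cnj z - \<i>)) * ((z - A) * (cnj z - B) + (z - B) * (cnj z - A))"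
    unfolding line_form_def d[OF nz(1)] d[OF nz(2)] e[OF nz(1)] e[OF nz(2)]
  proof -
    have 1: "(2 * \<i> * u / (f * g)) * (2 * \<i> * v / (h * k)) = - 4 / (f * g * h * k) * (u * v)" for u v f g h k
    proof -
      have "(2 * \<i> * u) * (2 * \<i> * v) = (2 * \<i> * (2 * \<i>)) * (u * v)" by (simp only: mult_ac)
      also have "2 * \<i> * (2 * \<i>) = - 4" by simp
      finally have "(2 * \<i> * u) * (2 * \<i> * v) = - 4 * (u * v)" .
      then show ?thesis unfolding times_divide_times_eq by (simp only: times_divide_eq_left mult.assoc)
    qed
    have 2: "(2 * \<i> * u / (f * g)) * (2 * \<i> * v / (h * k)) = - 4 / (f * h * g * k) * (u * v)" for u v f g h k
      unfolding 1 by (simp only: mult_ac)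
    show "(2 * \<i> * (z - A) / ((z + \<i>) * (A + \<i>))) * (2 * \<i> * (cnj z - B) / ((B + \<i>) * (cnj z - \<i>)))
      + (2 * \<i> * (z - B) / ((z + \<i>) * (B + \<i>))) * (2 * \<i> * (cnj z - A) / ((A + \<i>) * (cnj z - \<i>)))
      = - 4 / ((z + \<i>) * (A + \<i>) * (B + \<i>) * (cnj z - \<i>))
        * ((z - A) * (cnj z - B) + (z - B) * (cnj z - A))"
      unfolding 1[of "z - A"] 2[of "z - B"] by (rule distrib_left[symmetric])
  qed
  moreover have "- 4 / ((z + \<i>) * (A + \<i>) * (B + \<i>) * (cnj z - \<i>)) \<noteq> 0"
    using nz nz' by simp
  ultimately have "line_form (cayley A) (cayley B) (cayley z) = 0 \<longleftrightarrow> (z - A) * (cnj z - B) + (z - B) * (cnj z - A) = 0"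
    by (simp only: mult_eq_0_iff simp_thms)
  also have "(z - A) * (cnj z - B) + (z - B) * (cnj z - A) = of_real (2 * ((cmod z)\<^sup>2 - (a + b) * Re z + a * b))"
    unfolding cmod_power2 by (simp add: A_def B_def complex_eq_iff power2_eq_square algebra_simps)
  finally show ?thesis
    unfolding A_def B_def of_real_eq_0_iff by (simp only: mult_eq_0_iff) simp
qed

text \<open>Real coefficients make the map fix both \<open>1\<close> and \<open>-1\<close>, so it is
  a dilation of the half-plane.\<close>

lemma disc_moebius_cayley:
  fixes a b :: real
  assumes "\<bar>b\<bar> < \<bar>a\<bar>" "Im z \<ge> 0"
  shows "disc_moebius (of_real a) (of_real b) (cayley z) = cayley (of_real ((a + b) / (a - b)) * z)"
proof -
  have nz: "complex_of_real (a - b) \<noteq> 0" "z + \<i> \<noteq> 0"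
    using assms cayley_denominator[of z] by (simp_all only: of_real_eq_0_iff) auto
  have "disc_moebius (of_real a) (of_real b) (cayley z) =
     ((z + \<i>) * (of_real a * cayley z + of_real b)) / ((z + \<i>) * (of_real b * cayley z + of_real a))"
    using nz by (simp add: disc_moebius_def)
  also have "\<dots> = (of_real a * (z - \<i>) + of_real b * (z + \<i>)) / (of_real b * (z - \<i>) + of_real a * (z + \<i>))"
  proof -
    have "(z + \<i>) * (c * cayley z + d) = c * (z - \<i>) + d * (z + \<i>)" for c d
      using nz(2) by (simp add: cayley_def distrib_left mult.commute)
    then show ?thesis by simp
  qed
  also have "\<dots> = (of_real (a - b) * (of_real ((a + b) / (a - b)) * z - \<i>)) / (of_real (a - b) * (of_real ((a + b) / (a - b)) * z + \<i>))"
  proof -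
    have "of_real (a - b) * (of_real ((a + b) / (a - b)) * z) = of_real (a + b) * z"
      using nz(1) by (simp add: mult.assoc[symmetric])
    then show ?thesis unfolding right_diff_distrib[of "of_real (a - b)"] distrib_left[of "of_real (a - b)"]
      by (simp add: algebra_simps)
  qed
  also have "\<dots> = cayley (of_real ((a + b) / (a - b)) * z)"
    using nz(1) by (simp add: cayley_def del: of_real_diff of_real_add of_real_divide)
  finally show ?thesis .
qed

lemma cnj_cayley: "cnj (cayley z) = cayley (- cnj z)"
proof -
  have "cnj (cayley z) = (- (cnj z + \<i>)) / (- (cnj z - \<i>))"
    by (simp only: minus_divide_divide) (simp add: cayley_def)
  then show ?thesis by (simp add: cayley_def algebra_simps)
qed

text \<open>A reversing isometry exchanging the ends of the diameter would be \<open>z \<mapsto> s / cnj z\<close> in the half-plane,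
  which fixes the point \<open>\<i> * sqrt s\<close>.\<close>

lemma reversing_isometry_fixing_diameter:
  assumes g: "g \<in> isometries True" "g ` {- 1, 1} = {- 1, 1}" and nofix: "\<And>z. z \<in> ball 0 1 \<Longrightarrow> g z \<noteq> z"
  obtains l where "l > 0" "l \<noteq> 1" "g 1 = 1" "\<And>z. Im z \<ge> 0 \<Longrightarrow> g (cayley z) = cayley (dilation (- l) z)"
proof -
  obtain \<alpha> \<beta> where ab: "cmod \<beta> < cmod \<alpha>" and g': "\<And>z. g z = disc_moebius \<alpha> \<beta> (cnj z)"
    using isometriesE[OF g(1)] by metis
  have d: "cnj \<beta> + cnj \<alpha> \<noteq> 0" "cnj \<alpha> - cnj \<beta> \<noteq> 0"
    using moebius_denominator_nonzero[OF ab, of 1] moebius_denominator_nonzero[OF ab, of "-1"] by auto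
  have g1: "g 1 = (\<alpha> + \<beta>) / (cnj \<beta> + cnj \<alpha>)" "g (- 1) = (\<beta> - \<alpha>) / (cnj \<alpha> - cnj \<beta>)"
    by (simp_all add: g' disc_moebius_def)
  have "g 1 = 1 \<and> g (-1) = -1 \<or> g 1 = -1 \<and> g (-1) = 1"
    using g(2) by (auto simp: doubleton_eq_iff)
  then show ?thesis
  proof (elim disjE conjE)
    assume fix1: "g 1 = 1" "g (-1) = -1"
    then have "\<alpha> + \<beta> = cnj \<beta> + cnj \<alpha>" "\<beta> - \<alpha> = - (cnj \<alpha> - cnj \<beta>)"
      using d unfolding g1 by (metis divide_eq_1_iff, metis divide_eq_eq mult_minus1)
    then have "Im \<alpha> = 0" "Im \<beta> = 0" by (auto simp: complex_eq_iff)
    then obtain a b where r: "\<alpha> = of_real a" "\<beta> = of_real b"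
      by (metis complex_is_Real_iff Reals_cases)
    have ab': "\<bar>b\<bar> < \<bar>a\<bar>" using ab r by simp
    define l where "l = (a + b) / (a - b)"
    have l0: "l > 0" using ab' unfolding l_def zero_less_divide_iff by auto
    have gl: "g (cayley z) = cayley (dilation (- l) z)" if "Im z \<ge> 0" for z
      using disc_moebius_cayley[OF ab', of "- cnj z"] that l0
      by (simp add: g' r cnj_cayley l_def dilation_def)
    \<comment> \<open>For \<open>l = 1\<close> the map would be the reflection
      \<open>z \<mapsto> - cnj z\<close>, which fixes \<open>\<i>\<close>.\<close>
    have "l \<noteq> 1"
    proof
      assume "l = 1"
      then have "g (cayley \<i>) = cayley \<i>" using gl[of \<i>] by (simp add: dilation_def)
      then show False using nofix[OF cayley_cball(2)[of \<i>]] by simp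
    qed
    then show ?thesis using that l0 fix1 gl by blast
  next
    assume swap: "g 1 = -1" "g (-1) = 1"
    then have "\<alpha> + \<beta> = - (cnj \<beta> + cnj \<alpha>)" "\<beta> - \<alpha> = cnj \<alpha> - cnj \<beta>"
      using d unfolding g1 by (metis divide_eq_eq mult_minus1, metis divide_eq_1_iff)
    then have re0: "Re \<alpha> = 0" "Re \<beta> = 0" by (auto simp: complex_eq_iff)
    define a b where "a = Im \<alpha>" and "b = Im \<beta>"
    have r: "\<alpha> = \<i> * of_real a" "\<beta> = \<i> * of_real b"
      using re0 by (auto simp: complex_eq_iff a_def b_def)
    have ab': "\<bar>b\<bar> < \<bar>a\<bar>" using ab r by (simp add: norm_mult)
    define q where "q = b / a"
    have q: "\<bar>q\<bar> < 1" "b = q * a" using ab' by (auto simp: q_def abs_divide)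
    define s where "s = sqrt (1 - q\<^sup>2)"
    have "q\<^sup>2 < 1" using q by (simp add: abs_square_less_1)
    then have s: "s \<ge> 0" "s\<^sup>2 = 1 - q\<^sup>2" by (simp_all add: s_def)
    \<comment> \<open>The root of \<open>q * t^2 + 2 * t + q = 0\<close> inside the unit interval,
      rationalised so that \<open>q = 0\<close> is no special case. It gives the fixed point on the
      diameter.\<close>
    define t where "t = - q / (1 + s)"
    have ts: "t * (1 + s) = - q" using s by (simp add: t_def)
    have "\<bar>t\<bar> \<le> \<bar>q\<bar>" using s by (simp add: t_def abs_divide divide_le_eq mult_le_cancel_left1)
    then have t1: "\<bar>t\<bar> < 1" using q by simp
    have "(1 + s)\<^sup>2 * (q * t\<^sup>2 + 2 * t + q) = q * (t * (1 + s))\<^sup>2 + 2 * (t * (1 + s)) * (1 + s) + q * (1 + s)\<^sup>2"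
      by (simp add: power2_eq_square algebra_simps)
    also have "\<dots> = q * (q\<^sup>2 - 1 + s\<^sup>2)" unfolding ts by (simp add: power2_eq_square algebra_simps)
    finally have "q * t\<^sup>2 + 2 * t + q = 0" using s by auto
    then have "a * (q * t\<^sup>2 + 2 * t + q) = 0" by simp
    then have quad: "a * t + b = - (t * (b * t + a))" by (simp add: q(2) power2_eq_square algebra_simps)
    have "\<bar>b * t\<bar> \<le> \<bar>b\<bar> * 1" unfolding abs_mult using t1 by (intro mult_left_mono) auto
    then have nz: "b * t + a \<noteq> 0" using ab' by linarith
    have "g (of_real t) = \<i> * of_real (a * t + b) / (- \<i> * of_real (b * t + a))"
      by (simp add: g' r disc_moebius_def algebra_simps)
    also have "\<dots> = of_real (t * (b * t + a) / (b * t + a))"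
      unfolding quad by (simp flip: of_real_mult of_real_add of_real_divide)
    also have "\<dots> = of_real t" using nz by simp
    finally show ?thesis using nofix[of "of_real t"] t1 by simp
  qed
qed

context hyperbolic_surface
begin

text \<open>The deck transformation \<open>h\<close> need not be \<open>g\<close>: if
  \<open>g\<close> turns out to have a factor below 1 in modulus, its inverse is taken to achieve
  \<open>l > 1\<close>.\<close>

lemma glide_reflection_coordinates:
  assumes x: "x \<in> geodesics" and g: "g \<in> isometries True" "g \<in> deck_group p" "g ` x = x"
  obtains m l h where "m \<in> isometries False" "m ` {- 1, 1} = x" "l > 1" "h \<in> deck_group p" "h (m 1) = m 1"
    "\<And>z. Im z \<ge> 0 \<Longrightarrow> h (m (cayley z)) = m (cayley (dilation (- l) z))"
proof -
  obtain a b where ab: "x = {a, b}" "a \<in> sphere 0 1" "b \<in> sphere 0 1" "a \<noteq> b"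
    using geodesicsE[OF x] .
  obtain m where m: "m \<in> isometries False" "m (- 1) = a" "m 1 = b"
    using exists_isometry_endpoints[OF ab(2-)] .
  have mx: "m ` {- 1, 1} = x" using m ab by simp
  obtain m' where m': "m' \<in> isometries False" "\<And>z. z \<in> cball 0 1 \<Longrightarrow> m' (m z) = z" "\<And>z. z \<in> cball 0 1 \<Longrightarrow> m (m' z) = z"
    using isometry_inverse[OF m(1)] by metis
  obtain k1 where k1: "k1 \<in> isometries True" "\<And>z. z \<in> cball 0 1 \<Longrightarrow> k1 z = g (m z)"
    using isometry_compose[OF g(1) m(1)] by auto
  obtain k where k: "k \<in> isometries True" "\<And>z. z \<in> cball 0 1 \<Longrightarrow> k z = m' (k1 z)"
    using isometry_compose[OF m'(1) k1(1)] by auto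
  have mk: "m (k z) = g (m z)" if "z \<in> cball 0 1" for z
    using that k k1 m'(3) isometry_cball(1)[OF k1(1) that] by simp
  have kg: "k z = m' (g (m z))" if "z \<in> cball 0 1" for z using that k k1 by simp
  have "k ` {-1, 1} = m' ` g ` m ` {-1, 1}" using kg by simp
  also have "\<dots> = m' ` m ` {- 1, 1}" unfolding mx g(3) by (simp only: mx)
  also have "\<dots> = {-1, 1}" using m'(2) by simp
  finally have kd: "k ` {-1, 1} = {-1, 1}" .
  have "k z \<noteq> z" if "z \<in> ball 0 1" for z
  proof
    assume "k z = z"
    moreover have "z \<in> cball 0 1" using that by simp
    ultimately have "g (m z) = m z" using mk by metis
    then show False
      using reversing_deck_no_fixed_point[OF g(1,2)] isometry_cball(2)[OF m(1) \<open>z \<in> cball 0 1\<close>] that by blast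
  qed
  then obtain l where l: "l > 0" "l \<noteq> 1" "k 1 = 1" "\<And>z. Im z \<ge> 0 \<Longrightarrow> k (cayley z) = cayley (dilation (- l) z)"
    using reversing_isometry_fixing_diameter[OF k(1) kd] by metis
  have g1: "g (m 1) = m 1" using mk[of 1] l by simp
  have gc: "g (m (cayley z)) = m (cayley (dilation (- l) z))" if "Im z \<ge> 0" for z
    using mk[OF cayley_cball(1)[OF that]] l(4)[OF that] by simp
  show ?thesis
  proof (cases "l > 1")
    case True
    then show ?thesis using that[OF m(1) mx _ g(2) g1] gc by blast
  next
    case False
    then have l1: "1 / l > 1" using l by simp
    obtain f where f: "f \<in> deck_group p" "\<And>z. z \<in> cball 0 1 \<Longrightarrow> f (g z) = z" "\<And>z. z \<in> cball 0 1 \<Longrightarrow> g (f z) = z"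
      using deck_inverse[OF g(2)] by metis
    have mb: "m z \<in> cball 0 1" if "z \<in> cball 0 1" for z using isometry_cball(1)[OF m(1) that] .
    have "f (m 1) = m 1" using f(2)[OF mb, of 1] g1 by simp
    moreover have "f (m (cayley z)) = m (cayley (dilation (- (1 / l)) z))" if "Im z \<ge> 0" for z
    proof -
      have im: "Im (dilation (- (1 / l)) z) \<ge> 0" using that l by (simp add: Im_dilation)
      have "dilation (- l) (dilation (- (1 / l)) z) = z"
        using l by (simp add: dilation_dilation) (simp add: dilation_def)
      then have "g (m (cayley (dilation (- (1 / l)) z))) = m (cayley z)"
        using gc[OF im] by simp
      then show ?thesis using f(2)[OF mb[OF cayley_cball(1)[OF im]]] by simp
    qed
    ultimately show ?thesis using that[OF m(1) mx l1 f(1)] by blast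
  qed
qed

end

section \<open>Counting self-intersections\<close>

text \<open>The quotient equals \<open>s + 1 / s + 2\<close>, and \<open>s + 1 / s\<close> takes
  equal values only at \<open>s\<close> and at \<open>1 / s\<close>.\<close>

lemma shifted_square_ratio_inj:
  fixes s t :: real
  assumes "\<bar>s\<bar> > 1" "\<bar>t\<bar> > 1" and eq: "(1 + s)\<^sup>2 / s = (1 + t)\<^sup>2 / t"
  shows "s = t"
proof -
  have nz: "s \<noteq> 0" "t \<noteq> 0" using assms by auto
  have "\<bar>s * t\<bar> > 1" unfolding abs_mult using assms by (metis less_1_mult)
  then have st: "s * t \<noteq> 1" by auto
  have "(1 + s)\<^sup>2 * t = (1 + t)\<^sup>2 * s" using eq nz by (simp add: frac_eq_eq)
  then have "(s - t) * (s * t - 1) = 0" by (simp add: power2_eq_square algebra_simps)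
  then show ?thesis using st by simp
qed

text \<open>The coordinates of the intersection point of the half-circle with ends \<open>a\<close>, \<open>b\<close> and its
  image under the dilation by \<open>s\<close>.\<close>

lemma dilated_half_circle_intersection:
  fixes a b s :: real
  assumes sab: "s * (a * b) > 0" and ab0: "a + b \<noteq> 0" and small: "(1 + s)\<^sup>2 / s * (a * b / (a + b)\<^sup>2) \<le> 1 / 4"
  obtains z where "Im z > 0" "(cmod z)\<^sup>2 - (a + b) * Re z + a * b = 0"
    "(cmod z)\<^sup>2 - (s * a + s * b) * Re z + (s * a) * (s * b) = 0"
    "(Re z)\<^sup>2 = (1 + s)\<^sup>2 / s * (a * b / (a + b)\<^sup>2) * (cmod z)\<^sup>2"
proof -
  define q where "q = (1 + s)\<^sup>2 / s * (a * b / (a + b)\<^sup>2)"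
  \<comment> \<open>Eliminating between the two circle equations gives
    \<open>(cmod z)^2 = s * (a * b)\<close> and this real part.\<close>
  define x where "x = (1 + s) * (a * b) / (a + b)"
  have s0: "s \<noteq> 0" using sab by auto
  have xq: "x\<^sup>2 = q * (s * (a * b))"
    using ab0 s0 by (simp add: x_def q_def power_divide power_mult_distrib) (simp add: power2_eq_square)
  \<comment> \<open>The bound on \<open>q\<close> leaves room for a positive imaginary part. The
    same \<open>1 / 4\<close> reappears as the aperture of
    \<open>fundamental_region\<close>.\<close>
  have "q * (s * (a * b)) \<le> (1 / 4) * (s * (a * b))"
    using sab small unfolding q_def by (intro mult_right_mono) auto
  then have lt: "x\<^sup>2 < s * (a * b)" using sab xq by simp
  define z where "z = Complex x (sqrt (s * (a * b) - x\<^sup>2))"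
  have z: "Re z = x" "Im z > 0" "(cmod z)\<^sup>2 = s * (a * b)"
    using lt by (simp_all add: z_def cmod_power2)
  have x: "(a + b) * x = (1 + s) * (a * b)" using ab0 by (simp add: x_def)
  have 1: "(cmod z)\<^sup>2 - (a + b) * Re z + a * b = 0"
    unfolding z x by (simp add: algebra_simps)
  have "(s * a + s * b) * Re z = s * ((1 + s) * (a * b))"
    unfolding z x[symmetric] by (simp add: algebra_simps)
  then have 2: "(cmod z)\<^sup>2 - (s * a + s * b) * Re z + (s * a) * (s * b) = 0"
    unfolding z by (simp add: algebra_simps)
  show ?thesis using that[OF z(2) 1 2] xq z by (simp add: q_def)
qed

lemma card_image_bounded_fibres:
  assumes "finite A" "\<And>y. card {x \<in> A. f x = y} \<le> n"
  shows "card A \<le> n * card (f ` A)"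
proof -
  have "card A = (\<Sum>y \<in> f ` A. card {x \<in> A. f x = y})"
    using sum.image_gen[OF assms(1), of "\<lambda>_. 1 :: nat" f] by (simp only: card_eq_sum)
  also have "\<dots> \<le> (\<Sum>y \<in> f ` A. n)" using assms(2) by (rule sum_mono)
  finally show ?thesis by (simp add: mult.commute)
qed

section \<open>Crossings with the images under powers of the glide reflection\<close>

locale glide_reflection = hyperbolic_surface +
  fixes m h :: "complex \<Rightarrow> complex" and l :: real
  assumes m: "m \<in> isometries False" and l: "l > 1" and h: "h \<in> deck_group p" and h_fixes: "h (m 1) = m 1"
    and h_cayley: "\<And>z. Im z \<ge> 0 \<Longrightarrow> h (m (cayley z)) = m (cayley (dilation (- l) z))"
begin

abbreviation chart :: "complex \<Rightarrow> complex" where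
  "chart z \<equiv> m (cayley z)"

lemma chart_ball: "Im z > 0 \<Longrightarrow> chart z \<in> ball 0 1"
  and chart_sphere: "Im z = 0 \<Longrightarrow> chart z \<in> sphere 0 1"
  using isometry_cball[OF m cayley_cball(1)[of z]] cayley_cball[of z] by auto

lemma chart_eqD: "Im z \<ge> 0 \<Longrightarrow> Im w \<ge> 0 \<Longrightarrow> chart z = chart w \<Longrightarrow> z = w"
  using inj_onD[OF isometry_inj_on[OF m]] cayley_eqD cayley_cball(1) by metis

lemma chart_of_real_eqD: "chart (of_real a) = chart (of_real b) \<Longrightarrow> a = b"
  using chart_eqD[of "of_real a" "of_real b"] by simp

lemma hyp_line_chart:
  assumes "a \<noteq> b" "Im z > 0"
  shows "chart z \<in> hyp_line {chart (of_real a), chart (of_real b)} \<longleftrightarrow> (cmod z)\<^sup>2 - (a + b) * Re z + a * b = 0"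
proof -
  have "chart (of_real a) \<noteq> chart (of_real b)"
    using chart_eqD[of "of_real a" "of_real b"] assms by auto
  then have "chart z \<in> hyp_line {chart (of_real a), chart (of_real b)} \<longleftrightarrow>
      line_form (chart (of_real a)) (chart (of_real b)) (chart z) = 0"
    using chart_sphere[of "of_real a"] chart_sphere[of "of_real b"] chart_ball[OF assms(2)]
    by (simp add: hyp_line_eq)
  also have "\<dots> \<longleftrightarrow> line_form (cayley (of_real a)) (cayley (of_real b)) (cayley z) = 0"
    by (rule line_form_isometry[OF m cayley_cball(1) cayley_cball(1) cayley_cball(1)]) (use assms in auto)
  finally show ?thesis using line_form_cayley[OF assms(2)] by simp
qed

lemma deck_dilation:
  obtains g where "g \<in> deck_group p" "g (m 1) = m 1" "\<And>z. Im z \<ge> 0 \<Longrightarrow> g (chart z) = chart (dilation ((- l) ^ Suc n) z)"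
proof -
  have "\<exists>g \<in> deck_group p. g (m 1) = m 1 \<and> (\<forall>z. Im z \<ge> 0 \<longrightarrow> g (chart z) = chart (dilation ((- l) ^ Suc n) z))"
  proof (induction n)
    case 0
    then show ?case using h h_fixes h_cayley by auto
  next
    case (Suc n)
    then obtain g where g: "g \<in> deck_group p" "g (m 1) = m 1" "\<And>z. Im z \<ge> 0 \<Longrightarrow> g (chart z) = chart (dilation ((- l) ^ Suc n) z)"
      by blast
    obtain f where f: "f \<in> deck_group p" "\<And>z. z \<in> cball 0 1 \<Longrightarrow> f z = h (g z)"
      using deck_compose[OF h g(1)] by metis
    have mb: "m z \<in> cball 0 1" if "z \<in> cball 0 1" for z using isometry_cball(1)[OF m that] .
    have "f (m 1) = m 1" using f(2)[OF mb, of 1] g h_fixes by simp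
    moreover have "f (chart z) = chart (dilation ((- l) ^ Suc (Suc n)) z)" if "Im z \<ge> 0" for z
    proof -
      have "f (chart z) = h (chart (dilation ((- l) ^ Suc n) z))"
        using f(2)[OF mb[OF cayley_cball(1)[OF that]]] g(3)[OF that] by simp
      also have "\<dots> = chart (dilation (- l) (dilation ((- l) ^ Suc n) z))"
        using that by (intro h_cayley) (simp only: Im_dilation, simp)
      also have "dilation (- l) (dilation ((- l) ^ Suc n) z) = dilation ((- l) ^ Suc (Suc n)) z"
        using l by (subst dilation_dilation) auto
      finally show ?thesis .
    qed
    ultimately show ?case using f(1) by blast
  qed
  then show ?thesis using that by blast
qed

text \<open>Even powers have a positive factor, so their dilations are plain multiplications; they
  suffice for moving points into a compact set.\<close>

lemma projection_invariant:
  assumes "Im z > 0"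
  shows "p (chart (of_real (l ^ (2 * n)) * z)) = p (chart z)"
proof (cases n)
  case (Suc k)
  obtain g where g: "g \<in> deck_group p" "\<And>z. Im z \<ge> 0 \<Longrightarrow> g (chart z) = chart (dilation ((- l) ^ Suc (2 * k + 1)) z)"
    using deck_dilation[of "2 * k + 1"] by blast
  have "(- l) ^ Suc (2 * k + 1) = l ^ (2 * n)" using Suc by simp
  then have "g (chart z) = chart (of_real (l ^ (2 * n)) * z)"
    using g(2)[of z] assms l by (simp add: dilation_def)
  then show ?thesis using deck_groupE[OF g(1)] chart_ball[OF assms] by metis
qed simp

text \<open>Fundamental for the square of the glide reflection only, and only near the axis: the
  condition on \<open>Re z\<close> selects a sector around the imaginary axis, which keeps the
  region off the boundary and makes it compact in the open half-plane.\<close>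

definition fundamental_region :: "complex set" where
  "fundamental_region = {z. Im z \<ge> 0 \<and> 1 \<le> cmod z \<and> cmod z \<le> l\<^sup>2 \<and> 4 * (Re z)\<^sup>2 \<le> (cmod z)\<^sup>2}"

lemma Im_fundamental_region: "z \<in> fundamental_region \<Longrightarrow> Im z > 0"
proof (rule ccontr)
  assume z: "z \<in> fundamental_region" and "\<not> Im z > 0"
  then have "Im z = 0" by (simp add: fundamental_region_def)
  then have "(cmod z)\<^sup>2 = (Re z)\<^sup>2" by (simp add: cmod_power2)
  moreover have "4 * (Re z)\<^sup>2 \<le> (cmod z)\<^sup>2" "1 \<le> cmod z" using z by (auto simp: fundamental_region_def)
  ultimately have "(cmod z)\<^sup>2 = 0" by (smt (verit) zero_le_power2)
  then show False using \<open>1 \<le> cmod z\<close> by simp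
qed

text \<open>A power of \<open>l^2\<close> brings the modulus between 1 and \<open>l^2\<close>.
  Scaling leaves the ratio \<open>q\<close> alone, so \<open>q\<close> remains a label of the
  crossing.\<close>

lemma move_to_fundamental_region:
  assumes z: "Im z > 0" and q: "(Re z)\<^sup>2 = q * (cmod z)\<^sup>2" "q \<le> 1 / 4"
  obtains w where "w \<in> fundamental_region" "p (chart w) = p (chart z)" "(Re w)\<^sup>2 = q * (cmod w)\<^sup>2"
proof -
  define L where "L = l\<^sup>2"
  have L: "L > 1" using l by (simp add: L_def)
  have z0: "cmod z > 0" using z by auto
  obtain n w where w: "w = of_real n * z" "n > 0" "p (chart w) = p (chart z)" "1 \<le> cmod w" "cmod w \<le> L"
  proof -
    define k where "k = \<lfloor>log L (cmod z)\<rfloor>"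
    have k: "L powi k \<le> cmod z" "cmod z < L powi (k + 1)"
    proof -
      have "L powr (of_int k) \<le> cmod z" "cmod z < L powr (of_int (k + 1))"
        unfolding le_log_iff[OF L z0, symmetric] log_less_iff[OF L z0, symmetric] k_def by linarith+
      then show "L powi k \<le> cmod z" "cmod z < L powi (k + 1)"
        using L powr_real_of_int'[of L k] powr_real_of_int'[of L "k + 1"] by linarith+
    qed
    define c where "c = L powi (- k)"
    define w where "w = of_real c * z"
    have Lp: "L powi j > 0" for j using L by simp
    then have c: "c > 0" by (simp add: c_def)
    have ck: "c = 1 / L powi k" by (simp add: c_def power_int_minus inverse_eq_divide)
    have nw: "cmod w = cmod z / L powi k"
      using c by (simp add: w_def norm_mult) (simp add: ck)
    have 1: "1 \<le> cmod w" using k(1) Lp[of k] by (simp add: nw)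
    have "L powi (k + 1) = L * L powi k" using L by (simp add: power_int_add mult.commute)
    then have 2: "cmod w \<le> L" using k(2) Lp[of k] by (simp add: nw divide_le_eq)
    have Imw: "Im w > 0" using z c by (simp add: w_def)
    have "p (chart w) = p (chart z)"
    proof (cases "k \<ge> 0")
      \<comment> \<open>\<open>projection_invariant\<close> only multiplies by powers with
        nonnegative exponent, so here it is applied to \<open>w\<close>, in the other case to
        \<open>z\<close>.\<close>
      case True
      then have lk: "L powi k = l ^ (2 * nat k)" by (simp add: L_def power_int_def power_mult)
      have "c * l ^ (2 * nat k) = 1" using l unfolding ck lk by simp
      then have "of_real (l ^ (2 * nat k)) * w = z"
        unfolding w_def by (metis mult.assoc mult.commute mult_1_left of_real_1 of_real_mult)
      then show ?thesis using projection_invariant[OF Imw, of "nat k"] by simp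
    next
      case False
      then have "c = l ^ (2 * nat (- k))" by (simp add: c_def L_def power_int_def power_mult)
      then show ?thesis using projection_invariant[OF z, of "nat (- k)"] by (simp add: w_def)
    qed
    then show ?thesis using that[OF w_def c _ 1 2] by blast
  qed
  have Re: "(Re w)\<^sup>2 = q * (cmod w)\<^sup>2"
    using q(1) by (simp add: w(1) norm_mult power_mult_distrib)
  moreover have "q * (cmod w)\<^sup>2 \<le> 1 / 4 * (cmod w)\<^sup>2" using q(2) by (intro mult_right_mono) auto
  moreover have "Im w > 0" using w(1,2) z by simp
  ultimately have "w \<in> fundamental_region"
    using w by (simp add: fundamental_region_def L_def)
  then show ?thesis using that w Re by blast
qed

lemma compact_fundamental_region: "compact fundamental_region"
proof -
  have "closed fundamental_region"
    unfolding fundamental_region_def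
    by (intro closed_Collect_conj closed_Collect_le continuous_intros)
  moreover have "fundamental_region \<subseteq> cball 0 (l\<^sup>2)"
    by (auto simp: fundamental_region_def)
  ultimately show ?thesis
    by (meson bounded_cball bounded_subset compact_eq_bounded_closed)
qed

text \<open>Finitely many open sets on which \<open>p\<close> is injective cover the compact image
  of the region; each accounts for at most one point of a fibre.\<close>

lemma fibres_in_fundamental_region:
  obtains N where "N > 0" "\<And>Z y. Z \<subseteq> fundamental_region \<Longrightarrow> finite Z \<Longrightarrow> card {z \<in> Z. p (chart z) = y} \<le> N"
proof -
  let ?K = "chart ` fundamental_region"
  have "fundamental_region \<subseteq> {z. Im z \<ge> 0}" by (auto simp: fundamental_region_def)
  then have c: "continuous_on fundamental_region cayley"
    by (rule continuous_on_subset[OF continuous_cayley])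
  have "continuous_on fundamental_region chart"
    by (rule continuous_on_compose2[OF isometry_continuous[OF m] c])
      (use cayley_cball(1) in \<open>force simp: fundamental_region_def\<close>)
  then have K: "compact ?K" by (rule compact_continuous_image[OF _ compact_fundamental_region])
  have Kb: "?K \<subseteq> ball 0 1" using chart_ball Im_fundamental_region by blast
  have cover: "?K \<subseteq> \<Union> {W. open W \<and> inj_on p W}"
  proof
    fix u assume "u \<in> ?K"
    then have "u \<in> ball 0 1" by (rule subsetD[OF Kb])
    then obtain W where "open W" "u \<in> W" "W \<subseteq> ball 0 1" "inj_on p W" by (rule p_locally_inj)
    then show "u \<in> \<Union> {W. open W \<and> inj_on p W}" by blast
  qed
  have opn: "\<And>W. W \<in> {W. open W \<and> inj_on p W} \<Longrightarrow> open W" by simp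
  obtain \<W> where W: "\<W> \<subseteq> {W. open W \<and> inj_on p W}" "finite \<W>" "?K \<subseteq> \<Union> \<W>"
    using compactE[OF K cover opn] .
  have "card {z \<in> Z. p (chart z) = y} \<le> card \<W>" if Z: "Z \<subseteq> fundamental_region" "finite Z" for Z y
  proof -
    let ?A = "{z \<in> Z. p (chart z) = y}"
    have "\<exists>W \<in> \<W>. chart z \<in> W" if "z \<in> ?A" for z using that Z W(3) by blast
    then obtain f where f: "\<And>z. z \<in> ?A \<Longrightarrow> f z \<in> \<W> \<and> chart z \<in> f z" by metis
    have "inj_on f ?A"
    proof (rule inj_onI)
      fix z w assume zw: "z \<in> ?A" "w \<in> ?A" "f z = f w"
      have "inj_on p (f z)" using f[OF zw(1)] W(1) by blast
      moreover have "chart z \<in> f z" "chart w \<in> f z" using f[OF zw(1)] f[OF zw(2)] zw(3) by simp_all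
      moreover have "p (chart z) = p (chart w)" using zw by simp
      ultimately have "chart z = chart w" by (metis inj_onD)
      moreover have "z \<in> fundamental_region" "w \<in> fundamental_region" using zw Z by auto
      ultimately show "z = w"
        using chart_eqD[of z w] by (simp add: fundamental_region_def)
    qed
    moreover have "f ` ?A \<subseteq> \<W>" using f by blast
    ultimately show ?thesis using W(2) by (rule card_inj_on_le)
  qed
  \<comment> \<open>The successor makes the bound positive, so that it can be cancelled when
    counting.\<close>
  then have "card {z \<in> Z. p (chart z) = y} \<le> Suc (card \<W>)" if "Z \<subseteq> fundamental_region" "finite Z" for Z y
    using that le_SucI by blast
  then show ?thesis using that[of "Suc (card \<W>)"] by blast
qed

text \<open>Here \<open>a\<close> is close to the end \<open>0\<close> of the axis and
  \<open>b\<close> to the end at infinity. A subset of \<open>k\<close> points is produced because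
  \<open>card\<close> of an infinite set is 0.\<close>

lemma many_self_intersections:
  obtains \<epsilon> where "0 < \<epsilon>" "\<epsilon> < 1" "\<And>a b. a \<noteq> 0 \<Longrightarrow> \<bar>a\<bar> < \<epsilon> \<Longrightarrow> 1 < \<epsilon> * \<bar>b\<bar> \<Longrightarrow>
    \<exists>F \<subseteq> self_intersections p {chart (of_real a), chart (of_real b)}. finite F \<and> card F = k"
proof -
  obtain N where N: "N > 0" "\<And>Z y. Z \<subseteq> fundamental_region \<Longrightarrow> finite Z \<Longrightarrow> card {z \<in> Z. p (chart z) = y} \<le> N"
    using fibres_in_fundamental_region by blast
  \<comment> \<open>At most \<open>N\<close> crossings share a point of the surface, so
    \<open>k * N\<close> distinct crossings leave at least \<open>k\<close> points.\<close>
  define M where "M = k * N"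
  \<comment> \<open>Bounds \<open>\<bar>1 + s\<bar>\<close> for all powers used. With
    \<open>\<epsilon> * R = 1 / 4\<close>, the ratio of every crossing is at most
    \<open>4 * (\<epsilon> * R)^2 = 1 / 4\<close>.\<close>
  define R where "R = 1 + l ^ (2 * M + 2)"
  have R: "R > 1" using l by (simp add: R_def)
  define \<epsilon> where "\<epsilon> = 1 / (4 * R)"
  have e: "0 < \<epsilon>" "\<epsilon> < 1" "\<epsilon> * R = 1 / 4" using R by (auto simp: \<epsilon>_def)
  have "\<exists>F \<subseteq> self_intersections p {chart (of_real a), chart (of_real b)}. finite F \<and> card F = k"
    if a0: "a \<noteq> 0" and a: "\<bar>a\<bar> < \<epsilon>" and b: "1 < \<epsilon> * \<bar>b\<bar>" for a b
  proof -
    let ?x = "{chart (of_real a), chart (of_real b)}"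
    have b0: "b \<noteq> 0" using b by auto
    have "1 < \<bar>b\<bar>" using b e by (smt (verit) mult_left_le_one_le)
    have ab: "\<bar>a\<bar> \<le> \<epsilon>\<^sup>2 * \<bar>b\<bar>"
    proof -
      have "\<epsilon> * 1 \<le> \<epsilon> * (\<epsilon> * \<bar>b\<bar>)" using b e by (intro mult_left_mono) auto
      then show ?thesis using a by (simp add: power2_eq_square mult.assoc)
    qed
    have "\<epsilon> \<le> 1 / 4" using R by (simp add: \<epsilon>_def)
    then have "\<bar>a\<bar> < \<bar>b\<bar> / 2" using a \<open>1 < \<bar>b\<bar>\<close> by linarith
    then have half: "\<bar>a + b\<bar> \<ge> \<bar>b\<bar> / 2" and aneb: "a \<noteq> b" by linarith+
    then have apb: "a + b \<noteq> 0" using b0 by auto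
    have "(\<bar>b\<bar> / 2)\<^sup>2 \<le> \<bar>a + b\<bar>\<^sup>2" using half by (intro power_mono) auto
    then have sq: "b\<^sup>2 / 4 \<le> (a + b)\<^sup>2" by (simp add: power_divide)
    have ratio: "\<bar>a * b\<bar> / (a + b)\<^sup>2 \<le> 4 * \<epsilon>\<^sup>2"
    proof -
      have "\<bar>a * b\<bar> \<le> \<epsilon>\<^sup>2 * \<bar>b\<bar> * \<bar>b\<bar>" unfolding abs_mult using ab by (intro mult_right_mono) auto
      also have "\<dots> = 4 * \<epsilon>\<^sup>2 * (b\<^sup>2 / 4)" by (simp add: power2_eq_square)
      also have "\<dots> \<le> 4 * \<epsilon>\<^sup>2 * (a + b)\<^sup>2" using sq by (intro mult_left_mono) auto
      finally show ?thesis using apb by (simp add: divide_le_eq)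
    qed
    \<comment> \<open>Parity of the power: the exponent \<open>Suc (2 * j + e0)\<close> is even iff
      \<open>a * b > 0\<close>, which gives \<open>s j\<close> the sign of \<open>a * b\<close>. Two
      half-circles related by the factor \<open>s\<close> can only meet where
      \<open>(cmod z)^2 = s * (a * b)\<close>.\<close>
    define e0 where "e0 = (if a * b > 0 then 1 else 0 :: nat)"
    define s where "s j = (- l) ^ Suc (2 * j + e0)" for j
    have abs_s: "\<bar>s j\<bar> = l ^ Suc (2 * j + e0)" for j using l by (simp add: s_def power_abs abs_mult)
    have s1: "\<bar>s j\<bar> > 1" for j unfolding abs_s using l by (intro one_less_power) auto
    have s_inj: "i = j" if "s i = s j" for i j
    proof -
      have "l ^ Suc (2 * i + e0) = l ^ Suc (2 * j + e0)" using that abs_s by metis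
      then show ?thesis using l power_inject_exp[of l] by simp
    qed
    have s_sgn: "s j * (a * b) > 0" for j
    proof (cases "a * b > 0")
      case True
      then have "s j > 0" using l by (simp add: s_def e0_def)
      then show ?thesis using True by simp
    next
      case False
      then have "a * b < 0" using a0 b0 by (simp add: not_less order_le_less)
      moreover have "s j < 0" using l False by (simp add: s_def e0_def)
      ultimately show ?thesis by (rule mult_neg_neg[rotated])
    qed
    define q where "q j = (1 + s j)\<^sup>2 / s j * (a * b / (a + b)\<^sup>2)" for j
    have q_small: "q j \<le> 1 / 4" if "j < M" for j
    proof -
      have "\<bar>s j\<bar> \<le> l ^ (2 * M + 2)" unfolding abs_s e0_def using l that by (intro power_increasing) auto
      then have "\<bar>1 + s j\<bar> \<le> R" unfolding R_def by linarith
      then have "\<bar>1 + s j\<bar>\<^sup>2 \<le> R\<^sup>2" by (intro power_mono) auto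
      then have "(1 + s j)\<^sup>2 / \<bar>s j\<bar> \<le> R\<^sup>2 / 1" using s1[of j] by (intro frac_le) auto
      then have "\<bar>(1 + s j)\<^sup>2 / s j\<bar> \<le> R\<^sup>2" by (simp add: abs_divide)
      moreover have "\<bar>a * b / (a + b)\<^sup>2\<bar> \<le> 4 * \<epsilon>\<^sup>2" using ratio by (simp add: abs_divide)
      ultimately have "\<bar>q j\<bar> \<le> R\<^sup>2 * (4 * \<epsilon>\<^sup>2)" unfolding q_def abs_mult[of "(1 + s j)\<^sup>2 / s j"]
        by (intro mult_mono) auto
      also have "\<dots> = 4 * (\<epsilon> * R)\<^sup>2" by (simp add: power_mult_distrib)
      also have "\<dots> = 1 / 4" unfolding e(3) by (simp add: power2_eq_square)
      finally show ?thesis by simp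
    qed
    have "\<exists>w. w \<in> fundamental_region \<and> p (chart w) \<in> self_intersections p ?x \<and> (Re w)\<^sup>2 = q j * (cmod w)\<^sup>2"
      if j: "j < M" for j
    proof -
      obtain z where z: "Im z > 0" "(cmod z)\<^sup>2 - (a + b) * Re z + a * b = 0"
        "(cmod z)\<^sup>2 - (s j * a + s j * b) * Re z + (s j * a) * (s j * b) = 0" "(Re z)\<^sup>2 = q j * (cmod z)\<^sup>2"
        using dilated_half_circle_intersection[OF s_sgn apb, of j] q_small[OF j] unfolding q_def by metis
      obtain g where g: "g \<in> deck_group p" "\<And>z. Im z \<ge> 0 \<Longrightarrow> g (chart z) = chart (dilation (s j) z)"
        unfolding s_def using deck_dilation[of "2 * j + e0"] by blast
      have gx: "g ` ?x = {chart (of_real (s j * a)), chart (of_real (s j * b))}"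
        using g(2)[of "of_real a"] g(2)[of "of_real b"] by (simp add: dilation_of_real)
      have "s j * a \<noteq> s j * b" using aneb s1[of j] by auto
      with aneb have line: "chart z \<in> hyp_line ?x" "chart z \<in> hyp_line (g ` ?x)"
        unfolding gx using hyp_line_chart[of a b z] hyp_line_chart[of "s j * a" "s j * b" z] z aneb by blast+
      have "g ` ?x \<noteq> ?x"
      proof
        assume "g ` ?x = ?x"
        then have "chart (of_real (s j * a)) \<in> ?x" "chart (of_real (s j * b)) \<in> ?x"
          unfolding gx by auto
        then have "s j * a = a \<or> s j * a = b" "s j * b = a \<or> s j * b = b"
          using chart_of_real_eqD by blast+
        \<comment> \<open>The end \<open>s j * b\<close> exceeds both \<open>a\<close> and
          \<open>b\<close> in modulus, so the image has an end that \<open>?x\<close> lacks.\<close>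
        moreover have "\<bar>s j * b\<bar> > \<bar>b\<bar>" using s1[of j] b0 by (simp add: abs_mult)
        ultimately show False using \<open>\<bar>a\<bar> < \<bar>b\<bar> / 2\<close> by auto
      qed
      then have "p (chart z) \<in> self_intersections p ?x"
        unfolding self_intersections_def using g(1) line by blast
      moreover obtain w where "w \<in> fundamental_region" "p (chart w) = p (chart z)" "(Re w)\<^sup>2 = q j * (cmod w)\<^sup>2"
        using move_to_fundamental_region[OF z(1,4) q_small[OF j]] .
      ultimately show ?thesis by auto
    qed
    then obtain w where w: "\<And>j. j < M \<Longrightarrow> w j \<in> fundamental_region"
      "\<And>j. j < M \<Longrightarrow> p (chart (w j)) \<in> self_intersections p ?x" "\<And>j. j < M \<Longrightarrow> (Re (w j))\<^sup>2 = q j * (cmod (w j))\<^sup>2"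
      by metis
    \<comment> \<open>The point \<open>w j\<close> determines \<open>q j\<close>, its squared cosine
      with the real axis, and \<open>q j\<close> determines \<open>s j\<close>.\<close>
    have "inj_on w {..<M}"
    proof (rule inj_onI)
      fix i j assume ij: "i \<in> {..<M}" "j \<in> {..<M}" "w i = w j"
      have "cmod (w j) \<noteq> 0" using Im_fundamental_region[OF w(1), of j] ij by auto
      then have "q i = q j" using w(3)[of i] w(3)[of j] ij by simp
      moreover have "a * b / (a + b)\<^sup>2 \<noteq> 0" using a0 b0 apb by simp
      ultimately have "(1 + s i)\<^sup>2 / s i = (1 + s j)\<^sup>2 / s j" unfolding q_def by (simp only: mult_cancel_right simp_thms)
      then show "i = j" using shifted_square_ratio_inj[OF s1 s1] s_inj by blast
    qed
    then have cardM: "card (w ` {..<M}) = M" by (simp add: card_image)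
    have "w ` {..<M} \<subseteq> fundamental_region" using w(1) by auto
    then have "M \<le> N * card ((\<lambda>z. p (chart z)) ` w ` {..<M})"
      using card_image_bounded_fibres[of "w ` {..<M}" "\<lambda>z. p (chart z)" N] N(2) cardM by simp
    then have "k \<le> card ((\<lambda>z. p (chart z)) ` w ` {..<M})"
      using N(1) by (simp add: M_def mult.commute)
    then obtain F where "F \<subseteq> (\<lambda>z. p (chart z)) ` w ` {..<M}" "card F = k" "finite F"
      using obtain_subset_with_card_n by metis
    moreover have "(\<lambda>z. p (chart z)) ` w ` {..<M} \<subseteq> self_intersections p ?x" using w(2) by auto
    ultimately show ?thesis by blast
  qed
  with e that show ?thesis by blast
qed

end

section \<open>Currents near a one-sided geodesic\<close>

definition geodesics_joining :: "complex set \<Rightarrow> complex set \<Rightarrow> geodesic set" where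
  "geodesics_joining A B = {{a, b} | a b. a \<in> A \<and> b \<in> B}"

lemma continuous_map_pair_geodesic:
  "continuous_map (top_of_set endpoint_pairs) geodesic_topology (\<lambda>(a, b). {a, b})"
  unfolding continuous_map_def
proof (intro conjI allI impI)
  show "(\<lambda>(a, b). {a, b}) \<in> topspace (top_of_set endpoint_pairs) \<rightarrow> topspace geodesic_topology"
    by (auto simp: endpoint_pairs_def intro!: geodesicsI)
  fix U assume U: "openin geodesic_topology U"
  have "{x \<in> topspace (top_of_set endpoint_pairs). (case x of (a, b) \<Rightarrow> {a, b}) \<in> U} = {(a, b) \<in> endpoint_pairs. {a, b} \<in> U}"
    by auto
  then show "openin (top_of_set endpoint_pairs) {x \<in> topspace (top_of_set endpoint_pairs). (case x of (a, b) \<Rightarrow> {a, b}) \<in> U}"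
    using U by (simp add: openin_geodesic_topology)
qed

lemma continuous_map_from_geodesics:
  assumes "continuous_on endpoint_pairs (\<lambda>(a, b). f {a, b} :: real)"
  shows "continuous_map geodesic_topology euclideanreal f"
  unfolding continuous_map_def
proof (intro conjI allI impI)
  fix U :: "real set" assume "openin euclideanreal U"
  then have "openin (top_of_set endpoint_pairs) (endpoint_pairs \<inter> (\<lambda>(a, b). f {a, b}) -` U)"
    using assms by (simp add: continuous_openin_preimage_gen)
  also have "endpoint_pairs \<inter> (\<lambda>(a, b). f {a, b}) -` U = {(a, b) \<in> endpoint_pairs. {a, b} \<in> {x \<in> geodesics. f x \<in> U}}"
    by (auto simp: endpoint_pairs_def intro!: geodesicsI)
  finally show "openin geodesic_topology {x \<in> topspace geodesic_topology. f x \<in> U}"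
    by (auto simp: openin_geodesic_topology)
qed auto

text \<open>Disjointness keeps the compact product off the diagonal. Closedness is read off from the
  preimage \<open>A \<times> B \<union> B \<times> A\<close> in the ordered pairs, which avoids a
  detour through the Hausdorff property of the quotient.\<close>

lemma geodesics_joining_compact:
  assumes A: "compact A" "A \<subseteq> sphere 0 1" and B: "compact B" "B \<subseteq> sphere 0 1" and AB: "A \<inter> B = {}"
  shows "compactin geodesic_topology (geodesics_joining A B)" "closedin geodesic_topology (geodesics_joining A B)"
proof -
  have sub: "A \<times> B \<subseteq> endpoint_pairs" using A B AB by (auto simp: endpoint_pairs_def)
  have "compactin (top_of_set endpoint_pairs) (A \<times> B)"
    using A B sub by (simp add: compactin_subtopology compact_Times)
  then have "compactin geodesic_topology ((\<lambda>(a, b). {a, b}) ` (A \<times> B))"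
    using continuous_map_pair_geodesic by (rule image_compactin)
  also have "(\<lambda>(a, b). {a, b}) ` (A \<times> B) = geodesics_joining A B"
    by (auto simp: geodesics_joining_def)
  finally show "compactin geodesic_topology (geodesics_joining A B)" .
  have J: "geodesics_joining A B \<subseteq> geodesics"
    using A B AB by (auto simp: geodesics_joining_def intro!: geodesicsI)
  have "closed (A \<times> B \<union> B \<times> A)"
    using A B by (intro closed_Un closed_Times compact_imp_closed)
  then have "openin (top_of_set endpoint_pairs) (endpoint_pairs \<inter> - (A \<times> B \<union> B \<times> A))"
    by (intro openin_open_Int open_Compl)
  also have "endpoint_pairs \<inter> - (A \<times> B \<union> B \<times> A) = {(a, b) \<in> endpoint_pairs. {a, b} \<in> geodesics - geodesics_joining A B}"
    by (auto simp: geodesics_joining_def doubleton_eq_iff endpoint_pairs_def intro!: geodesicsI)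
  finally have "openin geodesic_topology (geodesics - geodesics_joining A B)"
    by (simp add: openin_geodesic_topology)
  then show "closedin geodesic_topology (geodesics_joining A B)"
    using J by (simp add: closedin_def)
qed

lemma image_geodesics_joining: "(`) g ` geodesics_joining A B = geodesics_joining (g ` A) (g ` B)"
  unfolding geodesics_joining_def by (auto simp: image_iff) (metis image_empty image_insert)

section \<open>Null sets and integrals of currents\<close>

lemma current_measurable:
  assumes "c \<in> geodesic_currents p"
  shows "openin geodesic_topology U \<Longrightarrow> U \<in> sets c" "closedin geodesic_topology K \<Longrightarrow> K \<in> sets c"
    "space c = geodesics"
proof -
  have s: "sets c = sigma_sets geodesics {U. openin geodesic_topology U}"
    and sp: "space c = geodesics" using assms by (auto simp: geodesic_currents_def)
  then show "space c = geodesics" by simp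
  show o: "U \<in> sets c" if "openin geodesic_topology U" for U
    unfolding s using that by blast
  assume K: "closedin geodesic_topology K"
  then have "K = space c - (geodesics - K)" by (auto simp: closedin_def sp)
  moreover have "geodesics - K \<in> sets c" using K by (intro o) (simp add: closedin_def)
  ultimately show "K \<in> sets c" by (metis sets.compl_sets)
qed

text \<open>The complement of the support is a union of open null sets. Countably many suffice by
  the Lindelof property, applied to the preimages among ordered pairs, which form a subspace of a
  Euclidean space.\<close>

lemma null_outside_current_support:
  assumes c: "c \<in> geodesic_currents p"
  shows "geodesics - current_support c \<in> null_sets c"
proof -
  define \<U> where "\<U> = {U. openin geodesic_topology U \<and> emeasure c U = 0}"
  define pre where "pre U = {(a, b) \<in> endpoint_pairs. {a, b} \<in> U}" for U
  have "openin (top_of_set endpoint_pairs) V" if "V \<in> pre ` \<U>" for V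
    using that by (auto simp: \<U>_def pre_def openin_geodesic_topology)
  then obtain \<V> where V: "\<V> \<subseteq> pre ` \<U>" "countable \<V>" "\<Union> \<V> = \<Union> (pre ` \<U>)"
    using Lindelof_openin by metis
  obtain \<U>' where U': "\<U>' \<subseteq> \<U>" "countable \<U>'" "\<V> = pre ` \<U>'"
    using V(1,2) by (metis countable_subset_image)
  have "\<Union> \<U>' \<in> null_sets c"
  proof (rule null_sets_UN'[of \<U>' "\<lambda>x. x" c, simplified])
    show "countable \<U>'" using U' by blast
    show "U \<in> null_sets c" if "U \<in> \<U>'" for U
      using that U' current_measurable(1)[OF c] by (auto simp: \<U>_def null_sets_def)
  qed
  moreover have "geodesics - current_support c = \<Union> \<U>'"
  proof (intro equalityI subsetI)
    fix x assume x: "x \<in> geodesics - current_support c"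
    then obtain U where U: "U \<in> \<U>" "x \<in> U"
      unfolding current_support_def \<U>_def by (auto simp: zero_less_iff_neq_zero)
    obtain a b where ab: "x = {a, b}" "a \<in> sphere 0 1" "b \<in> sphere 0 1" "a \<noteq> b"
      using x geodesicsE[of x] by blast
    have "(a, b) \<in> pre U" using U ab by (auto simp: pre_def endpoint_pairs_def)
    then have "(a, b) \<in> \<Union> (pre ` \<U>')" using V(3) U' U by blast
    then show "x \<in> \<Union> \<U>'" using ab by (auto simp: pre_def)
  next
    fix x assume "x \<in> \<Union> \<U>'"
    then obtain U where U: "U \<in> \<U>" "x \<in> U" using U' by blast
    then have "x \<in> geodesics" by (auto simp: \<U>_def openin_geodesic_topology)
    moreover have "x \<notin> current_support c" using U by (auto simp: current_support_def \<U>_def)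
    ultimately show "x \<in> geodesics - current_support c" by blast
  qed
  ultimately show ?thesis by simp
qed

text \<open>\<open>K n\<close> and the larger set \<open>K 0\<close> have the same measure.
  Compactness makes it finite, so their difference is null.\<close>

lemma null_shrinking_compact:
  fixes K :: "nat \<Rightarrow> geodesic set"
  assumes c: "c \<in> geodesic_currents p"
    and K: "\<And>n. compactin geodesic_topology (K n)" "\<And>n. closedin geodesic_topology (K n)"
    and sub: "\<And>n. K n \<subseteq> K 0"
    and shift: "\<And>n. emeasure c (K (Suc n)) = emeasure c (K n)"
  shows "K 0 - (\<Inter>n. K n) \<in> null_sets c"
proof -
  have eq: "emeasure c (K n) = emeasure c (K 0)" for n
    by (induction n) (simp_all add: shift)
  have fin: "emeasure c (K n) < \<infinity>" for n
    using c K(1) by (simp add: geodesic_currents_def)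
  have "K 0 - K n \<in> null_sets c" for n
  proof -
    have "emeasure c (K 0 - K n) = emeasure c (K 0) - emeasure c (K n)"
      using fin[of n] current_measurable(2)[OF c K(2)] sub by (intro emeasure_Diff) auto
    then show ?thesis
      using eq[of n] fin[of 0] current_measurable(2)[OF c K(2)] by (auto simp: null_sets_def diff_eq_0_ennreal)
  qed
  then have "(\<Union>n. K 0 - K n) \<in> null_sets c" by (intro null_sets_UN) auto
  also have "(\<Union>n. K 0 - K n) = K 0 - (\<Inter>n. K n)" by auto
  finally show ?thesis .
qed

lemma borel_measurable_current:
  assumes "c \<in> geodesic_currents p" "continuous_map geodesic_topology euclideanreal f"
  shows "f \<in> borel_measurable c"
proof (rule borel_measurableI)
  fix S :: "real set" assume "open S"
  then have "openin geodesic_topology {x \<in> topspace geodesic_topology. f x \<in> S}"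
    using assms(2) by (simp add: continuous_map_def)
  moreover have "{x \<in> topspace geodesic_topology. f x \<in> S} = f -` S \<inter> space c"
    using current_measurable(3)[OF assms(1)] by auto
  ultimately show "f -` S \<inter> space c \<in> sets c" using current_measurable(1)[OF assms(1)] by metis
qed

text \<open>Otherwise \<open>f\<close> would vanish almost everywhere, although the open set where
  it does not vanish contains a point of the support. Integrability has to be checked, since a
  non-integrable function has integral 0 by convention.\<close>

lemma integral_positive_at_support:
  assumes c: "c \<in> geodesic_currents p" and f: "continuous_map geodesic_topology euclideanreal f"
    and nonneg: "\<And>y. f y \<ge> 0"
    and K: "compactin geodesic_topology K" "closedin geodesic_topology K" "\<And>y. y \<in> geodesics - K \<Longrightarrow> f y = 0"
    and x: "x \<in> current_support c" "f x > 0"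
  shows "integral\<^sup>L c f > 0"
proof -
  have "compact (f ` K)" using image_compactin[OF K(1) f] by simp
  then obtain B where B: "\<And>y. y \<in> K \<Longrightarrow> norm (f y) \<le> B"
    by (metis bounded_iff compact_imp_bounded imageI)
  note meas = borel_measurable_current[OF c f]
  have int: "integrable c f"
  proof (rule integrableI_bounded_set)
    show "K \<in> sets c" using current_measurable(2)[OF c K(2)] .
    show "emeasure c K < \<infinity>" using c K(1) by (simp add: geodesic_currents_def)
    show "AE y in c. y \<in> K \<longrightarrow> norm (f y) \<le> B" using B by simp
    show "AE y in c. y \<notin> K \<longrightarrow> f y = 0" using K(3) current_measurable(3)[OF c] by (auto intro!: AE_I2)
  qed (rule meas)
  have "integral\<^sup>L c f \<noteq> 0"
  proof
    assume "integral\<^sup>L c f = 0"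
    then have "AE y in c. f y = 0"
      using integral_nonneg_eq_0_iff_AE[OF int] nonneg by simp
    then have "emeasure c {y \<in> space c. f y \<noteq> 0} = 0"
      using meas by (subst (asm) AE_iff_measurable[OF _ refl]) auto
    moreover have "openin geodesic_topology {y \<in> topspace geodesic_topology. f y \<in> - {0}}"
      using f unfolding continuous_map_def by (metis open_openin open_Compl closed_singleton)
    moreover have "x \<in> {y \<in> topspace geodesic_topology. f y \<in> - {0}}"
      using x by (auto simp: current_support_def)
    ultimately show False
      using x(1) current_measurable(3)[OF c] by (auto simp: current_support_def)
  qed
  moreover have "integral\<^sup>L c f \<ge> 0" using nonneg by simp
  ultimately show ?thesis by simp
qed

section \<open>Arcs around the ends of the axis and the detecting function\<close>

context glide_reflection
begin

definition inner_arc :: "real \<Rightarrow> complex set" where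
  "inner_arc r = (\<lambda>t. chart (of_real t)) ` {t. \<bar>t\<bar> \<le> r}"

text \<open>The closed arc of radius \<open>r\<close> about infinity in the coordinate
  \<open>1 / t\<close>, multiplied out to avoid division.\<close>

definition outer_arc :: "real \<Rightarrow> complex set" where
  "outer_arc r = insert (m 1) ((\<lambda>t. chart (of_real t)) ` {t. 1 \<le> r * \<bar>t\<bar>})"

lemma chart_neq_m1: "Im z \<ge> 0 \<Longrightarrow> chart z \<noteq> m 1"
  using inj_onD[OF isometry_inj_on[OF m], of "cayley z" 1] cayley_cball(1)[of z] cayley_neq_1[of z] by auto

lemma m1_sphere: "m 1 \<in> sphere 0 1"
  using isometry_cball(3)[OF m, of 1] by simp

lemma arc_subset_sphere: "inner_arc r \<subseteq> sphere 0 1" "outer_arc r \<subseteq> sphere 0 1"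
  using chart_sphere[of "of_real _"] m1_sphere unfolding inner_arc_def outer_arc_def by auto

lemma compact_inner_arc: "compact (inner_arc r)"
proof -
  have "continuous_on {t. \<bar>t\<bar> \<le> r} (\<lambda>t. cayley (of_real t))"
    by (rule continuous_on_compose2[OF continuous_cayley]) (auto intro!: continuous_intros)
  then have "continuous_on {t. \<bar>t\<bar> \<le> r} (\<lambda>t. chart (of_real t))"
    by (rule continuous_on_compose2[OF isometry_continuous[OF m]]) (use cayley_cball(1)[of "of_real _"] in auto)
  moreover have "{t. \<bar>t\<bar> \<le> r} = {-r..r}" by auto
  ultimately show ?thesis
    unfolding inner_arc_def by (simp add: compact_continuous_image)
qed

lemma compact_outer_arc:
  assumes "r > 0"
  shows "compact (outer_arc r)"
proof -
  \<comment> \<open>\<open>cayley (1 / s)\<close> extended continuously to \<open>s = 0\<close>, so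
    that the arc through infinity is the image of a compact interval.\<close>
  define e where "e s = (1 - \<i> * of_real s) / (1 + \<i> * of_real s)" for s
  have nz: "1 + \<i> * of_real s \<noteq> 0" for s by (auto simp: complex_eq_iff)
  have e: "e s = cayley (of_real (1 / s))" if "s \<noteq> 0" for s
  proof -
    have "cayley (of_real (1 / s)) = (of_real s * (of_real (1 / s) - \<i>)) / (of_real s * (of_real (1 / s) + \<i>))"
      using that by (simp add: cayley_def)
    also have "\<dots> = e s" using that by (simp add: e_def algebra_simps)
    finally show ?thesis by simp
  qed
  have e0: "e 0 = 1" by (simp add: e_def)
  have "e s \<in> cball 0 1" for s
    using e[of s] cayley_cball(1)[of "of_real (1 / s)"] e0 by (cases "s = 0") auto
  moreover have "continuous_on {-r..r} e"
    unfolding e_def using nz by (intro continuous_intros) auto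
  ultimately have "continuous_on {-r..r} (\<lambda>s. m (e s))"
    by (intro continuous_on_compose2[OF isometry_continuous[OF m]]) auto
  then have "compact ((\<lambda>s. m (e s)) ` {-r..r})" by (intro compact_continuous_image) auto
  also have "(\<lambda>s. m (e s)) ` {-r..r} = outer_arc r"
  proof (intro equalityI subsetI)
    fix y assume "y \<in> (\<lambda>s. m (e s)) ` {-r..r}"
    then obtain s where s: "y = m (e s)" "\<bar>s\<bar> \<le> r" by auto
    show "y \<in> outer_arc r"
    proof (cases "s = 0")
      case False
      then have "1 \<le> r * \<bar>1 / s\<bar>" using s by (simp add: abs_divide)
      moreover have "y = chart (of_real (1 / s))" using s(1) e[OF False] by simp
      ultimately show ?thesis unfolding outer_arc_def by blast
    qed (use s e0 in \<open>simp add: outer_arc_def\<close>)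
  next
    fix y assume y: "y \<in> outer_arc r"
    consider "y = m 1" | t where "y = chart (of_real t)" "1 \<le> r * \<bar>t\<bar>"
      using y unfolding outer_arc_def by blast
    then show "y \<in> (\<lambda>s. m (e s)) ` {-r..r}"
    proof cases
      case 1
      then show ?thesis using e0 assms by (intro image_eqI[of _ _ 0]) auto
    next
      case 2
      then have "t \<noteq> 0" by auto
      then have "\<bar>1 / t\<bar> \<le> r" using 2 by (simp add: abs_divide divide_le_eq)
      then have "1 / t \<in> {-r..r}" by (simp only: atLeastAtMost_iff) linarith
      then show ?thesis using 2 \<open>t \<noteq> 0\<close> by (intro image_eqI[of _ _ "1 / t"]) (auto simp: e)
    qed
  qed
  finally show ?thesis .
qed

lemma inner_outer_disjoint:
  assumes "r * s < 1" "s > 0"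
  shows "inner_arc r \<inter> outer_arc s = {}"
proof -
  have False if y: "y \<in> inner_arc r" "y \<in> outer_arc s" for y
  proof -
    obtain t where t: "y = chart (of_real t)" "\<bar>t\<bar> \<le> r" using y(1) by (auto simp: inner_arc_def)
    then have "y \<noteq> m 1" using chart_neq_m1[of "of_real t"] by simp
    then obtain u where u: "y = chart (of_real u)" "1 \<le> s * \<bar>u\<bar>" using y(2) by (auto simp: outer_arc_def)
    have "u = t" using chart_of_real_eqD t u by metis
    then have "1 \<le> s * r" using u t assms by (smt (verit) mult_left_mono)
    then show False using assms by (simp add: mult.commute)
  qed
  then show ?thesis by blast
qed

lemma h_chart_of_real: "h (chart (of_real t)) = chart (of_real (- l * t))"
  using h_cayley[of "of_real t"] by (simp only: dilation_of_real) simp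

lemma h_inner_arc: "h ` inner_arc r = inner_arc (l * r)"
proof (intro equalityI subsetI)
  fix y assume "y \<in> h ` inner_arc r"
  then obtain t where "y = chart (of_real (- l * t))" "\<bar>t\<bar> \<le> r"
    by (auto simp: inner_arc_def h_chart_of_real simp del: of_real_mult)
  moreover from this have "\<bar>- l * t\<bar> \<le> l * r" using l by (simp add: abs_mult)
  ultimately show "y \<in> inner_arc (l * r)" unfolding inner_arc_def by blast
next
  fix y assume "y \<in> inner_arc (l * r)"
  then obtain t where t: "y = chart (of_real t)" "\<bar>t\<bar> \<le> l * r" by (auto simp: inner_arc_def)
  have "\<bar>- (t / l)\<bar> \<le> r" using t l by (simp add: abs_divide divide_le_eq mult.commute)
  moreover have "y = h (chart (of_real (- (t / l))))" unfolding h_chart_of_real t using l by simp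
  ultimately show "y \<in> h ` inner_arc r" unfolding inner_arc_def by blast
qed

lemma h_outer_arc: "h ` outer_arc r = outer_arc (r / l)"
proof (intro equalityI subsetI)
  fix y assume "y \<in> h ` outer_arc r"
  then consider "y = m 1" | t where "y = chart (of_real (- l * t))" "1 \<le> r * \<bar>t\<bar>"
    by (auto simp: outer_arc_def h_chart_of_real h_fixes simp del: of_real_mult)
  then show "y \<in> outer_arc (r / l)"
  proof cases
    case 2
    then have "1 \<le> r / l * \<bar>- l * t\<bar>" using l by (simp add: abs_mult)
    then show ?thesis unfolding outer_arc_def using 2 by blast
  qed (simp add: outer_arc_def)
next
  fix y assume "y \<in> outer_arc (r / l)"
  then consider "y = m 1" | t where "y = chart (of_real t)" "1 \<le> r / l * \<bar>t\<bar>"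
    by (auto simp: outer_arc_def)
  then show "y \<in> h ` outer_arc r"
  proof cases
    case 1
    then show ?thesis by (metis h_fixes image_eqI insertI1 outer_arc_def)
  next
    case 2
    have "1 \<le> r * \<bar>- (t / l)\<bar>" using 2 l by (simp add: abs_divide)
    moreover have "y = h (chart (of_real (- (t / l))))" unfolding h_chart_of_real 2 using l by simp
    ultimately show ?thesis unfolding outer_arc_def by blast
  qed
qed

text \<open>The geodesics asymptotic to, but different from, the axis are negligible: a current is finite on
  compact sets and the glide reflection moves such geodesics towards the axis or away from it.\<close>

lemma null_asymptotic:
  assumes c: "c \<in> geodesic_currents p"
  obtains N where "N \<in> null_sets c"
    "\<And>b. 1 \<le> \<bar>b\<bar> \<Longrightarrow> {chart 0, chart (of_real b)} \<in> N"
    "\<And>a. a \<noteq> 0 \<Longrightarrow> \<bar>a\<bar> \<le> 1 \<Longrightarrow> {chart (of_real a), m 1} \<in> N"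
proof -
  define r where "r n = 1 / l ^ n" for n
  have r: "r n > 0" "r n \<le> 1" "r (Suc n) = r n / l" "l * r (Suc n) = r n" "r 0 = 1" for n
    using l by (auto simp: r_def)
  have r_lim: "\<exists>n. r n < e" if "e > 0" for e
    using real_arch_pow_inv[of e "1 / l"] that l by (simp add: r_def power_one_over)
  have inv: "emeasure c ((`) h ` A) = emeasure c A" if "closedin geodesic_topology A" for A
    using c h current_measurable(2)[OF c that] by (auto simp: geodesic_currents_def)
  \<comment> \<open>The glide reflection repels from the end \<open>0\<close> and attracts to
    infinity: it maps \<open>K n\<close> onto \<open>K (Suc n)\<close>, but
    \<open>K' (Suc n)\<close> onto \<open>K' n\<close>. In both families all measures are equal
    while the sets shrink to the axis.\<close>
  define K where "K n = geodesics_joining {chart 0} (outer_arc (r n))" for n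
  define K' where "K' n = geodesics_joining {m 1} (inner_arc (r n))" for n
  have c0: "{chart 0} = inner_arc 0"
    by (auto simp: inner_arc_def)
  have K: "compactin geodesic_topology (K n)" "closedin geodesic_topology (K n)" for n
    unfolding K_def c0 using inner_outer_disjoint[of 0 "r n"] r(1)[of n]
    by (auto intro!: geodesics_joining_compact compact_inner_arc compact_outer_arc arc_subset_sphere)
  have m1: "m 1 \<notin> inner_arc s" for s
    using chart_neq_m1[of "of_real _"] unfolding inner_arc_def by (metis (no_types, lifting) Im_complex_of_real image_iff order_refl)
  have K': "compactin geodesic_topology (K' n)" "closedin geodesic_topology (K' n)" for n
    unfolding K'_def using m1 m1_sphere
    by (auto intro!: geodesics_joining_compact compact_inner_arc arc_subset_sphere)
  have "h (chart 0) = chart 0" using h_chart_of_real[of 0] by simp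
  then have "(`) h ` K n = K (Suc n)" for n
    unfolding K_def image_geodesics_joining by (simp add: h_outer_arc r(3))
  then have shift: "emeasure c (K (Suc n)) = emeasure c (K n)" for n
    using inv[OF K(2)[of n]] by simp
  have "(`) h ` K' (Suc n) = K' n" for n
    unfolding K'_def image_geodesics_joining by (simp add: h_inner_arc r(4) h_fixes)
  then have shift': "emeasure c (K' (Suc n)) = emeasure c (K' n)" for n
    using inv[OF K'(2)[of "Suc n"]] by simp
  have "outer_arc (r n) \<subseteq> outer_arc (r 0)" for n
  proof -
    have "1 \<le> r 0 * \<bar>t\<bar>" if "1 \<le> r n * \<bar>t\<bar>" for t
      using that r(2)[of n] mult_right_mono[of "r n" 1 "\<bar>t\<bar>"] by (simp add: r(5))
    then show ?thesis unfolding outer_arc_def by blast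
  qed
  then have sub: "K n \<subseteq> K 0" for n unfolding K_def geodesics_joining_def by blast
  have "inner_arc (r n) \<subseteq> inner_arc (r 0)" for n
    unfolding inner_arc_def using r(2)[of n] by (auto simp: r(5))
  then have sub': "K' n \<subseteq> K' 0" for n unfolding K'_def geodesics_joining_def by blast
  define N where "N = (K 0 - (\<Inter>n. K n)) \<union> (K' 0 - (\<Inter>n. K' n))"
  have "N \<in> null_sets c"
    unfolding N_def using null_shrinking_compact[OF c K sub shift] null_shrinking_compact[OF c K' sub' shift'] by blast
  moreover have "{chart 0, chart (of_real b)} \<in> N" if b: "1 \<le> \<bar>b\<bar>" for b
  proof -
    have "{chart 0, chart (of_real b)} \<in> K 0"
      unfolding K_def geodesics_joining_def outer_arc_def using b by (auto simp: r(5))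
    moreover obtain n where n: "r n < 1 / \<bar>b\<bar>" using r_lim[of "1 / \<bar>b\<bar>"] b by force
    have "{chart 0, chart (of_real b)} \<notin> K n"
    proof
      assume "{chart 0, chart (of_real b)} \<in> K n"
      then have "{chart 0, chart (of_real b)} \<in> geodesics_joining {chart 0} (outer_arc (r n))" by (simp add: K_def)
      then obtain y where y: "y \<in> outer_arc (r n)" "{chart 0, chart (of_real b)} = {chart 0, y}"
        unfolding geodesics_joining_def by blast
      have "chart 0 \<noteq> chart (of_real b)" using chart_of_real_eqD[of 0 b] b by auto
      then have "y = chart (of_real b)" using y(2) by (auto simp: doubleton_eq_iff)
      then obtain t where "chart (of_real b) = chart (of_real t)" "1 \<le> r n * \<bar>t\<bar>"
        using y(1) chart_neq_m1[of "of_real b"] by (auto simp: outer_arc_def)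
      then have "1 \<le> r n * \<bar>b\<bar>" using chart_of_real_eqD by metis
      then show False using n b by (simp add: less_divide_eq split: if_splits)
    qed
    ultimately show ?thesis unfolding N_def by blast
  qed
  moreover have "{chart (of_real a), m 1} \<in> N" if a: "a \<noteq> 0" "\<bar>a\<bar> \<le> 1" for a
  proof -
    have "{chart (of_real a), m 1} \<in> K' 0"
      unfolding K'_def geodesics_joining_def inner_arc_def using a by (auto simp: r(5))
    moreover obtain n where n: "r n < \<bar>a\<bar>" using r_lim[of "\<bar>a\<bar>"] a by auto
    have "{chart (of_real a), m 1} \<notin> K' n"
    proof
      assume "{chart (of_real a), m 1} \<in> K' n"
      then obtain y where y: "y \<in> inner_arc (r n)" "{chart (of_real a), m 1} = {m 1, y}"
        unfolding geodesics_joining_def K'_def by blast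
      have "y = chart (of_real a)" using y(2) chart_neq_m1[of "of_real a"] by (auto simp: doubleton_eq_iff)
      then obtain t where "chart (of_real a) = chart (of_real t)" "\<bar>t\<bar> \<le> r n"
        using y(1) by (auto simp: inner_arc_def)
      then have "\<bar>a\<bar> \<le> r n" using chart_of_real_eqD by metis
      then show False using n by simp
    qed
    ultimately show ?thesis unfolding N_def by blast
  qed
  ultimately show ?thesis using that by blast
qed

text \<open>Positivity of the integral of \<open>f\<close> defines the neighbourhood. It forces
  \<open>f > 0\<close> at some geodesic of the support outside the null set of asymptotic ones;
  there either both ends are those of the axis, or both are real with the first nonzero.\<close>

lemma detecting_test_function:
  obtains f K where "continuous_map geodesic_topology euclideanreal f" "\<And>y. f y \<ge> 0"
    "compactin geodesic_topology K" "closedin geodesic_topology K" "\<And>y. y \<in> geodesics - K \<Longrightarrow> f y = 0"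
    "f {m (- 1), m 1} > 0"
    "\<And>c. c \<in> geodesic_currents p \<Longrightarrow> integral\<^sup>L c f > 0 \<Longrightarrow>
      \<exists>\<delta> \<in> current_support c. \<delta> = {m (- 1), m 1} \<or> (\<exists>F \<subseteq> self_intersections p \<delta>. finite F \<and> card F = k)"
proof -
  obtain \<epsilon> where e: "0 < \<epsilon>" "\<epsilon> < 1" and many: "\<And>a b. a \<noteq> 0 \<Longrightarrow> \<bar>a\<bar> < \<epsilon> \<Longrightarrow> 1 < \<epsilon> * \<bar>b\<bar> \<Longrightarrow>
    \<exists>F \<subseteq> self_intersections p {chart (of_real a), chart (of_real b)}. finite F \<and> card F = k"
    using many_self_intersections[of k] by metis
  obtain m' where m': "m' \<in> isometries False" "\<And>z. z \<in> cball 0 1 \<Longrightarrow> m' (m z) = z" "\<And>z. z \<in> cball 0 1 \<Longrightarrow> m (m' z) = z"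
    using isometry_inverse[OF m] by metis
  \<comment> \<open>By \<open>cayley_ratio\<close>, \<open>u\<close> is positive exactly at the ends
    with \<open>\<bar>t\<bar> < \<epsilon>\<close>, and \<open>v\<close> exactly at
    \<open>m 1\<close> and the ends with \<open>\<epsilon> * \<bar>t\<bar> > 1\<close>.\<close>
  define u where "u y = max 0 (\<epsilon> * cmod (1 - m' y) - cmod (1 + m' y))" for y
  define v where "v y = max 0 (\<epsilon> * cmod (1 + m' y) - cmod (1 - m' y))" for y
  \<comment> \<open>Sums over both ends make the product symmetric, as a function of unordered pairs
    must be.\<close>
  define f where "f x = (\<Sum>y\<in>x. u y) * (\<Sum>y\<in>x. v y)" for x
  define K where "K = geodesics_joining (inner_arc \<epsilon>) (outer_arc \<epsilon>)"
  have u0: "u y \<ge> 0" and v0: "v y \<ge> 0" for y by (simp_all add: u_def v_def)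
  have cases: "y = m 1 \<or> (\<exists>t. y = chart (of_real t))" if y: "y \<in> sphere 0 1" for y
  proof (cases "m' y = 1")
    case True
    then show ?thesis using m'(3)[of y] y by auto
  next
    case False
    have "m' y \<in> sphere 0 1" using isometry_cball(3)[OF m'(1), of y] y by auto
    then obtain t where "m' y = cayley (of_real t)" using sphere_cayley False by metis
    then show ?thesis using m'(3)[of y] y by auto
  qed
  have pos: "u y * v z > 0 \<Longrightarrow> (\<exists>a. y = chart (of_real a) \<and> \<bar>a\<bar> < \<epsilon>) \<and> (z = m 1 \<or> (\<exists>b. z = chart (of_real b) \<and> 1 < \<epsilon> * \<bar>b\<bar>))"
    if yz: "y \<in> sphere 0 1" "z \<in> sphere 0 1" for y z
  proof
    assume "u y * v z > 0"
    then have uy: "u y > 0" and vz: "v z > 0" using u0[of y] v0[of z] by (auto simp: zero_less_mult_iff)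
    have u1: "u (m 1) = 0" using m'(2)[of 1] by (simp add: u_def)
    have mc: "m' (chart (of_real t)) = cayley (of_real t)" "cmod (1 + cayley (of_real t)) = \<bar>t\<bar> * cmod (1 - cayley (of_real t))" for t
      using m'(2)[OF cayley_cball(1)] cayley_ratio[of "of_real t"] by auto
    have c1: "cmod (1 - cayley (of_real t)) > 0" for t using cayley_neq_1[of "of_real t"] by auto
    obtain a where a: "y = chart (of_real a)" using cases[OF yz(1)] uy u1 by auto
    have "0 < (\<epsilon> - \<bar>a\<bar>) * cmod (1 - cayley (of_real a))"
      using uy unfolding a u_def mc by (simp add: left_diff_distrib max_def split: if_splits)
    then show "\<exists>a. y = chart (of_real a) \<and> \<bar>a\<bar> < \<epsilon>" using a c1[of a] by (auto simp: zero_less_mult_iff)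
    show "z = m 1 \<or> (\<exists>b. z = chart (of_real b) \<and> 1 < \<epsilon> * \<bar>b\<bar>)"
    proof (cases "z = m 1")
      case False
      then obtain b where b: "z = chart (of_real b)" using cases[OF yz(2)] by auto
      have "0 < (\<epsilon> * \<bar>b\<bar> - 1) * cmod (1 - cayley (of_real b))"
        using vz unfolding b v_def mc by (simp add: left_diff_distrib max_def split: if_splits)
      then have "1 < \<epsilon> * \<bar>b\<bar>" using c1[of b] by (auto simp: zero_less_mult_iff)
      then show ?thesis using b by blast
    qed simp
  qed
  have fpos: "\<exists>a z. x = {chart (of_real a), z} \<and> \<bar>a\<bar> < \<epsilon> \<and> (z = m 1 \<or> (\<exists>b. z = chart (of_real b) \<and> 1 < \<epsilon> * \<bar>b\<bar>))"
    if x: "x \<in> geodesics" and fx: "f x > 0" for x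
  proof -
    have "(\<Sum>y\<in>x. u y) \<noteq> 0" "(\<Sum>y\<in>x. v y) \<noteq> 0" using fx by (auto simp: f_def)
    then obtain y z where yz: "y \<in> x" "u y \<noteq> 0" "z \<in> x" "v z \<noteq> 0" by (meson sum.neutral)
    then have "u y * v z > 0" using u0[of y] v0[of z] by (simp add: zero_less_mult_iff)
    then obtain a where a: "y = chart (of_real a)" "\<bar>a\<bar> < \<epsilon>"
      and z: "z = m 1 \<or> (\<exists>b. z = chart (of_real b) \<and> 1 < \<epsilon> * \<bar>b\<bar>)"
      using pos[of y z] geodesic_subset_sphere[OF x] yz by blast
    \<comment> \<open>The product of the sums also contains the terms \<open>u y * v y\<close>; they
      vanish, since no end is near both \<open>0\<close> and infinity.\<close>
    have "y \<noteq> z"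
    proof
      assume "y = z"
      then have "chart (of_real a) \<noteq> m 1" using chart_neq_m1[of "of_real a"] by simp
      then obtain b where "chart (of_real a) = chart (of_real b)" "1 < \<epsilon> * \<bar>b\<bar>" using z a \<open>y = z\<close> by auto
      then have "1 < \<epsilon> * \<bar>a\<bar>" using chart_of_real_eqD by metis
      moreover have "\<epsilon> * \<bar>a\<bar> \<le> 1 * 1" using a e by (intro mult_mono) auto
      ultimately show False by simp
    qed
    then have "x = {y, z}" using x yz by (auto simp: geodesics_def)
    then show ?thesis using a z by blast
  qed
  have f0: "f y \<ge> 0" for y
    unfolding f_def using u0 v0 by (intro mult_nonneg_nonneg sum_nonneg) auto
  have m'c: "continuous_on (sphere 0 1) m'"
    by (rule continuous_on_subset[OF isometry_continuous[OF m'(1)]]) auto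
  have uc: "continuous_on (sphere 0 1) u" and vc: "continuous_on (sphere 0 1) v"
    unfolding u_def v_def by (intro continuous_intros m'c)+
  have "continuous_on endpoint_pairs (\<lambda>x. (u (fst x) + u (snd x)) * (v (fst x) + v (snd x)))"
    by (intro continuous_intros continuous_on_compose2[OF uc] continuous_on_compose2[OF vc]) (auto simp: endpoint_pairs_def)
  moreover have "(u (fst x) + u (snd x)) * (v (fst x) + v (snd x)) = (case x of (a, b) \<Rightarrow> f {a, b})" if "x \<in> endpoint_pairs" for x
    using that by (auto simp: endpoint_pairs_def f_def)
  ultimately have "continuous_on endpoint_pairs (\<lambda>(a, b). f {a, b})"
    using continuous_on_cong by (metis (no_types, lifting))
  then have fc: "continuous_map geodesic_topology euclideanreal f"
    by (rule continuous_map_from_geodesics)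
  have "\<epsilon> * \<epsilon> < 1 * 1" using e by (intro mult_strict_mono) auto
  then have Kc: "compactin geodesic_topology K" "closedin geodesic_topology K"
    unfolding K_def using e inner_outer_disjoint[of \<epsilon> \<epsilon>]
    by (auto intro!: geodesics_joining_compact compact_inner_arc compact_outer_arc arc_subset_sphere)
  have fK: "f y = 0" if y: "y \<in> geodesics - K" for y
  proof (rule ccontr)
    assume "f y \<noteq> 0"
    then have "f y > 0" using f0[of y] by simp
    then obtain a z where az: "y = {chart (of_real a), z}" "\<bar>a\<bar> < \<epsilon>" "z = m 1 \<or> (\<exists>b. z = chart (of_real b) \<and> 1 < \<epsilon> * \<bar>b\<bar>)"
      using fpos[of y] y by blast
    have "chart (of_real a) \<in> inner_arc \<epsilon>" using az(2) unfolding inner_arc_def by auto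
    moreover have "z \<in> outer_arc \<epsilon>" using az(3) unfolding outer_arc_def by auto
    ultimately have "y \<in> K" using az(1) unfolding K_def geodesics_joining_def by blast
    then show False using y by simp
  qed
  have c0: "chart 0 = m (- 1)" by (simp add: cayley_0)
  have mm: "m (- 1) \<noteq> m 1" using chart_neq_m1[of 0] c0 by simp
  have "m' (m (- 1)) = - 1" "m' (m 1) = 1" using m'(2) by auto
  then have "u (m (- 1)) = 2 * \<epsilon>" "v (m 1) = 2 * \<epsilon>" using e by (simp_all add: u_def v_def)
  then have fx: "f {m (- 1), m 1} > 0"
    unfolding f_def using mm e u0[of "m 1"] v0[of "m (- 1)"] by (simp add: add_pos_nonneg add_nonneg_pos)
  have detect: "\<exists>\<delta> \<in> current_support c. \<delta> = {m (- 1), m 1} \<or> (\<exists>F \<subseteq> self_intersections p \<delta>. finite F \<and> card F = k)"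
    if c: "c \<in> geodesic_currents p" and int: "integral\<^sup>L c f > 0" for c
  proof (rule ccontr)
    assume no: "\<not> ?thesis"
    obtain N where N: "N \<in> null_sets c" "\<And>b. 1 \<le> \<bar>b\<bar> \<Longrightarrow> {chart 0, chart (of_real b)} \<in> N"
      "\<And>a. a \<noteq> 0 \<Longrightarrow> \<bar>a\<bar> \<le> 1 \<Longrightarrow> {chart (of_real a), m 1} \<in> N"
      using null_asymptotic[OF c] by blast
    have null: "N \<union> (geodesics - current_support c) \<in> null_sets c"
      using N(1) null_outside_current_support[OF c] by blast
    have "f x = 0" if x: "x \<in> geodesics" "x \<notin> N \<union> (geodesics - current_support c)" for x
    proof (rule ccontr)
      assume "f x \<noteq> 0"
      then have "f x > 0" using f0[of x] by simp
      then obtain a z where az: "x = {chart (of_real a), z}" "\<bar>a\<bar> < \<epsilon>" "z = m 1 \<or> (\<exists>b. z = chart (of_real b) \<and> 1 < \<epsilon> * \<bar>b\<bar>)"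
        using fpos[of x] x(1) by blast
      have supp: "x \<in> current_support c" "x \<notin> N" using x by auto
      show False
      proof (cases "z = m 1")
        case True
        show False
        proof (cases "a = 0")
          case True
          then have "x = {m (- 1), m 1}" using az(1) \<open>z = m 1\<close> c0 by simp
          then show False using no supp by blast
        next
          case False
          then show False using N(3)[of a] az \<open>z = m 1\<close> e supp by auto
        qed
      next
        case False
        then obtain b where b: "z = chart (of_real b)" "1 < \<epsilon> * \<bar>b\<bar>" using az(3) by blast
        show False
        proof (cases "a = 0")
          case True
          have "\<epsilon> * \<bar>b\<bar> \<le> 1 * \<bar>b\<bar>" using e by (intro mult_right_mono) auto
          then show False using N(2)[of b] az(1) b True supp by auto
        next
          case False
          then show False using many[OF False az(2) b(2)] no supp az(1) b(1) by blast
        qed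
      qed
    qed
    then have "AE x in c. f x = 0"
      using current_measurable(3)[OF c] by (intro AE_I'[OF null]) auto
    then have "integral\<^sup>L c f = 0" by (rule integral_eq_zero_AE)
    then show False using int by simp
  qed
  show ?thesis using that[OF fc f0 Kc fK fx detect] .
qed

end

theorem proposition12p3:
  fixes S :: "'s::metric_space set" and p :: "complex \<Rightarrow> 's"
    and lam :: "geodesic measure" and \<gamma> :: "'s set" and k :: nat
  assumes "closed_hyperbolic_surface S p"
    and "nonorientable_surface p"
    and "lam \<in> one_sided_laminations p"
    and "\<gamma> \<in> leaves p lam"
    and "one_sided_closed_geodesic p \<gamma>"
    and "k \<ge> 1"
  shows "\<exists>U. openin (current_topology p) U \<and> lam \<in> U \<and>
           (\<forall>c \<in> U. \<exists>\<delta> \<in> current_support c.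
              projection p \<delta> = \<gamma> \<or>
              (\<exists>F \<subseteq> self_intersections p \<delta>. finite F \<and> card F = k))"
proof -
  interpret hyperbolic_surface S p
    using assms(1) by unfold_locales
  have lam: "lam \<in> geodesic_currents p"
    using assms(3) by (simp add: one_sided_laminations_def measured_laminations_def)
  obtain x where x: "x \<in> current_support lam" "\<gamma> = projection p x"
    using assms(4) by (auto simp: leaves_def)
  then have xg: "x \<in> geodesics" by (simp add: current_support_def)
  \<comment> \<open>The lift \<open>x\<close> lies in the support, while \<open>x'\<close> carries
    the glide reflection; only their projections are known to coincide.\<close>
  obtain x' g' where x': "x' \<in> geodesics" "\<gamma> = projection p x'"
    and g': "g' \<in> deck_group p" "g' \<in> isometries True" "g' ` x' = x'"
    using assms(5) by (auto simp: one_sided_closed_geodesic_def isometries_def)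
  obtain q where q: "q \<in> deck_group p" "q ` x' = x"
    using geodesic_projection_eqD[OF xg x'(1)] x x' by metis
  obtain r where r: "q \<in> isometries r" "\<And>z. z \<in> ball 0 1 \<Longrightarrow> p (q z) = p z" using deck_groupE[OF q(1)] by blast
  obtain qi where qi: "qi \<in> isometries r" "\<And>z. z \<in> cball 0 1 \<Longrightarrow> qi (q z) = z" "\<And>z. z \<in> cball 0 1 \<Longrightarrow> q (qi z) = z"
    using isometry_inverse[OF r(1)] by metis
  obtain g1 where g1: "g1 \<in> isometries (r \<noteq> True)" "\<And>z. z \<in> cball 0 1 \<Longrightarrow> g1 z = q (g' z)"
    using isometry_compose[OF r(1) g'(2)] by metis
  \<comment> \<open>The conjugate of \<open>g'\<close> by \<open>q\<close>: the orientation flag of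
    \<open>q\<close> enters twice and cancels, so \<open>g\<close> still reverses
    orientation.\<close>
  obtain g where g: "g \<in> isometries True" "\<And>z. z \<in> cball 0 1 \<Longrightarrow> g z = g1 (qi z)"
    using isometry_compose[OF g1(1) qi(1)] by auto
  have geq: "g z = q (g' (qi z))" if "z \<in> cball 0 1" for z
    using g(2)[OF that] g1(2)[OF isometry_cball(1)[OF qi(1) that]] by simp
  have "p (g z) = p z" if z: "z \<in> ball 0 1" for z
  proof -
    have zc: "z \<in> cball 0 1" using z by simp
    have 1: "qi z \<in> ball 0 1" using isometry_cball(2)[OF qi(1) zc] z by blast
    have 2: "g' (qi z) \<in> ball 0 1" using isometry_cball(2)[OF g'(2), of "qi z"] 1 by auto
    have "p (g z) = p (g' (qi z))" using geq[OF zc] r(2)[OF 2] by simp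
    also have "\<dots> = p (qi z)" using g'(1) 1 by (simp add: deck_group_def)
    also have "\<dots> = p (q (qi z))" using r(2)[OF 1] by simp
    finally show ?thesis using qi(3)[OF zc] by simp
  qed
  then have gd: "g \<in> deck_group p" by (rule deck_groupI[OF g(1)])
  have sub: "x \<subseteq> cball 0 1" "x' \<subseteq> cball 0 1"
    using geodesic_subset_sphere[OF xg] geodesic_subset_sphere[OF x'(1)] by auto
  have "(\<lambda>z. qi (q z)) ` x' = (\<lambda>z. z) ` x'"
    by (rule image_cong[OF refl]) (use qi(2) sub(2) in blast)
  then have "qi ` x = x'"
    unfolding q(2)[symmetric] by (simp add: image_image)
  moreover have "g ` x = (\<lambda>z. q (g' (qi z))) ` x"
    by (rule image_cong[OF refl]) (use geq sub(1) in blast)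
  then have "g ` x = q ` g' ` qi ` x" by (simp add: image_image)
  ultimately have gx: "g ` x = x" using g'(3) q(2) by simp
  obtain m l h where mlh: "m \<in> isometries False" "m ` {- 1, 1} = x" "l > 1" "h \<in> deck_group p" "h (m 1) = m 1"
    "\<And>z. Im z \<ge> 0 \<Longrightarrow> h (m (cayley z)) = m (cayley (dilation (- l) z))"
    using glide_reflection_coordinates[OF xg g(1) gd gx] by metis
  interpret glide_reflection S p m h l
    using mlh by unfold_locales
  have xm: "x = {m (- 1), m 1}" using mlh(2) by simp
  obtain f K where f: "continuous_map geodesic_topology euclideanreal f" "\<And>y. f y \<ge> 0"
    and K: "compactin geodesic_topology K" "closedin geodesic_topology K" "\<And>y. y \<in> geodesics - K \<Longrightarrow> f y = 0"
    and fx: "f {m (- 1), m 1} > 0"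
    and detect: "\<And>c. c \<in> geodesic_currents p \<Longrightarrow> integral\<^sup>L c f > 0 \<Longrightarrow>
      \<exists>\<delta> \<in> current_support c. \<delta> = {m (- 1), m 1} \<or> (\<exists>F \<subseteq> self_intersections p \<delta>. finite F \<and> card F = k)"
    using detecting_test_function[of k] by blast
  \<comment> \<open>A subbasic weak-star open set: a single test function suffices.\<close>
  define U where "U = {c \<in> geodesic_currents p. integral\<^sup>L c f \<in> {0<..}}"
  have "f \<in> test_functions" using f K unfolding test_functions_def by blast
  then have "openin (current_topology p) U"
    unfolding current_topology_def U_def
    by (intro topology_generated_by_Basis CollectI exI[of _ f] exI[of _ "{0<..}"]) simp
  moreover have "integral\<^sup>L lam f > 0"
    using integral_positive_at_support[OF lam f K x(1)] fx xm by simp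
  then have "lam \<in> U" using lam by (simp add: U_def)
  moreover have "\<exists>\<delta> \<in> current_support c. projection p \<delta> = \<gamma> \<or> (\<exists>F \<subseteq> self_intersections p \<delta>. finite F \<and> card F = k)"
    if "c \<in> U" for c
    using detect[of c] that x(2) xm by (auto simp: U_def)
  ultimately show ?thesis by blast
qed

end
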